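(* Let $A$ and $B$ be special Frobenius algebras over $k$. Let $\tau:B\otimes A\rightarrow A\otimes B$ be a twisting map such that $$(\Delta_A\otimes\Delta_B)\,\tau=(1\otimes\tau\otimes 1)(\tau\otimes\tau)(1\otimes\tau\otimes 1)(\Delta_B\otimes\Delta_A).$$ Then the Frobenius algebra $(A\otimes_{\tau} B,\nabla_{A\otimes_{\tau} B},\eta_{A\otimes_{\tau} B},\Delta_{A\otimes_{\tau} B},\epsilon_{A\otimes_{\tau} B})$ is special.
   Context: $k$ is a field, $\otimes=\otimes_k$, and $1$ denotes identity maps. A Frobenius algebra over $k$ is a tuple $(A,\nabla,\eta,\Delta,\epsilon)$ with $(A,\nabla,\eta)$ an associative unital $k$-algebra, $(A,\Delta,\epsilon)$ a coassociative counital $k$-coalgebra, and $\Delta\nabla=(1\otimes\nabla)(\Delta\otimes 1)=(\nabla\otimes 1)(1\otimes\Delta)$; it is special when $\nabla\Delta=1$. A twisting map for algebras $A$, $B$ is a bijective $k$-linear map $\tau:B\otimes A\to A\otimes B$ such that $\tau(b\otimes 1_A)=1_A\otimes b$ and $\tau(1_B\otimes a)=a\otimes 1_B$ for all $a\in A$, $b\in B$, and $\tau(\nabla_B\otimes\nabla_A)=(\nabla_A\otimes\nabla_B)(1\otimes\tau\otimes 1)(\tau\otimes\tau)(1\otimes\tau\otimes 1)$. The twisted tensor product $A\otimes_\tau B$ is the vector space $A\otimes B$ with $\nabla_{A\otimes_\tau B}=(\nabla_A\otimes\nabla_B)(1\otimes\tau\otimes 1)$, $\eta_{A\otimes_\tau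 B}=\eta_A\otimes\eta_B$, $\Delta_{A\otimes_\tau B}=(1\otimes\tau^{-1}\otimes 1)(\Delta_A\otimes\Delta_B)$, $\epsilon_{A\otimes_\tau B}=\epsilon_A\otimes\epsilon_B$ (using $k\otimes k\cong k$). *)

theory Defs
  imports "HOL-Algebra.Module" "HOL-Algebra.Free_Abelian_Groups"
begin

section \<open>Tensor products of modules\<close>

text \<open>
  HOL-Algebra has no tensor product, so it is constructed here in the usual way: the free abelian
  group on pairs \<open>(m, n)\<close>, modulo the subgroup generated by the bilinearity relations, with the
  scalar action \<open>r (m \<otimes> n) = (r m) \<otimes> n\<close>.
\<close>

definition tensor_relations ::
    "('k, 'r) ring_scheme \<Rightarrow> ('k, 'a, 'm) module_scheme \<Rightarrow> ('k, 'b, 'n) module_scheme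
      \<Rightarrow> ('a \<times> 'b \<Rightarrow>\<^sub>0 int) set" where
  "tensor_relations K M N =
     {frag_of (m \<oplus>\<^bsub>M\<^esub> m', n) - frag_of (m, n) - frag_of (m', n) | m m' n.
        m \<in> carrier M \<and> m' \<in> carrier M \<and> n \<in> carrier N} \<union>
     {frag_of (m, n \<oplus>\<^bsub>N\<^esub> n') - frag_of (m, n) - frag_of (m, n') | m n n'.
        m \<in> carrier M \<and> n \<in> carrier N \<and> n' \<in> carrier N} \<union>
     {frag_of (r \<odot>\<^bsub>M\<^esub> m, n) - frag_of (m, r \<odot>\<^bsub>N\<^esub> n) | r m n.
        r \<in> carrier K \<and> m \<in> carrier M \<and> n \<in> carrier N}"

definition tensor_group ::
    "('k, 'r) ring_scheme \<Rightarrow> ('k, 'a, 'm) module_scheme \<Rightarrow> ('k, 'b, 'n) module_scheme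
      \<Rightarrow> ('a \<times> 'b \<Rightarrow>\<^sub>0 int) set monoid" where
  "tensor_group K M N =
     (let F = free_Abelian_group (carrier M \<times> carrier N)
      in F Mod (generate F (tensor_relations K M N)))"

definition pure_tensor ::
    "('k, 'r) ring_scheme \<Rightarrow> ('k, 'a, 'm) module_scheme \<Rightarrow> ('k, 'b, 'n) module_scheme
      \<Rightarrow> 'a \<Rightarrow> 'b \<Rightarrow> ('a \<times> 'b \<Rightarrow>\<^sub>0 int) set" where
  "pure_tensor K M N m n =
     (let F = free_Abelian_group (carrier M \<times> carrier N)
      in generate F (tensor_relations K M N) #>\<^bsub>F\<^esub> frag_of (m, n))"

text \<open>
  The additive map out of a tensor product, into the abelian group \<open>G\<close>, that sends \<open>m \<otimes> n\<close> to
  \<open>f m n\<close>. If \<open>f\<close> is biadditive and balanced, the sum below takes the same value at all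
  representatives \<open>c\<close> of the coset \<open>t\<close>; otherwise the result is meaningless.
\<close>

definition group_lift :: "('c, 'g) monoid_scheme \<Rightarrow> ('a \<Rightarrow> 'b \<Rightarrow> 'c) \<Rightarrow> ('a \<times> 'b \<Rightarrow>\<^sub>0 int) set \<Rightarrow> 'c"
  where
  "group_lift G f t =
     the_elem ((\<lambda>c. \<Otimes>\<^bsub>G\<^esub>x \<in> Poly_Mapping.keys c.
                       case_prod f x [^]\<^bsub>G\<^esub> Poly_Mapping.lookup c x) ` t)"

text \<open>
  The fields \<open>mult\<close> and \<open>one\<close> of a module record play no role in the locale \<open>module\<close>, hence are
  left unspecified.
\<close>

definition tensor ::
    "('k, 'r) ring_scheme \<Rightarrow> ('k, 'a, 'm) module_scheme \<Rightarrow> ('k, 'b, 'n) module_scheme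
      \<Rightarrow> ('k, ('a \<times> 'b \<Rightarrow>\<^sub>0 int) set) module" where
  "tensor K M N =
     \<lparr>carrier = carrier (tensor_group K M N),
      monoid.mult = undefined,
      monoid.one = undefined,
      ring.zero = \<one>\<^bsub>tensor_group K M N\<^esub>,
      ring.add = monoid.mult (tensor_group K M N),
      smult = (\<lambda>r. group_lift (tensor_group K M N) (\<lambda>m n. pure_tensor K M N (r \<odot>\<^bsub>M\<^esub> m) n))\<rparr>"

definition scalars :: "('k, 'r) ring_scheme \<Rightarrow> ('k, 'k) module" where
  "scalars K =
     \<lparr>carrier = carrier K, monoid.mult = monoid.mult K, monoid.one = \<one>\<^bsub>K\<^esub>,
      ring.zero = \<zero>\<^bsub>K\<^esub>, ring.add = ring.add K,
      smult = monoid.mult K\<rparr>"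

definition linear_maps ::
    "('k, 'r) ring_scheme \<Rightarrow> ('k, 'a, 'm) module_scheme \<Rightarrow> ('k, 'b, 'n) module_scheme
      \<Rightarrow> ('a \<Rightarrow> 'b) set" where
  "linear_maps K M N =
     {f \<in> hom (add_monoid M) (add_monoid N).
        \<forall>r \<in> carrier K. \<forall>x \<in> carrier M. f (r \<odot>\<^bsub>M\<^esub> x) = r \<odot>\<^bsub>N\<^esub> f x}"

definition tensor_lift :: "('k, 'c, 'p) module_scheme \<Rightarrow> ('a \<Rightarrow> 'b \<Rightarrow> 'c) \<Rightarrow> ('a \<times> 'b \<Rightarrow>\<^sub>0 int) set \<Rightarrow> 'c"
  where "tensor_lift P = group_lift (add_monoid P)"

text \<open>\<open>tensor_map K P Q f g\<close> is \<open>f \<otimes> g\<close>, where \<open>P\<close> and \<open>Q\<close> are the codomains of \<open>f\<close> and \<open>g\<close>.\<close>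

definition tensor_map ::
    "('k, 'r) ring_scheme \<Rightarrow> ('k, 'c, 'm) module_scheme \<Rightarrow> ('k, 'd, 'n) module_scheme
      \<Rightarrow> ('a \<Rightarrow> 'c) \<Rightarrow> ('b \<Rightarrow> 'd) \<Rightarrow> ('a \<times> 'b \<Rightarrow>\<^sub>0 int) set \<Rightarrow> ('c \<times> 'd \<Rightarrow>\<^sub>0 int) set" where
  "tensor_map K P Q f g = tensor_lift (tensor K P Q) (\<lambda>m n. pure_tensor K P Q (f m) (g n))"

text \<open>
  The canonical isomorphisms \<open>(L \<otimes> M) \<otimes> N \<cong> L \<otimes> (M \<otimes> N)\<close>, \<open>K \<otimes> M \<cong> M\<close> and \<open>M \<otimes> K \<cong> M\<close>, which
  are usually suppressed.
\<close>

definition tensor_assoc ::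
    "('k, 'r) ring_scheme \<Rightarrow> ('k, 'a, 'l) module_scheme \<Rightarrow> ('k, 'b, 'm) module_scheme
      \<Rightarrow> ('k, 'c, 'n) module_scheme
      \<Rightarrow> (('a \<times> 'b \<Rightarrow>\<^sub>0 int) set \<times> 'c \<Rightarrow>\<^sub>0 int) set \<Rightarrow> ('a \<times> ('b \<times> 'c \<Rightarrow>\<^sub>0 int) set \<Rightarrow>\<^sub>0 int) set" where
  "tensor_assoc K L M N =
     tensor_lift (tensor K L (tensor K M N))
       (\<lambda>t n. tensor_lift (tensor K L (tensor K M N))
          (\<lambda>l m. pure_tensor K L (tensor K M N) l (pure_tensor K M N m n)) t)"

definition tensor_assoc_inv ::
    "('k, 'r) ring_scheme \<Rightarrow> ('k, 'a, 'l) module_scheme \<Rightarrow> ('k, 'b, 'm) module_scheme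
      \<Rightarrow> ('k, 'c, 'n) module_scheme
      \<Rightarrow> ('a \<times> ('b \<times> 'c \<Rightarrow>\<^sub>0 int) set \<Rightarrow>\<^sub>0 int) set \<Rightarrow> (('a \<times> 'b \<Rightarrow>\<^sub>0 int) set \<times> 'c \<Rightarrow>\<^sub>0 int) set" where
  "tensor_assoc_inv K L M N =
     tensor_lift (tensor K (tensor K L M) N)
       (\<lambda>l. tensor_lift (tensor K (tensor K L M) N)
          (\<lambda>m n. pure_tensor K (tensor K L M) N (pure_tensor K L M l m) n))"

definition left_unitor :: "('k, 'a, 'm) module_scheme \<Rightarrow> ('k \<times> 'a \<Rightarrow>\<^sub>0 int) set \<Rightarrow> 'a" where
  "left_unitor M = tensor_lift M (\<lambda>r m. r \<odot>\<^bsub>M\<^esub> m)"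

definition right_unitor :: "('k, 'a, 'm) module_scheme \<Rightarrow> ('a \<times> 'k \<Rightarrow>\<^sub>0 int) set \<Rightarrow> 'a" where
  "right_unitor M = tensor_lift M (\<lambda>m r. r \<odot>\<^bsub>M\<^esub> m)"

text \<open>
  For \<open>f : X \<otimes> Y \<rightarrow> P \<otimes> Q\<close>, the map \<open>1 \<otimes> f \<otimes> 1\<close> from \<open>(W \<otimes> X) \<otimes> (Y \<otimes> Z)\<close> to
  \<open>(W \<otimes> P) \<otimes> (Q \<otimes> Z)\<close>.
\<close>

definition middle_map ::
    "('k, 'r) ring_scheme \<Rightarrow> ('k, 'w) module \<Rightarrow> ('k, 'x) module \<Rightarrow> ('k, 'y) module \<Rightarrow> ('k, 'z) module
      \<Rightarrow> ('k, 'p) module \<Rightarrow> ('k, 'q) module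
      \<Rightarrow> (('x \<times> 'y \<Rightarrow>\<^sub>0 int) set \<Rightarrow> ('p \<times> 'q \<Rightarrow>\<^sub>0 int) set)
      \<Rightarrow> (('w \<times> 'x \<Rightarrow>\<^sub>0 int) set \<times> ('y \<times> 'z \<Rightarrow>\<^sub>0 int) set \<Rightarrow>\<^sub>0 int) set
      \<Rightarrow> (('w \<times> 'p \<Rightarrow>\<^sub>0 int) set \<times> ('q \<times> 'z \<Rightarrow>\<^sub>0 int) set \<Rightarrow>\<^sub>0 int) set" where
  "middle_map K W X Y Z P Q f =
     tensor_assoc_inv K W P (tensor K Q Z)
     \<circ> tensor_map K W (tensor K P (tensor K Q Z)) id
         (tensor_assoc K P Q Z \<circ> tensor_map K (tensor K P Q) Z f id \<circ> tensor_assoc_inv K X Y Z)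
     \<circ> tensor_assoc K W X (tensor K Y Z)"


section \<open>Frobenius algebras\<close>

record ('k, 'a) frobenius =
  space :: "('k, 'a) module"
  nabla :: "('a \<times> 'a \<Rightarrow>\<^sub>0 int) set \<Rightarrow> 'a"
  unit :: "'k \<Rightarrow> 'a"
  delta :: "'a \<Rightarrow> ('a \<times> 'a \<Rightarrow>\<^sub>0 int) set"
  counit :: "'a \<Rightarrow> 'k"

definition assoc_unital_algebra ::
    "('k, 'r) ring_scheme \<Rightarrow> ('k, 'a) module \<Rightarrow> (('a \<times> 'a \<Rightarrow>\<^sub>0 int) set \<Rightarrow> 'a) \<Rightarrow> ('k \<Rightarrow> 'a) \<Rightarrow> bool" where
  "assoc_unital_algebra K V \<mu> \<eta> \<longleftrightarrow>
     module K V \<and>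
     \<mu> \<in> linear_maps K (tensor K V V) V \<and>
     \<eta> \<in> linear_maps K (scalars K) V \<and>
     (\<forall>x \<in> carrier (tensor K (tensor K V V) V).
        \<mu> (tensor_map K V V \<mu> id x) = \<mu> (tensor_map K V V id \<mu> (tensor_assoc K V V V x))) \<and>
     (\<forall>x \<in> carrier (tensor K (scalars K) V). \<mu> (tensor_map K V V \<eta> id x) = left_unitor V x) \<and>
     (\<forall>x \<in> carrier (tensor K V (scalars K)). \<mu> (tensor_map K V V id \<eta> x) = right_unitor V x)"

definition coassoc_counital_coalgebra ::
    "('k, 'r) ring_scheme \<Rightarrow> ('k, 'a) module \<Rightarrow> ('a \<Rightarrow> ('a \<times> 'a \<Rightarrow>\<^sub>0 int) set) \<Rightarrow> ('a \<Rightarrow> 'k) \<Rightarrow> bool" where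
  "coassoc_counital_coalgebra K V \<Delta> \<epsilon> \<longleftrightarrow>
     module K V \<and>
     \<Delta> \<in> linear_maps K V (tensor K V V) \<and>
     \<epsilon> \<in> linear_maps K V (scalars K) \<and>
     (\<forall>v \<in> carrier V.
        tensor_assoc K V V V (tensor_map K (tensor K V V) V \<Delta> id (\<Delta> v))
          = tensor_map K V (tensor K V V) id \<Delta> (\<Delta> v)) \<and>
     (\<forall>v \<in> carrier V. left_unitor V (tensor_map K (scalars K) V \<epsilon> id (\<Delta> v)) = v) \<and>
     (\<forall>v \<in> carrier V. right_unitor V (tensor_map K V (scalars K) id \<epsilon> (\<Delta> v)) = v)"

definition frobenius_algebra :: "('k, 'r) ring_scheme \<Rightarrow> ('k, 'a) frobenius \<Rightarrow> bool" where
  "frobenius_algebra K A \<longleftrightarrow>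
     (let V = space A; \<mu> = nabla A; \<Delta> = delta A in
      assoc_unital_algebra K V \<mu> (unit A) \<and>
      coassoc_counital_coalgebra K V \<Delta> (counit A) \<and>
      (\<forall>x \<in> carrier (tensor K V V).
         \<Delta> (\<mu> x)
           = tensor_map K V V id \<mu> (tensor_assoc K V V V (tensor_map K (tensor K V V) V \<Delta> id x)) \<and>
         \<Delta> (\<mu> x)
           = tensor_map K V V \<mu> id (tensor_assoc_inv K V V V (tensor_map K V (tensor K V V) id \<Delta> x))))"

definition special_frobenius_algebra :: "('k, 'r) ring_scheme \<Rightarrow> ('k, 'a) frobenius \<Rightarrow> bool" where
  "special_frobenius_algebra K A \<longleftrightarrow>
     frobenius_algebra K A \<and> (\<forall>a \<in> carrier (space A). nabla A (delta A a) = a)"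


section \<open>Twisted tensor products\<close>

text \<open>
  The map \<open>(1 \<otimes> \<tau> \<otimes> 1) (\<tau> \<otimes> \<tau>) (1 \<otimes> \<tau> \<otimes> 1)\<close> from \<open>(W \<otimes> W) \<otimes> (V \<otimes> V)\<close> to \<open>(V \<otimes> V) \<otimes> (W \<otimes> W)\<close>,
  for \<open>\<tau> : W \<otimes> V \<rightarrow> V \<otimes> W\<close>.
\<close>

definition double_twist ::
    "('k, 'r) ring_scheme \<Rightarrow> ('k, 'a) module \<Rightarrow> ('k, 'b) module
      \<Rightarrow> (('b \<times> 'a \<Rightarrow>\<^sub>0 int) set \<Rightarrow> ('a \<times> 'b \<Rightarrow>\<^sub>0 int) set)
      \<Rightarrow> (('b \<times> 'b \<Rightarrow>\<^sub>0 int) set \<times> ('a \<times> 'a \<Rightarrow>\<^sub>0 int) set \<Rightarrow>\<^sub>0 int) set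
      \<Rightarrow> (('a \<times> 'a \<Rightarrow>\<^sub>0 int) set \<times> ('b \<times> 'b \<Rightarrow>\<^sub>0 int) set \<Rightarrow>\<^sub>0 int) set" where
  "double_twist K V W \<tau> =
     middle_map K V W V W V W \<tau>
     \<circ> tensor_map K (tensor K V W) (tensor K V W) \<tau> \<tau>
     \<circ> middle_map K W W V V V W \<tau>"

definition twisting_map ::
    "('k, 'r) ring_scheme \<Rightarrow> ('k, 'a) frobenius \<Rightarrow> ('k, 'b) frobenius
      \<Rightarrow> (('b \<times> 'a \<Rightarrow>\<^sub>0 int) set \<Rightarrow> ('a \<times> 'b \<Rightarrow>\<^sub>0 int) set) \<Rightarrow> bool" where
  "twisting_map K A B \<tau> \<longleftrightarrow>
     (let V = space A; W = space B; u\<^sub>A = unit A \<one>\<^bsub>K\<^esub>; u\<^sub>B = unit B \<one>\<^bsub>K\<^esub> in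
      \<tau> \<in> linear_maps K (tensor K W V) (tensor K V W) \<and>
      bij_betw \<tau> (carrier (tensor K W V)) (carrier (tensor K V W)) \<and>
      (\<forall>b \<in> carrier W. \<tau> (pure_tensor K W V b u\<^sub>A) = pure_tensor K V W u\<^sub>A b) \<and>
      (\<forall>a \<in> carrier V. \<tau> (pure_tensor K W V u\<^sub>B a) = pure_tensor K V W a u\<^sub>B) \<and>
      (\<forall>x \<in> carrier (tensor K (tensor K W W) (tensor K V V)).
         \<tau> (tensor_map K W V (nabla B) (nabla A) x)
           = tensor_map K V W (nabla A) (nabla B) (double_twist K V W \<tau> x)))"

text \<open>The unit and counit are composed with \<open>K \<cong> K \<otimes> K\<close>, \<open>r \<mapsto> r \<otimes> 1\<close>, and its inverse \<open>r \<otimes> s \<mapsto> r s\<close>.\<close>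

definition twisted_tensor_product ::
    "('k, 'r) ring_scheme \<Rightarrow> ('k, 'a) frobenius \<Rightarrow> ('k, 'b) frobenius
      \<Rightarrow> (('b \<times> 'a \<Rightarrow>\<^sub>0 int) set \<Rightarrow> ('a \<times> 'b \<Rightarrow>\<^sub>0 int) set) \<Rightarrow> ('k, ('a \<times> 'b \<Rightarrow>\<^sub>0 int) set) frobenius" where
  "twisted_tensor_product K A B \<tau> =
     (let V = space A; W = space B; k = scalars K; \<tau>_inv = inv_into (carrier (tensor K W V)) \<tau> in
      \<lparr>space = tensor K V W,
       nabla = tensor_map K V W (nabla A) (nabla B) \<circ> middle_map K V W V W V W \<tau>,
       unit = (\<lambda>r. tensor_map K V W (unit A) (unit B) (pure_tensor K k k r \<one>\<^bsub>K\<^esub>)),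
       delta = middle_map K V V W W W V \<tau>_inv
                 \<circ> tensor_map K (tensor K V V) (tensor K W W) (delta A) (delta B),
       counit = left_unitor k \<circ> tensor_map K k k (counit A) (counit B)\<rparr>)"

end

theory Submission
  imports Defs
begin

text \<open>
  A unital algebra \<open>C\<close> with a linear form \<open>\<epsilon>\<close> and an element \<open>e\<close> of \<open>C \<otimes> C\<close> with \<open>c e = e c\<close> for all \<open>c\<close>
  and \<open>(\<epsilon> \<otimes> 1) e = 1 = (1 \<otimes> \<epsilon>) e\<close> is a Frobenius algebra with \<open>\<Delta> c = c e\<close>, and every Frobenius algebra arises
  in this way from \<open>e = \<Delta> 1\<close>. So only the algebra structure and the copairing of \<open>A \<otimes>\<^sub>\<tau> B\<close> have to be
  understood. In \<open>A \<otimes>\<^sub>\<tau> B\<close> one has \<open>\<tau> (b \<otimes> a) = b a\<close>, where \<open>A\<close> and \<open>B\<close> are viewed as subalgebras.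
  Write \<open>\<Sum> x \<otimes> y\<close> and \<open>\<Sum> u \<otimes> v\<close> for the copairings of \<open>A\<close> and \<open>B\<close>. Since \<open>A\<close> and \<open>B\<close> are special, the compatibility
  of \<open>\<tau>\<close> with the comultiplications lets each copairing pass through a strand of the other algebra, and
  the copairing of \<open>A \<otimes>\<^sub>\<tau> B\<close> becomes \<open>\<Sum> x u \<otimes> v y = \<Sum> u x \<otimes> y v\<close>. The first form commutes with \<open>A\<close>, the second
  with \<open>B\<close>, and each of them yields one of the counit laws. Specialness is the cancellation of \<open>\<tau>\<close>
  against its inverse.
\<close>

section \<open>The universal property of the tensor product\<close>

text \<open>The conclusion includes the Frobenius property of the twisted product as well as
  specialness. The obstacle is the inverse of \<tau>, which enters the comultiplication and of which
  only the cancellation laws with \<tau> are given. When that inverse is applied to the two middle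
  legs of \<open>s \<otimes> t\<close>, the outermost legs remain free, so left multiplication by A
  and right multiplication by B are immediate; the other two actions run into the inverse. To remove
  it, the comultiplication hypothesis is evaluated at \<open>1 \<otimes> a\<close>, where \<tau> is
  trivial, and the two A legs are multiplied. Multiplicativity of \<tau> fuses the two crossings of
  each B leg into one crossing with the product of the legs of \<Delta> a, which is a by
  specialness. Writing e for the copairing of B, this gives \<open>(\<tau> \<otimes> 1)(1 \<otimes>
  \<tau>)(e \<otimes> a) = a \<otimes> e\<close>, and cancelling the outer \<tau> replaces its
  inverse by \<tau> itself. Copairings and values of \<tau> are not pure tensors, so many auxiliary
  equations hold for an arbitrary tensor in their place and follow from pure tensors by
  linearity.\<close>

lemma (in comm_group) frag_finprod_eq_gfinprod:
  assumes f: "f \<in> S \<rightarrow> carrier G" and c: "Poly_Mapping.keys (c :: 'c \<Rightarrow>\<^sub>0 int) \<subseteq> S"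
  shows "(\<Otimes>x \<in> Poly_Mapping.keys c. f x [^] Poly_Mapping.lookup c x)
           = gfinprod G (\<lambda>x. f x [^] Poly_Mapping.lookup c x) S"
proof -
  have f': "f x \<in> carrier G" if "x \<in> S" for x
    using f that by blast
  have pow': "f x [^] i \<in> carrier G" if "x \<in> S" for x and i :: int
    using f'[OF that] by (rule int_pow_closed)
  have "finprod G (\<lambda>x. f x [^] Poly_Mapping.lookup c x) (Poly_Mapping.keys c)
      = gfinprod G (\<lambda>x. f x [^] Poly_Mapping.lookup c x) (Poly_Mapping.keys c)"
    using c by (intro gfinprod_eq_finprod[symmetric]) (use c in \<open>auto intro!: pow'\<close>)
  also have "\<dots> = gfinprod G (\<lambda>x. f x [^] Poly_Mapping.lookup c x) S"
    using c by (intro gfinprod_mono_neutral_cong_left) (auto simp: in_keys_iff intro!: f')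
  finally show ?thesis .
qed

text \<open>The product in \<open>group_lift\<close> runs over the support, which changes with the
  element. Rewritten over the fixed set \<open>S\<close> by \<open>gfinprod\<close>, the factors of
  two elements multiply index by index. This is the universal property of the free abelian group in
  the form that \<open>group_lift\<close> uses.\<close>

lemma (in comm_group) frag_finprod_hom:
  assumes f: "f \<in> S \<rightarrow> carrier G"
  shows "(\<lambda>c. \<Otimes>x \<in> Poly_Mapping.keys c. f x [^] Poly_Mapping.lookup c x)
           \<in> hom (free_Abelian_group S) G"
proof (rule homI)
  have f': "f x \<in> carrier G" if "x \<in> S" for x
    using f that by blast
  have pow': "f x [^] i \<in> carrier G" if "x \<in> S" for x and i :: int
    using f'[OF that] by (rule int_pow_closed)
  \<comment> \<open>\<open>gfinprod\<close> defaults to \<open>\<one>\<close> when infinitely many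
    factors are nontrivial, and \<open>S\<close> may be infinite; the support bounds the nontrivial
    ones.\<close>
  have fin: "finite {x \<in> S. f x [^] Poly_Mapping.lookup u x \<noteq> \<one>}" for u :: "'c \<Rightarrow>\<^sub>0 int"
    by (rule finite_subset[OF _ finite_keys[of u]]) (auto simp: in_keys_iff)
  fix c d assume c: "c \<in> carrier (free_Abelian_group S)" and d: "d \<in> carrier (free_Abelian_group S)"
  then have cd: "Poly_Mapping.keys (c + d) \<subseteq> S"
    using keys_add[of c d] by auto
  show "(\<Otimes>x\<in>Poly_Mapping.keys c. f x [^] Poly_Mapping.lookup c x) \<in> carrier G"
    using c by (intro finprod_closed) (use c in \<open>auto intro!: pow'\<close>)
  have pow: "(\<lambda>x. f x [^] Poly_Mapping.lookup u x) \<in> S \<rightarrow> carrier G" for u :: "'c \<Rightarrow>\<^sub>0 int"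
    by (auto intro!: pow')
  have "gfinprod G (\<lambda>x. f x [^] Poly_Mapping.lookup (c + d) x) S
      = gfinprod G (\<lambda>x. f x [^] Poly_Mapping.lookup c x \<otimes> f x [^] Poly_Mapping.lookup d x) S"
    by (intro gfinprod_cong) (auto simp: Poly_Mapping.lookup_add int_pow_mult[OF f'] simp_implies_def intro!: pow')
  also have "\<dots> = gfinprod G (\<lambda>x. f x [^] Poly_Mapping.lookup c x) S
      \<otimes> gfinprod G (\<lambda>x. f x [^] Poly_Mapping.lookup d x) S"
    by (rule gfinprod_distrib[OF fin fin pow pow])
  finally show "(\<Otimes>x\<in>Poly_Mapping.keys (c \<otimes>\<^bsub>free_Abelian_group S\<^esub> d).
        f x [^] Poly_Mapping.lookup (c \<otimes>\<^bsub>free_Abelian_group S\<^esub> d) x)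
     = (\<Otimes>x\<in>Poly_Mapping.keys c. f x [^] Poly_Mapping.lookup c x)
       \<otimes> (\<Otimes>x\<in>Poly_Mapping.keys d. f x [^] Poly_Mapping.lookup d x)"
    using f c d cd by (simp add: frag_finprod_eq_gfinprod)
qed

lemma (in comm_group) frag_finprod_frag_of:
  assumes "f y \<in> carrier G"
  shows "(\<Otimes>x \<in> Poly_Mapping.keys (frag_of y). f x [^] Poly_Mapping.lookup (frag_of y) x) = f y"
  using assms by simp

text \<open>The target is only a group, so \<open>pure_tensor\<close> qualifies before its target
  has a scalar action, and that action can itself be obtained by lifting.\<close>

definition balanced_maps ::
    "('k, 'r) ring_scheme \<Rightarrow> ('k, 'a, 'm) module_scheme \<Rightarrow> ('k, 'b, 'n) module_scheme
      \<Rightarrow> ('c, 'g) monoid_scheme \<Rightarrow> ('a \<Rightarrow> 'b \<Rightarrow> 'c) set" where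
  "balanced_maps K M N G =
     {f. (\<forall>m \<in> carrier M. \<forall>n \<in> carrier N. f m n \<in> carrier G) \<and>
         (\<forall>m \<in> carrier M. \<forall>m' \<in> carrier M. \<forall>n \<in> carrier N. f (m \<oplus>\<^bsub>M\<^esub> m') n = f m n \<otimes>\<^bsub>G\<^esub> f m' n) \<and>
         (\<forall>m \<in> carrier M. \<forall>n \<in> carrier N. \<forall>n' \<in> carrier N. f m (n \<oplus>\<^bsub>N\<^esub> n') = f m n \<otimes>\<^bsub>G\<^esub> f m n') \<and>
         (\<forall>r \<in> carrier K. \<forall>m \<in> carrier M. \<forall>n \<in> carrier N. f (r \<odot>\<^bsub>M\<^esub> m) n = f m (r \<odot>\<^bsub>N\<^esub> n))}"

section \<open>The tensor product as a quotient of a free abelian group\<close>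

locale tensor_modules =
  fixes K :: "('k, 'r) ring_scheme"
    and M :: "('k, 'a, 'm) module_scheme" and N :: "('k, 'b, 'n) module_scheme"
  assumes M: "module K M" and N: "module K N"
begin

interpretation M: module K M by (rule M)
interpretation N: module K N by (rule N)

abbreviation "F \<equiv> free_Abelian_group (carrier M \<times> carrier N)"
abbreviation "H \<equiv> generate F (tensor_relations K M N)"

interpretation F: comm_group F by (rule abelian_free_Abelian_group)

lemma tensor_relations_carrier: "tensor_relations K M N \<subseteq> carrier F"
proof -
  have k: "Poly_Mapping.keys (x - y) \<subseteq> S"
    if "Poly_Mapping.keys x \<subseteq> S" "Poly_Mapping.keys y \<subseteq> S" for x y :: "'c \<Rightarrow>\<^sub>0 int" and S
    using keys_diff[of x y] that by blast
  show ?thesis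
  proof
    fix x assume "x \<in> tensor_relations K M N"
    then show "x \<in> carrier F"
      unfolding tensor_relations_def carrier_free_Abelian_group_iff
      by (elim UnE CollectE exE conjE; hypsubst) (intro k; simp)+
  qed
qed

lemma relation_subgroup: "subgroup H F"
  by (rule F.generate_is_subgroup[OF tensor_relations_carrier])

lemma relation_normal: "H \<lhd> F"
  by (simp add: F.normal_iff_subgroup relation_subgroup)

interpretation H: normal H F by (rule relation_normal)

lemma comm_group_tensor_group: "comm_group (tensor_group K M N)"
  unfolding tensor_group_def Let_def by (rule F.abelian_FactGroup[OF relation_subgroup])

lemma pure_tensor_closed_group:
  "\<lbrakk>m \<in> carrier M; n \<in> carrier N\<rbrakk> \<Longrightarrow> pure_tensor K M N m n \<in> carrier (tensor_group K M N)"
  unfolding tensor_group_def pure_tensor_def Let_def carrier_FactGroup by (intro imageI) simp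

lemma coset_hom: "(\<lambda>c. H #>\<^bsub>F\<^esub> c) \<in> hom F (tensor_group K M N)"
  unfolding tensor_group_def Let_def by (rule H.r_coset_hom_Mod)

lemma relation_coset: "c \<in> H \<Longrightarrow> H #>\<^bsub>F\<^esub> c = \<one>\<^bsub>tensor_group K M N\<^esub>"
  unfolding tensor_group_def Let_def one_FactGroup
  by (rule F.coset_join2) (use relation_subgroup in \<open>auto dest: subgroup.mem_carrier simp del: carrier_free_Abelian_group_iff\<close>)

text \<open>The relations are differences for \<open>+\<close>, whereas cosets multiply; this
  converts each relation into an equation of cosets.\<close>

lemma coset_diff:
  assumes "c \<in> carrier F" "d \<in> carrier F"  "c - d \<in> H"
  shows "H #>\<^bsub>F\<^esub> c = H #>\<^bsub>F\<^esub> d"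
proof -
  interpret T: comm_group "tensor_group K M N" by (rule comm_group_tensor_group)
  have cd: "c - d \<in> carrier F"
    by (rule subgroup.mem_carrier[OF relation_subgroup assms(3)])
  have "H #>\<^bsub>F\<^esub> c = H #>\<^bsub>F\<^esub> ((c - d) \<otimes>\<^bsub>F\<^esub> d)"
    by simp
  also have "\<dots> = (H #>\<^bsub>F\<^esub> (c - d)) \<otimes>\<^bsub>tensor_group K M N\<^esub> (H #>\<^bsub>F\<^esub> d)"
    by (rule hom_mult[OF coset_hom cd assms(2)])
  also have "\<dots> = H #>\<^bsub>F\<^esub> d"
    using hom_in_carrier[OF coset_hom assms(2)] by (simp add: relation_coset[OF assms(3)])
  finally show ?thesis .
qed

lemma pure_tensor_balanced: "pure_tensor K M N \<in> balanced_maps K M N (tensor_group K M N)"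
proof -
  have mult: "pure_tensor K M N m n \<otimes>\<^bsub>tensor_group K M N\<^esub> pure_tensor K M N m' n'
      = H #>\<^bsub>F\<^esub> (frag_of (m, n) + frag_of (m', n'))"
    if "m \<in> carrier M" "n \<in> carrier N" "m' \<in> carrier M" "n' \<in> carrier N" for m n m' n'
    using hom_mult[OF coset_hom, of "frag_of (m, n)" "frag_of (m', n')"] that
    by (simp add: pure_tensor_def Let_def)
  have keys: "frag_of (m, n) + frag_of (m', n') \<in> carrier F"
    if "m \<in> carrier M" "n \<in> carrier N" "m' \<in> carrier M" "n' \<in> carrier N" for m n m' n'
    using that F.m_closed[of "frag_of (m, n)" "frag_of (m', n')"] by simp
  \<comment> \<open>\<open>diff_diff_eq\<close> regroups a relation a - b - c as a - (b + c), the
    shape that \<open>coset_diff\<close> expects.\<close>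
  have l1: "frag_of (m \<oplus>\<^bsub>M\<^esub> m', n) - (frag_of (m, n) + frag_of (m', n)) \<in> H"
    if "m \<in> carrier M" "m' \<in> carrier M" "n \<in> carrier N" for m m' n
    by (rule generate.incl) (use that in \<open>force simp: tensor_relations_def diff_diff_eq\<close>)
  have l2: "frag_of (m, n \<oplus>\<^bsub>N\<^esub> n') - (frag_of (m, n) + frag_of (m, n')) \<in> H"
    if "m \<in> carrier M" "n \<in> carrier N" "n' \<in> carrier N" for m n n'
    by (rule generate.incl) (use that in \<open>force simp: tensor_relations_def diff_diff_eq\<close>)
  show ?thesis
    unfolding balanced_maps_def
  proof (intro CollectI conjI ballI)
    fix m m' n assume that: "m \<in> carrier M" "m' \<in> carrier M" "n \<in> carrier N"
    show "pure_tensor K M N (m \<oplus>\<^bsub>M\<^esub> m') n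
        = pure_tensor K M N m n \<otimes>\<^bsub>tensor_group K M N\<^esub> pure_tensor K M N m' n"
      unfolding mult[OF that(1,3) that(2,3)] unfolding pure_tensor_def Let_def
      by (intro coset_diff keys that) (use that in \<open>simp_all add: l1\<close>)
  next
    fix m n n' assume that: "m \<in> carrier M" "n \<in> carrier N" "n' \<in> carrier N"
    show "pure_tensor K M N m (n \<oplus>\<^bsub>N\<^esub> n')
        = pure_tensor K M N m n \<otimes>\<^bsub>tensor_group K M N\<^esub> pure_tensor K M N m n'"
      unfolding mult[OF that(1,2) that(1,3)] unfolding pure_tensor_def Let_def
      by (intro coset_diff keys that) (use that in \<open>simp_all add: l2\<close>)
  next
    fix r m n assume "r \<in> carrier K" "m \<in> carrier M" "n \<in> carrier N"
    then show "pure_tensor K M N (r \<odot>\<^bsub>M\<^esub> m) n = pure_tensor K M N m (r \<odot>\<^bsub>N\<^esub> n)"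
      unfolding pure_tensor_def Let_def
      by (intro coset_diff generate.incl) (auto simp: tensor_relations_def)
  qed (rule pure_tensor_closed_group)
qed

text \<open>The product over a representative is a homomorphism that kills the three kinds of
  relations, hence all of \<open>H\<close>. It is therefore constant on each coset, and
  \<open>the_elem\<close> in \<open>group_lift\<close> is applied to a singleton.\<close>

lemma group_lift_coset:
  assumes G: "comm_group G" and f: "f \<in> balanced_maps K M N G" and c: "c \<in> carrier F"
  shows "group_lift G f (H #>\<^bsub>F\<^esub> c)
    = (\<Otimes>\<^bsub>G\<^esub>x \<in> Poly_Mapping.keys c. case_prod f x [^]\<^bsub>G\<^esub> Poly_Mapping.lookup c x)"
proof -
  interpret G: comm_group G by (rule G)
  define h where "h c = (\<Otimes>\<^bsub>G\<^esub>x \<in> Poly_Mapping.keys c. case_prod f x [^]\<^bsub>G\<^esub> Poly_Mapping.lookup c x)"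
    for c :: "'a \<times> 'b \<Rightarrow>\<^sub>0 int"
  have h: "h \<in> hom F G"
    unfolding h_def using f by (intro G.frag_finprod_hom) (auto simp: balanced_maps_def)
  interpret h: group_hom F G h
    by (unfold_locales) (rule h)
  have h_frag: "h (frag_of (m, n)) = f m n" if "m \<in> carrier M" "n \<in> carrier N" for m n
    unfolding h_def using f that by (subst G.frag_finprod_frag_of) (auto simp: balanced_maps_def)
  have h_diff: "h (x - y) = h x \<otimes>\<^bsub>G\<^esub> inv\<^bsub>G\<^esub> (h y)" "x - y \<in> carrier F"
    if "x \<in> carrier F" "y \<in> carrier F" for x y
  proof -
    have "x - y = x \<otimes>\<^bsub>F\<^esub> inv\<^bsub>F\<^esub> y" using that by simp
    then show "h (x - y) = h x \<otimes>\<^bsub>G\<^esub> inv\<^bsub>G\<^esub> (h y)" "x - y \<in> carrier F"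
      using that by (simp_all only: h.hom_mult h.hom_inv F.inv_closed F.m_closed)
  qed
  have f_closed: "f m n \<in> carrier G" if "m \<in> carrier M" "n \<in> carrier N" for m n
    using f that by (simp add: balanced_maps_def)
  have fr: "frag_of (m, n) \<in> carrier F" if "m \<in> carrier M" "n \<in> carrier N" for m n
    using that by simp
  have "tensor_relations K M N \<subseteq> kernel F G h"
  proof
    fix x assume "x \<in> tensor_relations K M N"
    then consider
      m m' n where "m \<in> carrier M" "m' \<in> carrier M" "n \<in> carrier N"
        "x = frag_of (m \<oplus>\<^bsub>M\<^esub> m', n) - frag_of (m, n) - frag_of (m', n)"
    | m n n' where "m \<in> carrier M" "n \<in> carrier N" "n' \<in> carrier N"
        "x = frag_of (m, n \<oplus>\<^bsub>N\<^esub> n') - frag_of (m, n) - frag_of (m, n')"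
    | r m n where "r \<in> carrier K" "m \<in> carrier M" "n \<in> carrier N"
        "x = frag_of (r \<odot>\<^bsub>M\<^esub> m, n) - frag_of (m, r \<odot>\<^bsub>N\<^esub> n)"
      unfolding tensor_relations_def
      by (elim UnE CollectE exE conjE) ((rule that; assumption)+)
    then show "x \<in> kernel F G h"
    proof cases
      case 1
      then have "h x = f (m \<oplus>\<^bsub>M\<^esub> m') n \<otimes>\<^bsub>G\<^esub> inv\<^bsub>G\<^esub> (f m n) \<otimes>\<^bsub>G\<^esub> inv\<^bsub>G\<^esub> (f m' n)" "x \<in> carrier F"
        by (simp_all add: h_diff fr h_frag del: carrier_free_Abelian_group_iff)
      \<comment> \<open>With the factors in this order, the inverses cancel from the inside by
        associativity alone.\<close>
      moreover have "f (m \<oplus>\<^bsub>M\<^esub> m') n = f m' n \<otimes>\<^bsub>G\<^esub> f m n"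
        using f 1 f_closed by (simp add: balanced_maps_def G.m_comm)
      ultimately show ?thesis
        using 1 f_closed by (simp add: kernel_def G.m_assoc del: carrier_free_Abelian_group_iff)
    next
      case 2
      then have "h x = f m (n \<oplus>\<^bsub>N\<^esub> n') \<otimes>\<^bsub>G\<^esub> inv\<^bsub>G\<^esub> (f m n) \<otimes>\<^bsub>G\<^esub> inv\<^bsub>G\<^esub> (f m n')" "x \<in> carrier F"
        by (simp_all add: h_diff fr h_frag del: carrier_free_Abelian_group_iff)
      moreover have "f m (n \<oplus>\<^bsub>N\<^esub> n') = f m n' \<otimes>\<^bsub>G\<^esub> f m n"
        using f 2 f_closed by (simp add: balanced_maps_def G.m_comm)
      ultimately show ?thesis
        using 2 f_closed by (simp add: kernel_def G.m_assoc del: carrier_free_Abelian_group_iff)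
    next
      case 3
      then have "h x = f (r \<odot>\<^bsub>M\<^esub> m) n \<otimes>\<^bsub>G\<^esub> inv\<^bsub>G\<^esub> (f m (r \<odot>\<^bsub>N\<^esub> n))" "x \<in> carrier F"
        by (simp_all add: h_diff fr h_frag del: carrier_free_Abelian_group_iff)
      moreover have "f (r \<odot>\<^bsub>M\<^esub> m) n = f m (r \<odot>\<^bsub>N\<^esub> n)"
        using f 3 by (simp add: balanced_maps_def)
      ultimately show ?thesis
        using 3 f_closed by (simp add: kernel_def del: carrier_free_Abelian_group_iff)
    qed
  qed
  then have "H \<subseteq> kernel F G h"
    by (rule F.generate_subgroup_incl[OF _ h.subgroup_kernel])
  then have "h (d \<otimes>\<^bsub>F\<^esub> c) = h c" if "d \<in> H" for d
    using that c relation_subgroup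
    by (subst h.hom_mult) (auto simp: kernel_def simp del: carrier_free_Abelian_group_iff mult_free_Abelian_group)
  then have "h ` (H #>\<^bsub>F\<^esub> c) = (\<lambda>d. h c) ` H"
    unfolding r_coset_def UNION_singleton_eq_range image_image by (rule image_cong[OF refl])
  also have "\<dots> = {h c}"
    using subgroup.one_closed[OF relation_subgroup] by blast
  finally have "h ` (H #>\<^bsub>F\<^esub> c) = {h c}" .
  then show ?thesis
    by (simp add: group_lift_def h_def[symmetric])
qed

lemma group_lift_pure:
  assumes G: "comm_group G" and f: "f \<in> balanced_maps K M N G"
    and "m \<in> carrier M" "n \<in> carrier N"
  shows "group_lift G f (pure_tensor K M N m n) = f m n"
proof -
  interpret G: comm_group G by (rule G)
  show ?thesis
    unfolding pure_tensor_def Let_def using assms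
    by (subst group_lift_coset[OF G f]) (auto simp: balanced_maps_def)
qed

lemma group_lift_hom:
  assumes G: "comm_group G" and f: "f \<in> balanced_maps K M N G"
  shows "group_lift G f \<in> hom (tensor_group K M N) G"
proof -
  interpret G: comm_group G by (rule G)
  let ?h = "\<lambda>c. \<Otimes>\<^bsub>G\<^esub>x \<in> Poly_Mapping.keys c. case_prod f x [^]\<^bsub>G\<^esub> Poly_Mapping.lookup c x"
  have h: "?h \<in> hom F G"
    using f by (intro G.frag_finprod_hom) (auto simp: balanced_maps_def)
  have T: "carrier (tensor_group K M N) = (\<lambda>c. H #>\<^bsub>F\<^esub> c) ` carrier F"
    by (simp add: tensor_group_def Let_def carrier_FactGroup)
  show ?thesis
  proof (rule homI)
    fix x assume "x \<in> carrier (tensor_group K M N)"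
    then show "group_lift G f x \<in> carrier G"
      unfolding T using group_lift_coset[OF G f] hom_in_carrier[OF h] by auto
  next
    fix x y assume "x \<in> carrier (tensor_group K M N)" "y \<in> carrier (tensor_group K M N)"
    then obtain c d where c: "c \<in> carrier F" "x = H #>\<^bsub>F\<^esub> c" and d: "d \<in> carrier F" "y = H #>\<^bsub>F\<^esub> d"
      unfolding T by blast
    have "group_lift G f (x \<otimes>\<^bsub>tensor_group K M N\<^esub> y) = group_lift G f (H #>\<^bsub>F\<^esub> (c \<otimes>\<^bsub>F\<^esub> d))"
      using c d by (simp only: hom_mult[OF coset_hom])
    also have "\<dots> = ?h (c \<otimes>\<^bsub>F\<^esub> d)"
      using c d by (intro group_lift_coset[OF G f] F.m_closed)
    also have "\<dots> = ?h c \<otimes>\<^bsub>G\<^esub> ?h d"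
      using c d by (intro hom_mult[OF h])
    finally show "group_lift G f (x \<otimes>\<^bsub>tensor_group K M N\<^esub> y) = group_lift G f x \<otimes>\<^bsub>G\<^esub> group_lift G f y"
      using c d by (simp only: group_lift_coset[OF G f])
  qed
qed

text \<open>Pure tensors are the cosets of the free generators, so agreement on them spreads by
  induction over the free abelian group.\<close>

lemma tensor_group_hom_ext:
  assumes G: "group G" and f: "f \<in> hom (tensor_group K M N) G" and g: "g \<in> hom (tensor_group K M N) G"
    and eq: "\<And>m n. \<lbrakk>m \<in> carrier M; n \<in> carrier N\<rbrakk> \<Longrightarrow> f (pure_tensor K M N m n) = g (pure_tensor K M N m n)"
    and t: "t \<in> carrier (tensor_group K M N)"
  shows "f t = g t"
proof -
  interpret T: comm_group "tensor_group K M N" by (rule comm_group_tensor_group)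
  have hom: "(\<lambda>c. k (H #>\<^bsub>F\<^esub> c)) \<in> hom F G" if "k \<in> hom (tensor_group K M N) G" for k
    using hom_compose[OF coset_hom that] by (simp add: comp_def)
  interpret f: group_hom F G "\<lambda>c. f (H #>\<^bsub>F\<^esub> c)"
    using G hom[OF f] by (simp add: group_hom_def group_hom_axioms_def)
  interpret g: group_hom F G "\<lambda>c. g (H #>\<^bsub>F\<^esub> c)"
    using G hom[OF g] by (simp add: group_hom_def group_hom_axioms_def)
  obtain c where c: "c \<in> carrier F" and tc: "t = H #>\<^bsub>F\<^esub> c"
    using t by (auto simp: tensor_group_def Let_def carrier_FactGroup)
  have "f (H #>\<^bsub>F\<^esub> c) = g (H #>\<^bsub>F\<^esub> c)"
  proof (rule free_Abelian_group_induct[where P="\<lambda>c. f (H #>\<^bsub>F\<^esub> c) = g (H #>\<^bsub>F\<^esub> c)"])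
    show "Poly_Mapping.keys c \<subseteq> carrier M \<times> carrier N"
      using c by simp
    show "f (H #>\<^bsub>F\<^esub> 0) = g (H #>\<^bsub>F\<^esub> 0)"
      using f.hom_one g.hom_one by simp
  next
    fix x y :: "'a \<times> 'b \<Rightarrow>\<^sub>0 int"
    assume xy: "Poly_Mapping.keys x \<subseteq> carrier M \<times> carrier N" "Poly_Mapping.keys y \<subseteq> carrier M \<times> carrier N"
      "f (H #>\<^bsub>F\<^esub> x) = g (H #>\<^bsub>F\<^esub> x)" "f (H #>\<^bsub>F\<^esub> y) = g (H #>\<^bsub>F\<^esub> y)"
    have e: "x - y = x \<otimes>\<^bsub>F\<^esub> inv\<^bsub>F\<^esub> y"
      using xy by simp
    have "x \<in> carrier F" "y \<in> carrier F" "inv\<^bsub>F\<^esub> y \<in> carrier F" using xy by simp_all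
    then show "f (H #>\<^bsub>F\<^esub> (x - y)) = g (H #>\<^bsub>F\<^esub> (x - y))"
      using xy(3,4) by (simp only: e f.hom_mult g.hom_mult f.hom_inv g.hom_inv)
  next
    fix a assume "a \<in> carrier M \<times> carrier N"
    then show "f (H #>\<^bsub>F\<^esub> frag_of a) = g (H #>\<^bsub>F\<^esub> frag_of a)"
      using eq by (auto simp: pure_tensor_def Let_def)
  qed
  then show ?thesis by (simp add: tc)
qed

end

section \<open>Linear and bilinear maps\<close>

lemma comm_group_add_monoid: "module K M \<Longrightarrow> comm_group (add_monoid M)"
  by (simp add: module_def abelian_group.a_comm_group)

lemma linear_maps_closed: "\<lbrakk>f \<in> linear_maps K M N; x \<in> carrier M\<rbrakk> \<Longrightarrow> f x \<in> carrier N"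
  by (auto simp: linear_maps_def hom_def)

lemma linear_maps_add:
  "\<lbrakk>f \<in> linear_maps K M N; x \<in> carrier M; y \<in> carrier M\<rbrakk> \<Longrightarrow> f (x \<oplus>\<^bsub>M\<^esub> y) = f x \<oplus>\<^bsub>N\<^esub> f y"
  by (auto simp: linear_maps_def hom_def)

lemma linear_maps_smult:
  "\<lbrakk>f \<in> linear_maps K M N; r \<in> carrier K; x \<in> carrier M\<rbrakk> \<Longrightarrow> f (r \<odot>\<^bsub>M\<^esub> x) = r \<odot>\<^bsub>N\<^esub> f x"
  by (auto simp: linear_maps_def)

lemma linear_maps_hom: "f \<in> linear_maps K M N \<Longrightarrow> f \<in> hom (add_monoid M) (add_monoid N)"
  by (auto simp: linear_maps_def)

lemma linear_mapsI:
  assumes "\<And>x. x \<in> carrier M \<Longrightarrow> f x \<in> carrier N"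
    and "\<And>x y. \<lbrakk>x \<in> carrier M; y \<in> carrier M\<rbrakk> \<Longrightarrow> f (x \<oplus>\<^bsub>M\<^esub> y) = f x \<oplus>\<^bsub>N\<^esub> f y"
    and "\<And>r x. \<lbrakk>r \<in> carrier K; x \<in> carrier M\<rbrakk> \<Longrightarrow> f (r \<odot>\<^bsub>M\<^esub> x) = r \<odot>\<^bsub>N\<^esub> f x"
  shows "f \<in> linear_maps K M N"
  using assms by (auto simp: linear_maps_def hom_def)

lemma linear_maps_ident [simp]: "(\<lambda>x. x) \<in> linear_maps K M M"
  by (auto simp: linear_maps_def hom_def)

lemma linear_maps_id [simp]: "id \<in> linear_maps K M M"
  by (auto simp: linear_maps_def hom_def)

lemma linear_maps_compose:
  "\<lbrakk>g \<in> linear_maps K N P; f \<in> linear_maps K M N\<rbrakk> \<Longrightarrow> (\<lambda>x. g (f x)) \<in> linear_maps K M P"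
  by (auto simp: linear_maps_def hom_def Pi_iff)

lemma linear_maps_cong:
  assumes "module K M" "f \<in> linear_maps K M N" "\<And>x. x \<in> carrier M \<Longrightarrow> g x = f x"
  shows "g \<in> linear_maps K M N"
proof -
  interpret module K M by fact
  show ?thesis
    by (rule linear_mapsI)
      (simp_all add: assms(3) linear_maps_closed[OF assms(2)] linear_maps_add[OF assms(2)] linear_maps_smult[OF assms(2)])
qed

text \<open>Both linearity laws are checked after applying the injective \<open>f\<close>. Only the
  domain is assumed to be a module; closure of the codomain under its operations is read off from
  surjectivity.\<close>

lemma linear_maps_inv_into:
  assumes "module K M" "f \<in> linear_maps K M N" and bij: "bij_betw f (carrier M) (carrier N)"
  shows "inv_into (carrier M) f \<in> linear_maps K N M"
proof -
  interpret M: module K M by fact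
  have inv: "f (inv_into (carrier M) f y) = y" "inv_into (carrier M) f y \<in> carrier M"
    if "y \<in> carrier N" for y
    using that bij by (auto simp: bij_betw_def f_inv_into_f inv_into_into)
  have inj: "x = y" if "x \<in> carrier M" "y \<in> carrier M" "f x = f y" for x y
    using that bij by (auto simp: bij_betw_def inj_on_def)
  note f = linear_maps_add[OF assms(2)] linear_maps_smult[OF assms(2)] linear_maps_closed[OF assms(2)]
  have N: "x \<oplus>\<^bsub>N\<^esub> y \<in> carrier N" if "x \<in> carrier N" "y \<in> carrier N" for x y
    using f(3)[of "inv_into (carrier M) f x \<oplus>\<^bsub>M\<^esub> inv_into (carrier M) f y"] that by (simp add: f inv)
  have S: "r \<odot>\<^bsub>N\<^esub> x \<in> carrier N" if "x \<in> carrier N" "r \<in> carrier K" for x r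
    using f(3)[of "r \<odot>\<^bsub>M\<^esub> inv_into (carrier M) f x"] that by (simp add: f inv)
  show ?thesis
    by (rule linear_mapsI) (auto simp: inv N S f intro!: inj)
qed

definition bilinear_maps ::
    "('k, 'r) ring_scheme \<Rightarrow> ('k, 'a, 'l) module_scheme \<Rightarrow> ('k, 'b, 'm) module_scheme
      \<Rightarrow> ('k, 'c, 'n) module_scheme \<Rightarrow> ('a \<Rightarrow> 'b \<Rightarrow> 'c) set" where
  "bilinear_maps K M N P =
     {f. (\<forall>m \<in> carrier M. f m \<in> linear_maps K N P) \<and>
         (\<forall>n \<in> carrier N. (\<lambda>m. f m n) \<in> linear_maps K M P)}"

lemma bilinear_mapsI:
  assumes "\<And>m. m \<in> carrier M \<Longrightarrow> (\<lambda>n. f m n) \<in> linear_maps K N P"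
    and "\<And>n. n \<in> carrier N \<Longrightarrow> (\<lambda>m. f m n) \<in> linear_maps K M P"
  shows "f \<in> bilinear_maps K M N P"
  using assms by (auto simp: bilinear_maps_def)

section \<open>The module structure of the tensor product\<close>

context tensor_modules
begin

interpretation M: module K M by (rule M)
interpretation N: module K N by (rule N)
interpretation T: comm_group "tensor_group K M N" by (rule comm_group_tensor_group)

lemma hom_add_monoid_tensor: "hom (add_monoid (tensor K M N)) G = hom (tensor_group K M N) G"
  by (simp add: tensor_def hom_def)

lemma abelian_group_tensor: "abelian_group (tensor K M N)"
  by (rule abelian_groupI)
    (use T.l_inv_ex in \<open>auto simp: tensor_def T.m_ac\<close>)

lemma carrier_tensor: "carrier (tensor K M N) = carrier (tensor_group K M N)"
  by (simp add: tensor_def)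

text \<open>Commutativity of \<open>K\<close> is used here. Scaling the first factor by
  \<open>r\<close> must still let a second scalar \<open>s\<close> move across the tensor sign,
  otherwise the scaling would not descend to the tensor product.\<close>

lemma smult_left_commute:
  "\<lbrakk>r \<in> carrier K; s \<in> carrier K; m \<in> carrier M\<rbrakk> \<Longrightarrow> r \<odot>\<^bsub>M\<^esub> (s \<odot>\<^bsub>M\<^esub> m) = s \<odot>\<^bsub>M\<^esub> (r \<odot>\<^bsub>M\<^esub> m)"
  by (simp add: M.smult_assoc1[symmetric] M.R.m_comm)

lemma smult_balanced:
  "r \<in> carrier K \<Longrightarrow> (\<lambda>m n. pure_tensor K M N (r \<odot>\<^bsub>M\<^esub> m) n) \<in> balanced_maps K M N (tensor_group K M N)"
  using pure_tensor_balanced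
  by (auto simp: balanced_maps_def M.smult_r_distr smult_left_commute)

lemma smult_hom:
  "r \<in> carrier K \<Longrightarrow> smult (tensor K M N) r \<in> hom (tensor_group K M N) (tensor_group K M N)"
  using group_lift_hom[OF comm_group_tensor_group smult_balanced] by (simp add: tensor_def)

lemma smult_pure_group:
  "\<lbrakk>r \<in> carrier K; m \<in> carrier M; n \<in> carrier N\<rbrakk>
    \<Longrightarrow> r \<odot>\<^bsub>tensor K M N\<^esub> pure_tensor K M N m n = pure_tensor K M N (r \<odot>\<^bsub>M\<^esub> m) n"
  using group_lift_pure[OF comm_group_tensor_group smult_balanced] by (simp add: tensor_def)

text \<open>The laws that are not already contained in \<open>smult_hom\<close> compare two
  homomorphisms on the tensor group, so pure tensors suffice, where they become laws of
  \<open>M\<close>.\<close>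

lemma module_tensor_local: "module K (tensor K M N)"
proof (rule moduleI)
  show "cring K" by (rule M.R.is_cring)
  show "abelian_group (tensor K M N)"
    by (rule abelian_group_tensor)
  have T: "ring.add (tensor K M N) = monoid.mult (tensor_group K M N)"
    by (simp add: tensor_def)
  note add = pure_tensor_balanced[unfolded balanced_maps_def, simplified]
  fix r assume r: "r \<in> carrier K"
  show "r \<odot>\<^bsub>tensor K M N\<^esub> x \<in> carrier (tensor K M N)" if "x \<in> carrier (tensor K M N)" for x
    using that hom_in_carrier[OF smult_hom[OF r]] by (simp add: carrier_tensor)
  show "r \<odot>\<^bsub>tensor K M N\<^esub> (x \<oplus>\<^bsub>tensor K M N\<^esub> y)
      = r \<odot>\<^bsub>tensor K M N\<^esub> x \<oplus>\<^bsub>tensor K M N\<^esub> r \<odot>\<^bsub>tensor K M N\<^esub> y"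
    if "x \<in> carrier (tensor K M N)" "y \<in> carrier (tensor K M N)" for x y
    using that hom_mult[OF smult_hom[OF r]] by (simp add: carrier_tensor T)
  fix s x assume s: "s \<in> carrier K" and x: "x \<in> carrier (tensor K M N)"
  then have x': "x \<in> carrier (tensor_group K M N)"
    by (simp add: carrier_tensor)
  show "(r \<oplus>\<^bsub>K\<^esub> s) \<odot>\<^bsub>tensor K M N\<^esub> x
      = r \<odot>\<^bsub>tensor K M N\<^esub> x \<oplus>\<^bsub>tensor K M N\<^esub> s \<odot>\<^bsub>tensor K M N\<^esub> x"
  proof (rule tensor_group_hom_ext[OF T.is_group smult_hom _ _ x'])
    show "(\<lambda>x. r \<odot>\<^bsub>tensor K M N\<^esub> x \<oplus>\<^bsub>tensor K M N\<^esub> s \<odot>\<^bsub>tensor K M N\<^esub> x)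
        \<in> hom (tensor_group K M N) (tensor_group K M N)"
      by (rule homI)
        (simp_all add: T T.m_ac r s hom_in_carrier[OF smult_hom] hom_mult[OF smult_hom])
  qed (use r s in \<open>simp_all add: smult_pure_group M.smult_l_distr add T\<close>)
  show "(r \<otimes>\<^bsub>K\<^esub> s) \<odot>\<^bsub>tensor K M N\<^esub> x = r \<odot>\<^bsub>tensor K M N\<^esub> (s \<odot>\<^bsub>tensor K M N\<^esub> x)"
  proof (rule tensor_group_hom_ext[OF T.is_group smult_hom _ _ x'])
    show "(\<lambda>x. r \<odot>\<^bsub>tensor K M N\<^esub> (s \<odot>\<^bsub>tensor K M N\<^esub> x))
        \<in> hom (tensor_group K M N) (tensor_group K M N)"
      using hom_compose[OF smult_hom[OF s] smult_hom[OF r]] by (simp add: comp_def)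
  qed (use r s in \<open>simp_all add: smult_pure_group M.smult_assoc1\<close>)
next
  fix x assume "x \<in> carrier (tensor K M N)"
  then have x': "x \<in> carrier (tensor_group K M N)"
    by (simp add: carrier_tensor)
  show "\<one>\<^bsub>K\<^esub> \<odot>\<^bsub>tensor K M N\<^esub> x = x"
  proof (rule tensor_group_hom_ext[OF T.is_group smult_hom _ _ x', where g="\<lambda>x. x"])
    show "(\<lambda>x. x) \<in> hom (tensor_group K M N) (tensor_group K M N)"
      by (simp add: hom_def)
  qed (simp_all add: smult_pure_group)
qed

end

lemma module_tensor [simp]: "\<lbrakk>module K M; module K N\<rbrakk> \<Longrightarrow> module K (tensor K M N)"
  by (rule tensor_modules.module_tensor_local[OF tensor_modules.intro])

lemma pure_tensor_closed [simp]:
  assumes "module K M" "module K N" "m \<in> carrier M" "n \<in> carrier N"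
  shows "pure_tensor K M N m n \<in> carrier (tensor K M N)"
proof -
  interpret tensor_modules K M N by (rule tensor_modules.intro[OF assms(1,2)])
  show ?thesis using assms by (simp add: carrier_tensor pure_tensor_closed_group)
qed

lemma pure_tensor_bilinear:
  assumes "module K M" "module K N"
  shows "pure_tensor K M N \<in> bilinear_maps K M N (tensor K M N)"
proof -
  interpret tensor_modules K M N by (rule tensor_modules.intro[OF assms])
  have T: "ring.add (tensor K M N) = monoid.mult (tensor_group K M N)"
    by (simp add: tensor_def)
  note add = pure_tensor_balanced[unfolded balanced_maps_def, simplified]
  show ?thesis
    by (intro bilinear_mapsI linear_mapsI)
      (use assms in \<open>simp_all add: add smult_pure_group T\<close>)
qed

lemma linear_maps_pure_tensor_left:
  assumes "module K M" "module K N" "f \<in> linear_maps K L M" "n \<in> carrier N"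
  shows "(\<lambda>x. pure_tensor K M N (f x) n) \<in> linear_maps K L (tensor K M N)"
  using pure_tensor_bilinear[OF assms(1,2)] assms(3,4)
  by - (rule linear_maps_compose[of "\<lambda>m. pure_tensor K M N m n" K M _ f], simp_all add: bilinear_maps_def)

lemma linear_maps_pure_tensor_right:
  assumes "module K M" "module K N" "f \<in> linear_maps K L N" "m \<in> carrier M"
  shows "(\<lambda>x. pure_tensor K M N m (f x)) \<in> linear_maps K L (tensor K M N)"
  using pure_tensor_bilinear[OF assms(1,2)] assms(3,4)
  by - (rule linear_maps_compose[of "pure_tensor K M N m" K N _ f], simp_all add: bilinear_maps_def)

lemma linear_maps_pure_tensor [simp]:
  assumes "module K M" "module K N"
  shows "n \<in> carrier N \<Longrightarrow> (\<lambda>m. pure_tensor K M N m n) \<in> linear_maps K M (tensor K M N)"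
    and "m \<in> carrier M \<Longrightarrow> pure_tensor K M N m \<in> linear_maps K N (tensor K M N)"
  using pure_tensor_bilinear[OF assms] by (simp_all add: bilinear_maps_def)

lemma pure_tensor_smult_left:
  assumes "module K M" "module K N" "r \<in> carrier K" "m \<in> carrier M" "n \<in> carrier N"
  shows "pure_tensor K M N (r \<odot>\<^bsub>M\<^esub> m) n = r \<odot>\<^bsub>tensor K M N\<^esub> pure_tensor K M N m n"
  using linear_maps_smult[OF linear_maps_pure_tensor_left[OF assms(1,2) linear_maps_ident assms(5)] assms(3,4)] .

lemma pure_tensor_smult_right:
  assumes "module K M" "module K N" "r \<in> carrier K" "m \<in> carrier M" "n \<in> carrier N"
  shows "pure_tensor K M N m (r \<odot>\<^bsub>N\<^esub> n) = r \<odot>\<^bsub>tensor K M N\<^esub> pure_tensor K M N m n"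
  using linear_maps_smult[OF linear_maps_pure_tensor_right[OF assms(1,2) linear_maps_ident assms(4)] assms(3,5)] .

text \<open>The principle behind nearly all later identities: linearity of both sides reduces them
  to pure tensors. Iterated tensor products take one application for each level.\<close>

lemma tensor_ext:
  assumes "module K M" "module K N" "module K P"
    and "t \<in> carrier (tensor K M N)"
    and "f \<in> linear_maps K (tensor K M N) P" "g \<in> linear_maps K (tensor K M N) P"
    and "\<And>m n. \<lbrakk>m \<in> carrier M; n \<in> carrier N\<rbrakk> \<Longrightarrow> f (pure_tensor K M N m n) = g (pure_tensor K M N m n)"
  shows "f t = g t"
proof -
  interpret tensor_modules K M N by (rule tensor_modules.intro[OF assms(1,2)])
  interpret P: comm_group "add_monoid P" by (rule comm_group_add_monoid[OF assms(3)])
  show ?thesis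
    using assms(5,6)[THEN linear_maps_hom, unfolded hom_add_monoid_tensor] assms(4,7)
    by - (rule tensor_group_hom_ext[OF P.is_group], simp_all add: carrier_tensor)
qed

section \<open>Linear extension of bilinear maps\<close>

lemma bilinear_balanced:
  assumes "f \<in> bilinear_maps K M N P"
  shows "f \<in> balanced_maps K M N (add_monoid P)"
  using assms by (auto simp: bilinear_maps_def balanced_maps_def linear_maps_def hom_def Pi_iff)

lemma tensor_lift_pure:
  assumes "module K M" "module K N" "module K P" "f \<in> bilinear_maps K M N P" "m \<in> carrier M" "n \<in> carrier N"
  shows "tensor_lift P f (pure_tensor K M N m n) = f m n"
  using tensor_modules.group_lift_pure[OF tensor_modules.intro[OF assms(1,2)] comm_group_add_monoid[OF assms(3)]
      bilinear_balanced[OF assms(4)] assms(5,6)]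
  by (simp add: tensor_lift_def)

text \<open>Additivity is inherited from \<open>group_lift\<close>. Compatibility with a scalar
  holds because scaling before and scaling after the lift are two additive maps that agree on pure
  tensors.\<close>

lemma tensor_lift_linear:
  assumes "module K M" "module K N" "module K P" "f \<in> bilinear_maps K M N P"
  shows "tensor_lift P f \<in> linear_maps K (tensor K M N) P"
proof (rule linear_mapsI)
  interpret tensor_modules K M N by (rule tensor_modules.intro[OF assms(1,2)])
  interpret M: module K M by fact
  interpret N: module K N by fact
  interpret P: module K P by fact
  interpret T: module K "tensor K M N" using assms by simp
  have hom: "tensor_lift P f \<in> hom (add_monoid (tensor K M N)) (add_monoid P)"
    using group_lift_hom[OF comm_group_add_monoid[OF assms(3)] bilinear_balanced[OF assms(4)]]
    by (simp add: tensor_lift_def hom_add_monoid_tensor)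
  show c: "tensor_lift P f x \<in> carrier P" if "x \<in> carrier (tensor K M N)" for x
    using hom_in_carrier[OF hom] that by simp
  show "tensor_lift P f (x \<oplus>\<^bsub>tensor K M N\<^esub> y) = tensor_lift P f x \<oplus>\<^bsub>P\<^esub> tensor_lift P f y"
    if "x \<in> carrier (tensor K M N)" "y \<in> carrier (tensor K M N)" for x y
    using hom_mult[OF hom] that by simp
  fix r x assume r: "r \<in> carrier K" and x: "x \<in> carrier (tensor K M N)"
  have rP: "smult P r \<in> hom (add_monoid P) (add_monoid P)"
    using r by (simp add: hom_def P.smult_r_distr)
  have rT: "smult (tensor K M N) r \<in> hom (add_monoid (tensor K M N)) (add_monoid (tensor K M N))"
    using r by (simp add: hom_def T.smult_r_distr)
  have "(tensor_lift P f \<circ> smult (tensor K M N) r) x = (smult P r \<circ> tensor_lift P f) x"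
  proof (rule tensor_group_hom_ext[where G="add_monoid P"])
    show "Group.group (add_monoid P)"
      using comm_group_add_monoid[OF assms(3)] by (simp add: comm_group.axioms)
    show "x \<in> carrier (tensor_group K M N)"
      using x by (simp add: carrier_tensor)
  next
    fix m n assume mn: "m \<in> carrier M" "n \<in> carrier N"
    have "f (r \<odot>\<^bsub>M\<^esub> m) n = r \<odot>\<^bsub>P\<^esub> f m n"
      using assms(4) mn r linear_maps_smult[of "\<lambda>m. f m n" K M P r m] by (simp add: bilinear_maps_def)
    then show "(tensor_lift P f \<circ> smult (tensor K M N) r) (pure_tensor K M N m n)
        = (smult P r \<circ> tensor_lift P f) (pure_tensor K M N m n)"
      using mn r by (simp add: smult_pure_group tensor_lift_pure[OF assms])
  qed (use hom_compose[OF rT hom] hom_compose[OF hom rP] in \<open>simp_all add: comp_def hom_add_monoid_tensor\<close>)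
  then show "tensor_lift P f (r \<odot>\<^bsub>tensor K M N\<^esub> x) = r \<odot>\<^bsub>P\<^esub> tensor_lift P f x"
    by simp
qed

lemma tensor_map_bilinear:
  assumes "module K P" "module K Q" "f \<in> linear_maps K M P" "g \<in> linear_maps K N Q"
  shows "(\<lambda>m n. pure_tensor K P Q (f m) (g n)) \<in> bilinear_maps K M N (tensor K P Q)"
  using assms
  by (intro bilinear_mapsI linear_maps_pure_tensor_left linear_maps_pure_tensor_right) (simp_all add: linear_maps_closed)

lemma tensor_map_linear:
  assumes "module K M" "module K N" "module K P" "module K Q" "f \<in> linear_maps K M P" "g \<in> linear_maps K N Q"
  shows "tensor_map K P Q f g \<in> linear_maps K (tensor K M N) (tensor K P Q)"
  unfolding tensor_map_def using assms
  by (intro tensor_lift_linear tensor_map_bilinear) simp_all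

lemma tensor_map_pure:
  assumes "module K M" "module K N" "module K P" "module K Q" "f \<in> linear_maps K M P" "g \<in> linear_maps K N Q"
    "m \<in> carrier M" "n \<in> carrier N"
  shows "tensor_map K P Q f g (pure_tensor K M N m n) = pure_tensor K P Q (f m) (g n)"
  unfolding tensor_map_def using assms
  by (subst tensor_lift_pure[where P="tensor K P Q" and f="\<lambda>m n. pure_tensor K P Q (f m) (g n)"])
     (simp_all add: tensor_map_bilinear)

text \<open>Linearity in a parameter of the lifted map, with the tensor held fixed. The associator
  needs it, being a lift whose values are again lifts, and so do maps that send an element to its
  action on a fixed copairing. The laws in the parameter are identities of linear maps in
  \<open>t\<close>, so pure tensors decide them.\<close>

lemma linear_maps_tensor_lift_param:
  assumes "module K L" "module K M" "module K N" "module K P"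
    and f: "\<And>l. l \<in> carrier L \<Longrightarrow> f l \<in> bilinear_maps K M N P"
    and l: "\<And>m n. \<lbrakk>m \<in> carrier M; n \<in> carrier N\<rbrakk> \<Longrightarrow> (\<lambda>l. f l m n) \<in> linear_maps K L P"
    and t: "t \<in> carrier (tensor K M N)"
  shows "(\<lambda>l. tensor_lift P (f l) t) \<in> linear_maps K L P"
proof -
  interpret L: module K L by fact
  interpret P: module K P by fact
  note lin = tensor_lift_linear[OF assms(2-4) f]
  note pure = tensor_lift_pure[OF assms(2-4) f]
  show ?thesis
  proof (rule linear_mapsI)
    show "tensor_lift P (f x) t \<in> carrier P" if "x \<in> carrier L" for x
      using linear_maps_closed[OF lin[OF that] t] .
  next
    fix x y assume xy: "x \<in> carrier L" "y \<in> carrier L"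
    have xy': "x \<oplus>\<^bsub>L\<^esub> y \<in> carrier L" using xy by simp
    show "tensor_lift P (f (x \<oplus>\<^bsub>L\<^esub> y)) t = tensor_lift P (f x) t \<oplus>\<^bsub>P\<^esub> tensor_lift P (f y) t"
    proof (rule tensor_ext[OF assms(2-4) t lin[OF xy']])
      show "(\<lambda>t. tensor_lift P (f x) t \<oplus>\<^bsub>P\<^esub> tensor_lift P (f y) t) \<in> linear_maps K (tensor K M N) P"
        using xy lin[THEN linear_maps_closed] lin[THEN linear_maps_add] lin[THEN linear_maps_smult]
        by (intro linear_mapsI) (simp_all add: P.a_ac P.smult_r_distr)
      show "tensor_lift P (f (x \<oplus>\<^bsub>L\<^esub> y)) (pure_tensor K M N m n)
          = tensor_lift P (f x) (pure_tensor K M N m n) \<oplus>\<^bsub>P\<^esub> tensor_lift P (f y) (pure_tensor K M N m n)"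
        if "m \<in> carrier M" "n \<in> carrier N" for m n
        using that xy xy' linear_maps_add[OF l] by (simp add: pure)
    qed
  next
    fix r x assume r: "r \<in> carrier K" and x: "x \<in> carrier L"
    have rx: "r \<odot>\<^bsub>L\<^esub> x \<in> carrier L" using r x by simp
    show "tensor_lift P (f (r \<odot>\<^bsub>L\<^esub> x)) t = r \<odot>\<^bsub>P\<^esub> tensor_lift P (f x) t"
    proof (rule tensor_ext[OF assms(2-4) t lin[OF rx]])
      show "(\<lambda>t. r \<odot>\<^bsub>P\<^esub> tensor_lift P (f x) t) \<in> linear_maps K (tensor K M N) P"
        using r x lin[THEN linear_maps_closed] lin[THEN linear_maps_add] lin[THEN linear_maps_smult]
        by (intro linear_mapsI)
          (simp_all add: P.smult_r_distr P.smult_assoc1[symmetric] L.R.m_comm)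
      show "tensor_lift P (f (r \<odot>\<^bsub>L\<^esub> x)) (pure_tensor K M N m n)
          = r \<odot>\<^bsub>P\<^esub> tensor_lift P (f x) (pure_tensor K M N m n)"
        if "m \<in> carrier M" "n \<in> carrier N" for m n
        using that r x rx linear_maps_smult[OF l] by (simp add: pure)
    qed
  qed
qed

section \<open>The associativity and unit isomorphisms\<close>

lemma tensor_assoc_aux:
  assumes "module K L" "module K M" "module K N"
  shows "n \<in> carrier N \<Longrightarrow> (\<lambda>l m. pure_tensor K L (tensor K M N) l (pure_tensor K M N m n))
      \<in> bilinear_maps K L M (tensor K L (tensor K M N))"
    and "(\<lambda>t n. tensor_lift (tensor K L (tensor K M N))
          (\<lambda>l m. pure_tensor K L (tensor K M N) l (pure_tensor K M N m n)) t)
      \<in> bilinear_maps K (tensor K L M) N (tensor K L (tensor K M N))"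
proof -
  show 1: "(\<lambda>l m. pure_tensor K L (tensor K M N) l (pure_tensor K M N m n))
      \<in> bilinear_maps K L M (tensor K L (tensor K M N))" if "n \<in> carrier N" for n
    using assms that by (intro bilinear_mapsI linear_maps_pure_tensor_left linear_maps_pure_tensor_right) simp_all
  show "(\<lambda>t n. tensor_lift (tensor K L (tensor K M N))
          (\<lambda>l m. pure_tensor K L (tensor K M N) l (pure_tensor K M N m n)) t)
      \<in> bilinear_maps K (tensor K L M) N (tensor K L (tensor K M N))"
    using assms 1
    by (intro bilinear_mapsI tensor_lift_linear linear_maps_tensor_lift_param linear_maps_pure_tensor_right) simp_all
qed

lemma tensor_assoc_linear:
  assumes "module K L" "module K M" "module K N"
  shows "tensor_assoc K L M N \<in> linear_maps K (tensor K (tensor K L M) N) (tensor K L (tensor K M N))"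
  unfolding tensor_assoc_def using assms by (intro tensor_lift_linear tensor_assoc_aux) simp_all

lemma tensor_assoc_pure:
  assumes "module K L" "module K M" "module K N" "l \<in> carrier L" "m \<in> carrier M" "n \<in> carrier N"
  shows "tensor_assoc K L M N (pure_tensor K (tensor K L M) N (pure_tensor K L M l m) n)
    = pure_tensor K L (tensor K M N) l (pure_tensor K M N m n)"
  unfolding tensor_assoc_def using assms
  by (subst tensor_lift_pure[OF _ _ _ tensor_assoc_aux(2)]) (simp_all add: tensor_lift_pure[OF _ _ _ tensor_assoc_aux(1)])

lemma tensor_assoc_inv_aux:
  assumes "module K L" "module K M" "module K N"
  shows "l \<in> carrier L \<Longrightarrow> (\<lambda>m n. pure_tensor K (tensor K L M) N (pure_tensor K L M l m) n)
      \<in> bilinear_maps K M N (tensor K (tensor K L M) N)"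
    and "(\<lambda>l. tensor_lift (tensor K (tensor K L M) N)
          (\<lambda>m n. pure_tensor K (tensor K L M) N (pure_tensor K L M l m) n))
      \<in> bilinear_maps K L (tensor K M N) (tensor K (tensor K L M) N)"
proof -
  show 1: "(\<lambda>m n. pure_tensor K (tensor K L M) N (pure_tensor K L M l m) n)
      \<in> bilinear_maps K M N (tensor K (tensor K L M) N)" if "l \<in> carrier L" for l
    using assms that by (intro bilinear_mapsI linear_maps_pure_tensor_left linear_maps_pure_tensor_right) simp_all
  show "(\<lambda>l. tensor_lift (tensor K (tensor K L M) N)
          (\<lambda>m n. pure_tensor K (tensor K L M) N (pure_tensor K L M l m) n))
      \<in> bilinear_maps K L (tensor K M N) (tensor K (tensor K L M) N)"
    using assms 1
    by (intro bilinear_mapsI tensor_lift_linear linear_maps_tensor_lift_param linear_maps_pure_tensor_left) simp_all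
qed

lemma tensor_assoc_inv_linear:
  assumes "module K L" "module K M" "module K N"
  shows "tensor_assoc_inv K L M N \<in> linear_maps K (tensor K L (tensor K M N)) (tensor K (tensor K L M) N)"
  unfolding tensor_assoc_inv_def using assms by (intro tensor_lift_linear tensor_assoc_inv_aux) simp_all

lemma tensor_assoc_inv_pure:
  assumes "module K L" "module K M" "module K N" "l \<in> carrier L" "m \<in> carrier M" "n \<in> carrier N"
  shows "tensor_assoc_inv K L M N (pure_tensor K L (tensor K M N) l (pure_tensor K M N m n))
    = pure_tensor K (tensor K L M) N (pure_tensor K L M l m) n"
  unfolding tensor_assoc_inv_def using assms
  by (subst tensor_lift_pure[OF _ _ _ tensor_assoc_inv_aux(2)]) (simp_all add: tensor_lift_pure[OF _ _ _ tensor_assoc_inv_aux(1)])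

lemma carrier_scalars [simp]: "carrier (scalars K) = carrier K"
  and smult_scalars [simp]: "r \<odot>\<^bsub>scalars K\<^esub> s = r \<otimes>\<^bsub>K\<^esub> s"
  and add_scalars [simp]: "r \<oplus>\<^bsub>scalars K\<^esub> s = r \<oplus>\<^bsub>K\<^esub> s"
  by (simp_all add: scalars_def)

lemma module_scalars [simp]:
  assumes "cring K" shows "module K (scalars K)"
proof -
  interpret cring K by fact
  show ?thesis
  proof (rule moduleI)
    show "abelian_group (scalars K)"
      by (rule abelian_groupI) (use add.l_inv_ex in \<open>auto simp: scalars_def a_ac\<close>)
  qed (simp_all add: l_distr r_distr m_assoc is_cring)
qed

lemma scalars_smult_bilinear:
  assumes "module K M"
  shows "smult M \<in> bilinear_maps K (scalars K) M M"
    and "(\<lambda>m r. r \<odot>\<^bsub>M\<^esub> m) \<in> bilinear_maps K M (scalars K) M"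
proof -
  interpret module K M by fact
  have 1: "smult M r \<in> linear_maps K M M" if "r \<in> carrier K" for r
    using that by (intro linear_mapsI) (simp_all add: smult_r_distr smult_assoc1[symmetric] m_comm)
  have 2: "(\<lambda>r. r \<odot>\<^bsub>M\<^esub> m) \<in> linear_maps K (scalars K) M" if "m \<in> carrier M" for m
    using that by (intro linear_mapsI) (simp_all add: smult_l_distr smult_assoc1)
  show "smult M \<in> bilinear_maps K (scalars K) M M" "(\<lambda>m r. r \<odot>\<^bsub>M\<^esub> m) \<in> bilinear_maps K M (scalars K) M"
    using 1 2 by (auto simp: bilinear_maps_def)
qed

lemma module_imp_cring: "module K M \<Longrightarrow> cring K"
  by (simp add: module_def)

lemma left_unitor_linear: "module K M \<Longrightarrow> left_unitor M \<in> linear_maps K (tensor K (scalars K) M) M"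
  unfolding left_unitor_def
  by (intro tensor_lift_linear scalars_smult_bilinear) (simp_all add: module_imp_cring)

lemma left_unitor_pure:
  "\<lbrakk>module K M; r \<in> carrier K; m \<in> carrier M\<rbrakk> \<Longrightarrow> left_unitor M (pure_tensor K (scalars K) M r m) = r \<odot>\<^bsub>M\<^esub> m"
  unfolding left_unitor_def
  by (subst tensor_lift_pure[OF _ _ _ scalars_smult_bilinear(1)]) (simp_all add: module_imp_cring)

lemma right_unitor_linear: "module K M \<Longrightarrow> right_unitor M \<in> linear_maps K (tensor K M (scalars K)) M"
  unfolding right_unitor_def
  by (intro tensor_lift_linear scalars_smult_bilinear) (simp_all add: module_imp_cring)

lemma right_unitor_pure:
  "\<lbrakk>module K M; r \<in> carrier K; m \<in> carrier M\<rbrakk> \<Longrightarrow> right_unitor M (pure_tensor K M (scalars K) m r) = r \<odot>\<^bsub>M\<^esub> m"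
  unfolding right_unitor_def
  by (subst tensor_lift_pure[OF _ _ _ scalars_smult_bilinear(2)]) (simp_all add: module_imp_cring)

section \<open>Calculus of tensor maps\<close>

lemma linear_maps_tensor_map:
  assumes "h \<in> linear_maps K L (tensor K M N)" "f \<in> linear_maps K M P" "g \<in> linear_maps K N Q"
    "module K M" "module K N" "module K P" "module K Q"
  shows "(\<lambda>x. tensor_map K P Q f g (h x)) \<in> linear_maps K L (tensor K P Q)"
  by (rule linear_maps_compose[OF tensor_map_linear]) fact+

lemma linear_maps_tensor_assoc:
  assumes "h \<in> linear_maps K X (tensor K (tensor K L M) N)" "module K L" "module K M" "module K N"
  shows "(\<lambda>x. tensor_assoc K L M N (h x)) \<in> linear_maps K X (tensor K L (tensor K M N))"
  by (rule linear_maps_compose[OF tensor_assoc_linear]) fact+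

lemma linear_maps_tensor_assoc_inv:
  assumes "h \<in> linear_maps K X (tensor K L (tensor K M N))" "module K L" "module K M" "module K N"
  shows "(\<lambda>x. tensor_assoc_inv K L M N (h x)) \<in> linear_maps K X (tensor K (tensor K L M) N)"
  by (rule linear_maps_compose[OF tensor_assoc_inv_linear]) fact+

lemma linear_maps_left_unitor:
  assumes "h \<in> linear_maps K X (tensor K (scalars K) M)" "module K M"
  shows "(\<lambda>x. left_unitor M (h x)) \<in> linear_maps K X M"
  by (rule linear_maps_compose[OF left_unitor_linear]) fact+

lemma linear_maps_right_unitor:
  assumes "h \<in> linear_maps K X (tensor K M (scalars K))" "module K M"
  shows "(\<lambda>x. right_unitor M (h x)) \<in> linear_maps K X M"
  by (rule linear_maps_compose[OF right_unitor_linear]) fact+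

text \<open>The variable sits inside one of the two maps instead of in the tensor, as in
  \<open>act_left x t\<close> regarded as a function of \<open>x\<close>.\<close>

lemma linear_maps_tensor_map_param_left:
  assumes "t \<in> carrier (tensor K M N)" "g \<in> linear_maps K N Q"
    and "\<And>x. x \<in> carrier L \<Longrightarrow> F x \<in> linear_maps K M P"
    and "\<And>m. m \<in> carrier M \<Longrightarrow> (\<lambda>x. F x m) \<in> linear_maps K L P"
    and "module K L" "module K M" "module K N" "module K P" "module K Q"
  shows "(\<lambda>x. tensor_map K P Q (F x) g t) \<in> linear_maps K L (tensor K P Q)"
  unfolding tensor_map_def
  by (rule linear_maps_tensor_lift_param[where M=M and N=N])
    (use assms in \<open>simp_all add: tensor_map_bilinear linear_maps_pure_tensor_left linear_maps_closed\<close>)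

lemma linear_maps_tensor_map_param_right:
  assumes "t \<in> carrier (tensor K M N)" "f \<in> linear_maps K M P"
    and "\<And>x. x \<in> carrier L \<Longrightarrow> G x \<in> linear_maps K N Q"
    and "\<And>n. n \<in> carrier N \<Longrightarrow> (\<lambda>x. G x n) \<in> linear_maps K L Q"
    and "module K L" "module K M" "module K N" "module K P" "module K Q"
  shows "(\<lambda>x. tensor_map K P Q f (G x) t) \<in> linear_maps K L (tensor K P Q)"
  unfolding tensor_map_def
  by (rule linear_maps_tensor_lift_param[where M=M and N=N])
    (use assms in \<open>simp_all add: tensor_map_bilinear linear_maps_pure_tensor_right linear_maps_closed\<close>)

text \<open>Resolution with these rules follows the syntax of a composite, and unification supplies
  the intermediate modules.\<close>

lemmas linear_maps_tensor_intros =
  linear_maps_ident linear_maps_id linear_maps_pure_tensor_left linear_maps_pure_tensor_right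
  linear_maps_tensor_map linear_maps_tensor_assoc linear_maps_tensor_assoc_inv
  linear_maps_left_unitor linear_maps_right_unitor

lemma tensor_map_closed:
  assumes "t \<in> carrier (tensor K M N)" "f \<in> linear_maps K M P" "g \<in> linear_maps K N Q"
    "module K M" "module K N" "module K P" "module K Q"
  shows "tensor_map K P Q f g t \<in> carrier (tensor K P Q)"
  using linear_maps_closed[OF tensor_map_linear] assms by blast

lemma tensor_map_cong:
  assumes "t \<in> carrier (tensor K M N)" "f \<in> linear_maps K M P" "g \<in> linear_maps K N Q"
    "module K M" "module K N" "module K P" "module K Q"
    and f: "\<And>m. m \<in> carrier M \<Longrightarrow> f m = f' m" and g: "\<And>n. n \<in> carrier N \<Longrightarrow> g n = g' n"
  shows "tensor_map K P Q f g t = tensor_map K P Q f' g' t"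
proof -
  have f': "f' \<in> linear_maps K M P"
    by (rule linear_maps_cong[OF assms(4,2)]) (simp add: f)
  have g': "g' \<in> linear_maps K N Q"
    by (rule linear_maps_cong[OF assms(5,3)]) (simp add: g)
  show ?thesis
    by (rule tensor_ext[OF _ _ _ assms(1) tensor_map_linear tensor_map_linear])
      (use assms f' g' in \<open>simp_all add: tensor_map_pure\<close>)
qed

lemma tensor_map_compose:
  assumes "t \<in> carrier (tensor K M N)" "f \<in> linear_maps K M P" "g \<in> linear_maps K N Q"
    "f' \<in> linear_maps K P P'" "g' \<in> linear_maps K Q Q'"
    "module K M" "module K N" "module K P" "module K Q" "module K P'" "module K Q'"
  shows "tensor_map K P' Q' f' g' (tensor_map K P Q f g t) = tensor_map K P' Q' (\<lambda>x. f' (f x)) (\<lambda>x. g' (g x)) t"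
proof -
  have c: "(\<lambda>x. f' (f x)) \<in> linear_maps K M P'" "(\<lambda>x. g' (g x)) \<in> linear_maps K N Q'"
    using assms by (auto intro: linear_maps_compose)
  show ?thesis
    by (rule tensor_ext[OF _ _ _ assms(1) linear_maps_compose[OF tensor_map_linear tensor_map_linear] tensor_map_linear])
      (use assms c in \<open>simp_all add: tensor_map_pure linear_maps_closed\<close>)
qed

lemma tensor_map_id:
  assumes "t \<in> carrier (tensor K M N)" "module K M" "module K N"
    "\<And>m. m \<in> carrier M \<Longrightarrow> f m = m" "\<And>n. n \<in> carrier N \<Longrightarrow> g n = n"
  shows "tensor_map K M N f g t = t"
proof -
  have "tensor_map K M N id id t = tensor_map K M N f g t"
    using assms by (intro tensor_map_cong) (simp_all add: eq_commute[of _ "f _"] eq_commute[of _ "g _"])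
  moreover have "tensor_map K M N id id t = t"
    using assms by (intro tensor_ext[OF _ _ _ assms(1) tensor_map_linear linear_maps_ident]) (simp_all add: tensor_map_pure)
  ultimately show ?thesis by simp
qed

lemma tensor_assoc_tensor_assoc_inv:
  assumes "module K L" "module K M" "module K N" and t: "t \<in> carrier (tensor K L (tensor K M N))"
  shows "tensor_assoc K L M N (tensor_assoc_inv K L M N t) = t"
proof (rule tensor_ext[OF _ _ _ t])
  show "(\<lambda>t. tensor_assoc K L M N (tensor_assoc_inv K L M N t))
      \<in> linear_maps K (tensor K L (tensor K M N)) (tensor K L (tensor K M N))"
    by (rule linear_maps_tensor_intros assms)+
  fix l r assume l: "l \<in> carrier L" and r: "r \<in> carrier (tensor K M N)"
  show "tensor_assoc K L M N (tensor_assoc_inv K L M N (pure_tensor K L (tensor K M N) l r))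
      = pure_tensor K L (tensor K M N) l r"
  proof (rule tensor_ext[OF _ _ _ r])
    show "(\<lambda>r. tensor_assoc K L M N (tensor_assoc_inv K L M N (pure_tensor K L (tensor K M N) l r)))
        \<in> linear_maps K (tensor K M N) (tensor K L (tensor K M N))"
      by (rule linear_maps_tensor_intros assms module_tensor l)+
  qed (use assms l in \<open>simp_all add: tensor_assoc_pure tensor_assoc_inv_pure\<close>)
qed (use assms in simp_all)

lemma tensor_assoc_inv_tensor_assoc:
  assumes "module K L" "module K M" "module K N" and t: "t \<in> carrier (tensor K (tensor K L M) N)"
  shows "tensor_assoc_inv K L M N (tensor_assoc K L M N t) = t"
proof (rule tensor_ext[OF _ _ _ t])
  show "(\<lambda>t. tensor_assoc_inv K L M N (tensor_assoc K L M N t))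
      \<in> linear_maps K (tensor K (tensor K L M) N) (tensor K (tensor K L M) N)"
    by (rule linear_maps_tensor_intros assms)+
  fix r n assume n: "n \<in> carrier N" and r: "r \<in> carrier (tensor K L M)"
  show "tensor_assoc_inv K L M N (tensor_assoc K L M N (pure_tensor K (tensor K L M) N r n))
      = pure_tensor K (tensor K L M) N r n"
  proof (rule tensor_ext[OF _ _ _ r])
    show "(\<lambda>r. tensor_assoc_inv K L M N (tensor_assoc K L M N (pure_tensor K (tensor K L M) N r n)))
        \<in> linear_maps K (tensor K L M) (tensor K (tensor K L M) N)"
      by (rule linear_maps_tensor_intros assms module_tensor n)+
  qed (use assms n in \<open>simp_all add: tensor_assoc_pure tensor_assoc_inv_pure\<close>)
qed (use assms in simp_all)

lemma middle_map_inner_linear: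
  assumes "module K X" "module K Y" "module K Z" "module K P" "module K Q"
    "f \<in> linear_maps K (tensor K X Y) (tensor K P Q)"
  shows "(tensor_assoc K P Q Z \<circ> tensor_map K (tensor K P Q) Z f id \<circ> tensor_assoc_inv K X Y Z)
    \<in> linear_maps K (tensor K X (tensor K Y Z)) (tensor K P (tensor K Q Z))"
  unfolding comp_def using assms
  by (intro linear_maps_tensor_assoc linear_maps_tensor_assoc_inv
      linear_maps_tensor_map[where M="tensor K X Y" and N=Z] linear_maps_ident) simp_all

lemma middle_map_linear:
  assumes "module K W" "module K X" "module K Y" "module K Z" "module K P" "module K Q"
    "f \<in> linear_maps K (tensor K X Y) (tensor K P Q)"
  shows "middle_map K W X Y Z P Q f
    \<in> linear_maps K (tensor K (tensor K W X) (tensor K Y Z)) (tensor K (tensor K W P) (tensor K Q Z))"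
  unfolding middle_map_def comp_assoc unfolding comp_def[of "tensor_assoc_inv K W P (tensor K Q Z)"]
    comp_def[of "tensor_map K W (tensor K P (tensor K Q Z)) id g" for g]
  using assms middle_map_inner_linear[OF assms(2-7), unfolded comp_assoc]
  by (intro linear_maps_tensor_assoc linear_maps_tensor_assoc_inv
      linear_maps_tensor_map[where M=W and N="tensor K X (tensor K Y Z)"]) (simp_all add: tensor_assoc_linear)

text \<open>Rebracketing places \<open>w\<close> and \<open>z\<close> on either side of
  \<open>t\<close>. An arbitrary \<open>t\<close> is required because \<open>middle_map_pure\<close>
  inserts a value of \<open>f\<close>, which in general is not a pure tensor.\<close>

lemma tensor_assoc_inv_insert:
  assumes "module K W" "module K Z" "module K P" "module K Q"
    "w \<in> carrier W" "z \<in> carrier Z" "t \<in> carrier (tensor K P Q)"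
  shows "tensor_assoc_inv K W P (tensor K Q Z)
      (pure_tensor K W (tensor K P (tensor K Q Z)) w (tensor_assoc K P Q Z (pure_tensor K (tensor K P Q) Z t z)))
    = tensor_map K (tensor K W P) (tensor K Q Z) (pure_tensor K W P w) (\<lambda>q. pure_tensor K Q Z q z) t"
  by (rule tensor_ext[OF _ _ _ assms(7), where P="tensor K (tensor K W P) (tensor K Q Z)"])
    (use assms in \<open>simp_all add: linear_maps_tensor_assoc linear_maps_tensor_assoc_inv linear_maps_pure_tensor_right
       linear_maps_pure_tensor_left tensor_map_linear tensor_assoc_pure tensor_assoc_inv_pure tensor_map_pure\<close>)

lemma middle_map_pure:
  assumes "module K W" "module K X" "module K Y" "module K Z" "module K P" "module K Q"
    "f \<in> linear_maps K (tensor K X Y) (tensor K P Q)"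
    "w \<in> carrier W" "x \<in> carrier X" "y \<in> carrier Y" "z \<in> carrier Z"
  shows "middle_map K W X Y Z P Q f
      (pure_tensor K (tensor K W X) (tensor K Y Z) (pure_tensor K W X w x) (pure_tensor K Y Z y z))
    = tensor_map K (tensor K W P) (tensor K Q Z) (pure_tensor K W P w) (\<lambda>q. pure_tensor K Q Z q z)
        (f (pure_tensor K X Y x y))"
proof -
  have f: "f (pure_tensor K X Y x y) \<in> carrier (tensor K P Q)"
    by (rule linear_maps_closed[OF assms(7)]) (use assms in simp)
  show ?thesis
    using assms f
    by (simp add: middle_map_def tensor_assoc_pure tensor_map_pure[OF _ _ _ _ _ middle_map_inner_linear]
        tensor_assoc_inv_pure tensor_map_pure tensor_assoc_inv_insert)
qed

section \<open>Frobenius algebras through their copairing\<close>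

text \<open>The unit is an element instead of a map, since a linear map on the scalars is determined
  by its value at 1. The laws are stated on pure tensors so that one can calculate with
  elements.\<close>

locale unital_algebra =
  fixes K :: "('k, 'r) ring_scheme" and V :: "('k, 'a) module" and \<mu> :: "('a \<times> 'a \<Rightarrow>\<^sub>0 int) set \<Rightarrow> 'a" and u :: 'a
  assumes module [simp]: "module K V"
    and mult_linear: "\<mu> \<in> linear_maps K (tensor K V V) V"
    and unit_closed [simp]: "u \<in> carrier V"
    and mult_assoc: "\<lbrakk>x \<in> carrier V; y \<in> carrier V; z \<in> carrier V\<rbrakk> \<Longrightarrow>
      \<mu> (pure_tensor K V V (\<mu> (pure_tensor K V V x y)) z) = \<mu> (pure_tensor K V V x (\<mu> (pure_tensor K V V y z)))"
    and mult_unit_left [simp]: "x \<in> carrier V \<Longrightarrow> \<mu> (pure_tensor K V V u x) = x"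
    and mult_unit_right [simp]: "x \<in> carrier V \<Longrightarrow> \<mu> (pure_tensor K V V x u) = x"
begin

abbreviation mult (infixl "\<cdot>" 70) where "x \<cdot> y \<equiv> \<mu> (pure_tensor K V V x y)"

lemma cring: "cring K"
  by (rule module_imp_cring[OF module])

lemma module_K [simp]: "module K (scalars K)"
  by (rule module_scalars[OF cring])

lemma mult_closed [simp]: "\<lbrakk>x \<in> carrier V; y \<in> carrier V\<rbrakk> \<Longrightarrow> x \<cdot> y \<in> carrier V"
  by (rule linear_maps_closed[OF mult_linear]) simp

lemmas linear_maps_mult = linear_maps_compose[OF mult_linear]

lemma linear_maps_mult_left [simp]:
  assumes "f \<in> linear_maps K L V" "y \<in> carrier V" shows "(\<lambda>x. f x \<cdot> y) \<in> linear_maps K L V"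
  by (intro linear_maps_mult linear_maps_pure_tensor_left assms module)

lemma linear_maps_mult_right [simp]:
  assumes "f \<in> linear_maps K L V" "y \<in> carrier V" shows "(\<lambda>x. y \<cdot> f x) \<in> linear_maps K L V"
  by (intro linear_maps_mult linear_maps_pure_tensor_right assms module)

end

lemma assoc_unital_algebra_iff:
  assumes "module K V" "\<eta> \<in> linear_maps K (scalars K) V"
  shows "assoc_unital_algebra K V \<mu> \<eta> \<longleftrightarrow> unital_algebra K V \<mu> (\<eta> \<one>\<^bsub>K\<^esub>)"
proof
  interpret module K V by fact
  have sK: "module K (scalars K)"
    by (simp add: R.is_cring)
  assume a: "assoc_unital_algebra K V \<mu> \<eta>"
  then have \<mu>: "\<mu> \<in> linear_maps K (tensor K V V) V"
    by (simp add: assoc_unital_algebra_def)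
  note a = a[unfolded assoc_unital_algebra_def]
  have \<eta>1: "\<eta> \<one>\<^bsub>K\<^esub> \<in> carrier V"
    by (rule linear_maps_closed[OF assms(2)]) simp
  show "unital_algebra K V \<mu> (\<eta> \<one>\<^bsub>K\<^esub>)"
  proof
    fix x y z assume xyz: "x \<in> carrier V" "y \<in> carrier V" "z \<in> carrier V"
    have p: "pure_tensor K (tensor K V V) V (pure_tensor K V V x y) z \<in> carrier (tensor K (tensor K V V) V)"
      using xyz assms(1) by simp
    show "\<mu> (pure_tensor K V V (\<mu> (pure_tensor K V V x y)) z) = \<mu> (pure_tensor K V V x (\<mu> (pure_tensor K V V y z)))"
      using a[THEN conjunct2, THEN conjunct2, THEN conjunct2, THEN conjunct1, rule_format, OF p] xyz assms(1) \<mu>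
      by (simp add: tensor_map_pure tensor_assoc_pure)
  next
    fix x assume x: "x \<in> carrier V"
    have p: "pure_tensor K (scalars K) V \<one>\<^bsub>K\<^esub> x \<in> carrier (tensor K (scalars K) V)"
      "pure_tensor K V (scalars K) x \<one>\<^bsub>K\<^esub> \<in> carrier (tensor K V (scalars K))"
      using x assms(1) sK by simp_all
    show "\<mu> (pure_tensor K V V (\<eta> \<one>\<^bsub>K\<^esub>) x) = x"
      using a[THEN conjunct2, THEN conjunct2, THEN conjunct2, THEN conjunct2, THEN conjunct1, rule_format, OF p(1)] x assms sK
      by (simp add: tensor_map_pure left_unitor_pure)
    show "\<mu> (pure_tensor K V V x (\<eta> \<one>\<^bsub>K\<^esub>)) = x"
      using a[THEN conjunct2, THEN conjunct2, THEN conjunct2, THEN conjunct2, THEN conjunct2, rule_format, OF p(2)] x assms sK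
      by (simp add: tensor_map_pure right_unitor_pure)
  qed (fact assms \<mu> \<eta>1)+
next
  assume "unital_algebra K V \<mu> (\<eta> \<one>\<^bsub>K\<^esub>)"
  then interpret unital_algebra K V \<mu> "\<eta> \<one>\<^bsub>K\<^esub>" .
  interpret module K V by fact
  note lin = linear_maps_mult linear_maps_tensor_intros
  \<comment> \<open>This extends the unit laws from the unit element to every scalar multiple of
    it.\<close>
  have \<eta>: "\<eta> r = r \<odot>\<^bsub>V\<^esub> \<eta> \<one>\<^bsub>K\<^esub>" if "r \<in> carrier K" for r
    using linear_maps_smult[OF assms(2) that, of "\<one>\<^bsub>K\<^esub>"] that by simp
  note [simp] = linear_maps_closed[OF assms(2), simplified] assms(2)
  show "assoc_unital_algebra K V \<mu> \<eta>"
    unfolding assoc_unital_algebra_def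
  proof (intro conjI ballI)
    fix x assume x: "x \<in> carrier (tensor K (tensor K V V) V)"
    show "\<mu> (tensor_map K V V \<mu> id x) = \<mu> (tensor_map K V V id \<mu> (tensor_assoc K V V V x))"
    proof (rule tensor_ext[OF _ _ _ x])
      show "(\<lambda>x. \<mu> (tensor_map K V V \<mu> id x)) \<in> linear_maps K (tensor K (tensor K V V) V) V"
        by (rule lin mult_linear module module_tensor)+
      show "(\<lambda>x. \<mu> (tensor_map K V V id \<mu> (tensor_assoc K V V V x))) \<in> linear_maps K (tensor K (tensor K V V) V) V"
        by (rule lin mult_linear module module_tensor)+
      fix t z assume t: "t \<in> carrier (tensor K V V)" and z: "z \<in> carrier V"
      show "\<mu> (tensor_map K V V \<mu> id (pure_tensor K (tensor K V V) V t z))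
        = \<mu> (tensor_map K V V id \<mu> (tensor_assoc K V V V (pure_tensor K (tensor K V V) V t z)))"
      proof (rule tensor_ext[OF _ _ _ t])
        show "(\<lambda>t. \<mu> (tensor_map K V V \<mu> id (pure_tensor K (tensor K V V) V t z))) \<in> linear_maps K (tensor K V V) V"
          by (rule lin mult_linear module module_tensor z)+
        show "(\<lambda>t. \<mu> (tensor_map K V V id \<mu> (tensor_assoc K V V V (pure_tensor K (tensor K V V) V t z))))
            \<in> linear_maps K (tensor K V V) V"
          by (rule lin mult_linear module module_tensor z)+
      qed (use z in \<open>simp_all add: tensor_map_pure tensor_assoc_pure mult_linear mult_assoc\<close>)
    qed simp_all
  next
    fix x assume x: "x \<in> carrier (tensor K (scalars K) V)"
    show "\<mu> (tensor_map K V V \<eta> id x) = left_unitor V x"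
    proof (rule tensor_ext[OF _ _ _ x])
      show "(\<lambda>x. \<mu> (tensor_map K V V \<eta> id x)) \<in> linear_maps K (tensor K (scalars K) V) V"
        by (rule lin mult_linear module module_tensor module_K assms)+
      fix r v assume "r \<in> carrier (scalars K)" "v \<in> carrier V"
      then show "\<mu> (tensor_map K V V \<eta> id (pure_tensor K (scalars K) V r v)) = left_unitor V (pure_tensor K (scalars K) V r v)"
        by (simp add: tensor_map_pure left_unitor_pure \<eta>[of r] linear_maps_smult[OF mult_linear] pure_tensor_smult_left)
    qed (simp_all add: left_unitor_linear)
  next
    fix x assume x: "x \<in> carrier (tensor K V (scalars K))"
    show "\<mu> (tensor_map K V V id \<eta> x) = right_unitor V x"
    proof (rule tensor_ext[OF _ _ _ x])
      show "(\<lambda>x. \<mu> (tensor_map K V V id \<eta> x)) \<in> linear_maps K (tensor K V (scalars K)) V"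
        by (rule lin mult_linear module module_tensor module_K assms)+
      fix r v assume "r \<in> carrier (scalars K)" "v \<in> carrier V"
      then show "\<mu> (tensor_map K V V id \<eta> (pure_tensor K V (scalars K) v r)) = right_unitor V (pure_tensor K V (scalars K) v r)"
        by (simp add: tensor_map_pure right_unitor_pure \<eta>[of r] linear_maps_smult[OF mult_linear] pure_tensor_smult_right)
    qed (simp_all add: right_unitor_linear)
  qed (fact module mult_linear assms)+
qed

section \<open>The outer actions on V \<otimes> V\<close>

context unital_algebra
begin

text \<open>Together with \<open>act_right\<close> this is the outer bimodule structure of V
  \<otimes> V. The Casimir elements are the tensors on which both actions of every \<open>x\<close>
  agree.\<close>

abbreviation act_left where "act_left x \<equiv> tensor_map K V V (\<lambda>y. x \<cdot> y) id"
abbreviation act_right where "act_right x \<equiv> tensor_map K V V id (\<lambda>y. y \<cdot> x)"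

lemma mult_maps [simp]:
  "x \<in> carrier V \<Longrightarrow> (\<lambda>y. x \<cdot> y) \<in> linear_maps K V V"
  "x \<in> carrier V \<Longrightarrow> (\<lambda>y. y \<cdot> x) \<in> linear_maps K V V"
  by simp_all

lemma act_linear [simp]:
  "x \<in> carrier V \<Longrightarrow> act_left x \<in> linear_maps K (tensor K V V) (tensor K V V)"
  "x \<in> carrier V \<Longrightarrow> act_right x \<in> linear_maps K (tensor K V V) (tensor K V V)"
  by (simp_all add: tensor_map_linear)

lemma act_closed [simp]:
  "\<lbrakk>x \<in> carrier V; t \<in> carrier (tensor K V V)\<rbrakk> \<Longrightarrow> act_left x t \<in> carrier (tensor K V V)"
  "\<lbrakk>x \<in> carrier V; t \<in> carrier (tensor K V V)\<rbrakk> \<Longrightarrow> act_right x t \<in> carrier (tensor K V V)"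
  by (simp_all add: linear_maps_closed[OF act_linear(1)] linear_maps_closed[OF act_linear(2)])

lemma act_param_linear [simp]:
  assumes "t \<in> carrier (tensor K V V)"
  shows "(\<lambda>x. act_left x t) \<in> linear_maps K V (tensor K V V)"
    and "(\<lambda>x. act_right x t) \<in> linear_maps K V (tensor K V V)"
  by (rule linear_maps_tensor_map_param_left[OF assms] linear_maps_tensor_map_param_right[OF assms]; simp)+

lemma act_mult:
  assumes "x \<in> carrier V" "y \<in> carrier V" "t \<in> carrier (tensor K V V)"
  shows "act_left x (act_left y t) = act_left (x \<cdot> y) t"
    and "act_right x (act_right y t) = act_right (y \<cdot> x) t"
    and "act_left x (act_right y t) = act_right y (act_left x t)"
proof -
  have "act_left x (act_left y t) = tensor_map K V V (\<lambda>z. x \<cdot> (y \<cdot> z)) (\<lambda>z. id (id z)) t"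
    using assms by (intro tensor_map_compose[where M=V and N=V]) simp_all
  also have "\<dots> = act_left (x \<cdot> y) t"
    using assms by (intro tensor_map_cong[OF assms(3)]) (simp_all add: mult_assoc)
  finally show "act_left x (act_left y t) = act_left (x \<cdot> y) t" .
  have "act_right x (act_right y t) = tensor_map K V V (\<lambda>z. id (id z)) (\<lambda>z. z \<cdot> y \<cdot> x) t"
    using assms by (intro tensor_map_compose[where M=V and N=V]) simp_all
  also have "\<dots> = act_right (y \<cdot> x) t"
    using assms by (intro tensor_map_cong[OF assms(3)]) (simp_all add: mult_assoc)
  finally show "act_right x (act_right y t) = act_right (y \<cdot> x) t" .
  have "act_left x (act_right y t) = tensor_map K V V (\<lambda>z. x \<cdot> id z) (\<lambda>z. id (z \<cdot> y)) t"
    using assms by (intro tensor_map_compose[where M=V and N=V]) simp_all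
  moreover have "act_right y (act_left x t) = tensor_map K V V (\<lambda>z. id (x \<cdot> z)) (\<lambda>z. id z \<cdot> y) t"
    using assms by (intro tensor_map_compose[where M=V and N=V]) simp_all
  ultimately show "act_left x (act_right y t) = act_right y (act_left x t)" by simp
qed

text \<open>The right-hand sides of the two Frobenius relations contain exactly these composites;
  read as outer actions they lose their associators.\<close>

lemma mult_assoc_tensor:
  assumes t: "t \<in> carrier (tensor K V V)" and c: "c \<in> carrier V"
  shows "tensor_map K V V id \<mu> (tensor_assoc K V V V (pure_tensor K (tensor K V V) V t c)) = act_right c t"
    and "tensor_map K V V \<mu> id (tensor_assoc_inv K V V V (pure_tensor K V (tensor K V V) c t)) = act_left c t"
proof -
  note lin = linear_maps_mult linear_maps_tensor_intros mult_linear module module_tensor c mult_maps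
  show "tensor_map K V V id \<mu> (tensor_assoc K V V V (pure_tensor K (tensor K V V) V t c)) = act_right c t"
  proof (rule tensor_ext[OF _ _ _ t])
    show "(\<lambda>t. tensor_map K V V id \<mu> (tensor_assoc K V V V (pure_tensor K (tensor K V V) V t c)))
        \<in> linear_maps K (tensor K V V) (tensor K V V)"
      by (rule lin)+
  qed (use c in \<open>simp_all add: tensor_map_linear tensor_map_pure tensor_assoc_pure mult_linear\<close>)
  show "tensor_map K V V \<mu> id (tensor_assoc_inv K V V V (pure_tensor K V (tensor K V V) c t)) = act_left c t"
  proof (rule tensor_ext[OF _ _ _ t])
    show "(\<lambda>t. tensor_map K V V \<mu> id (tensor_assoc_inv K V V V (pure_tensor K V (tensor K V V) c t)))
        \<in> linear_maps K (tensor K V V) (tensor K V V)"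
      by (rule lin)+
  qed (use c in \<open>simp_all add: tensor_map_linear tensor_map_pure tensor_assoc_inv_pure mult_linear\<close>)
qed

text \<open>The counit contracts one leg while the action multiplies the other, so the two commute.
  Hence the counit laws at the unit imply them everywhere.\<close>

lemma unitor_act:
  assumes \<epsilon>: "\<epsilon> \<in> linear_maps K V (scalars K)" and t: "t \<in> carrier (tensor K V V)" and c: "c \<in> carrier V"
  shows "left_unitor V (tensor_map K (scalars K) V \<epsilon> id (act_right c t))
      = left_unitor V (tensor_map K (scalars K) V \<epsilon> id t) \<cdot> c"
    and "right_unitor V (tensor_map K V (scalars K) id \<epsilon> (act_left c t))
      = c \<cdot> right_unitor V (tensor_map K V (scalars K) id \<epsilon> t)"
proof -
  interpret module K V by simp
  have \<epsilon>c: "\<epsilon> x \<in> carrier K" if "x \<in> carrier V" for x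
    using linear_maps_closed[OF \<epsilon> that] by simp
  note lin = linear_maps_mult_left linear_maps_mult_right linear_maps_tensor_intros mult_linear module module_tensor module_K c mult_maps \<epsilon>
  show "left_unitor V (tensor_map K (scalars K) V \<epsilon> id (act_right c t))
      = left_unitor V (tensor_map K (scalars K) V \<epsilon> id t) \<cdot> c"
  proof (rule tensor_ext[OF _ _ _ t])
    show "(\<lambda>t. left_unitor V (tensor_map K (scalars K) V \<epsilon> id (act_right c t))) \<in> linear_maps K (tensor K V V) V"
      by (rule linear_maps_left_unitor linear_maps_tensor_map[where M=V and N=V] act_linear lin)+
    show "(\<lambda>t. left_unitor V (tensor_map K (scalars K) V \<epsilon> id t) \<cdot> c) \<in> linear_maps K (tensor K V V) V"
      by (rule linear_maps_mult_left linear_maps_left_unitor linear_maps_tensor_map[where M=V and N=V] act_linear lin)+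
  qed (use c \<epsilon> \<epsilon>c in \<open>simp_all add: tensor_map_pure left_unitor_pure linear_maps_smult[OF mult_linear] pure_tensor_smult_left\<close>)
  show "right_unitor V (tensor_map K V (scalars K) id \<epsilon> (act_left c t))
      = c \<cdot> right_unitor V (tensor_map K V (scalars K) id \<epsilon> t)"
  proof (rule tensor_ext[OF _ _ _ t])
    show "(\<lambda>t. right_unitor V (tensor_map K V (scalars K) id \<epsilon> (act_left c t))) \<in> linear_maps K (tensor K V V) V"
      by (rule linear_maps_right_unitor linear_maps_tensor_map[where M=V and N=V] act_linear lin)+
    show "(\<lambda>t. c \<cdot> right_unitor V (tensor_map K V (scalars K) id \<epsilon> t)) \<in> linear_maps K (tensor K V V) V"
      by (rule linear_maps_mult_right linear_maps_right_unitor linear_maps_tensor_map[where M=V and N=V] act_linear lin)+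
  qed (use c \<epsilon> \<epsilon>c in \<open>simp_all add: tensor_map_pure right_unitor_pure linear_maps_smult[OF mult_linear] pure_tensor_smult_right\<close>)
qed

end

text \<open>The copairing is \<open>\<Delta> u\<close>, and \<open>comult_left\<close> with
  \<open>comult_right\<close> say that it is a Casimir element generating \<open>\<Delta>\<close>.
  The map \<open>\<Delta>\<close> stays a parameter so that the comultiplication of a given
  Frobenius algebra can be substituted directly.\<close>

locale casimir_algebra = unital_algebra K V \<mu> u
  for K :: "('k, 'r) ring_scheme" and V :: "('k, 'a) module" and \<mu> u +
  fixes \<Delta> :: "'a \<Rightarrow> ('a \<times> 'a \<Rightarrow>\<^sub>0 int) set" and \<epsilon> :: "'a \<Rightarrow> 'k"
  assumes comult_linear: "\<Delta> \<in> linear_maps K V (tensor K V V)"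
    and counit_linear: "\<epsilon> \<in> linear_maps K V (scalars K)"
    and comult_left: "x \<in> carrier V \<Longrightarrow> \<Delta> x = act_left x (\<Delta> u)"
    and comult_right: "x \<in> carrier V \<Longrightarrow> \<Delta> x = act_right x (\<Delta> u)"
    and counit_left: "left_unitor V (tensor_map K (scalars K) V \<epsilon> id (\<Delta> u)) = u"
    and counit_right: "right_unitor V (tensor_map K V (scalars K) id \<epsilon> (\<Delta> u)) = u"
begin

lemma comult_closed [simp]: "x \<in> carrier V \<Longrightarrow> \<Delta> x \<in> carrier (tensor K V V)"
  by (rule linear_maps_closed[OF comult_linear])

lemma comult_mult:
  assumes "x \<in> carrier V" "y \<in> carrier V"
  shows "\<Delta> (x \<cdot> y) = act_right y (\<Delta> x)" "\<Delta> (x \<cdot> y) = act_left x (\<Delta> y)"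
  using assms comult_right[of "x \<cdot> y"] comult_right[of x] comult_left[of "x \<cdot> y"] comult_left[of y]
  by (simp_all add: act_mult)

text \<open>Both sides of coassociativity at \<open>v\<close> equal this expression at \<open>t = \<Delta> v\<close>.\<close>
lemma comult_tensor:
  assumes t: "t \<in> carrier (tensor K V V)"
  shows "tensor_assoc K V V V (tensor_map K (tensor K V V) V \<Delta> id t)
    = tensor_map K V (tensor K V V) id (\<lambda>s. act_left s t) (\<Delta> u)"
proof -
  \<comment> \<open>Here \<open>r\<close> stands for the copairing. Writing
    \<open>\<Delta> p\<close> as the copairing times \<open>p\<close> leaves its first leg
    outermost, while \<open>p\<close> is absorbed into the second.\<close>
  have aux: "tensor_assoc K V V V (pure_tensor K (tensor K V V) V (act_right p r) q)
      = tensor_map K V (tensor K V V) id (\<lambda>s. pure_tensor K V V (s \<cdot> p) q) r"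
    if r: "r \<in> carrier (tensor K V V)" and p: "p \<in> carrier V" and q: "q \<in> carrier V" for p q r
  proof (rule tensor_ext[OF _ _ _ r])
    show "(\<lambda>r. tensor_assoc K V V V (pure_tensor K (tensor K V V) V (act_right p r) q))
        \<in> linear_maps K (tensor K V V) (tensor K V (tensor K V V))"
      by (rule linear_maps_tensor_intros linear_maps_mult_left module module_tensor p q)+
  qed (use p q in \<open>simp_all add: tensor_map_linear tensor_map_pure tensor_assoc_pure linear_maps_pure_tensor_left\<close>)
  show ?thesis
  proof (rule tensor_ext[OF _ _ _ t])
    show "(\<lambda>t. tensor_assoc K V V V (tensor_map K (tensor K V V) V \<Delta> id t))
        \<in> linear_maps K (tensor K V V) (tensor K V (tensor K V V))"
      by (rule linear_maps_tensor_intros comult_linear module module_tensor)+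
    show "(\<lambda>t. tensor_map K V (tensor K V V) id (\<lambda>s. act_left s t) (\<Delta> u))
        \<in> linear_maps K (tensor K V V) (tensor K V (tensor K V V))"
      by (rule linear_maps_tensor_map_param_right[where M=V and N=V]) simp_all
  next
    fix p q assume pq: "p \<in> carrier V" "q \<in> carrier V"
    have "tensor_assoc K V V V (tensor_map K (tensor K V V) V \<Delta> id (pure_tensor K V V p q))
      = tensor_assoc K V V V (pure_tensor K (tensor K V V) V (act_right p (\<Delta> u)) q)"
      using pq comult_right[of p] by (simp add: tensor_map_pure comult_linear)
    also have "\<dots> = tensor_map K V (tensor K V V) id (\<lambda>s. pure_tensor K V V (s \<cdot> p) q) (\<Delta> u)"
      by (rule aux) (simp_all add: pq)
    also have "\<dots> = tensor_map K V (tensor K V V) id (\<lambda>s. act_left s (pure_tensor K V V p q)) (\<Delta> u)"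
      using pq by (intro tensor_map_cong[where M=V and N=V]) (simp_all add: tensor_map_pure linear_maps_pure_tensor_left)
    finally show "tensor_assoc K V V V (tensor_map K (tensor K V V) V \<Delta> id (pure_tensor K V V p q))
      = tensor_map K V (tensor K V V) id (\<lambda>s. act_left s (pure_tensor K V V p q)) (\<Delta> u)" .
  qed simp_all
qed

text \<open>Let \<open>\<Sum> x \<otimes> y\<close> be the copairing. Then
  \<open>\<Delta> v = \<Sum> x \<otimes> y v\<close>, and applying \<Delta> to the second leg gives
  \<open>\<Sum> x \<otimes> y (\<Delta> v)\<close>, since \<Delta> respects left multiplication.
  \<open>comult_tensor\<close> gives the same value for the other side.\<close>

lemma coassoc:
  assumes v: "v \<in> carrier V"
  shows "tensor_assoc K V V V (tensor_map K (tensor K V V) V \<Delta> id (\<Delta> v))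
          = tensor_map K V (tensor K V V) id \<Delta> (\<Delta> v)"
proof -
  have "tensor_map K V (tensor K V V) id \<Delta> (\<Delta> v) = tensor_map K V (tensor K V V) id \<Delta> (act_right v (\<Delta> u))"
    using comult_right[OF v] by simp
  also have "\<dots> = tensor_map K V (tensor K V V) (\<lambda>s. id (id s)) (\<lambda>s. \<Delta> (s \<cdot> v)) (\<Delta> u)"
    using v by (intro tensor_map_compose[where M=V and N=V]) (simp_all add: comult_linear)
  also have "\<dots> = tensor_map K V (tensor K V V) id (\<lambda>s. act_left s (\<Delta> v)) (\<Delta> u)"
    using v by (intro tensor_map_cong[where M=V and N=V])
      (simp_all add: linear_maps_compose[OF comult_linear] comult_mult(2))
  finally show ?thesis
    using v by (simp add: comult_tensor)
qed

end

text \<open>The Frobenius relations at \<open>1 \<otimes> x\<close> and \<open>x \<otimes> 1\<close>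
  exhibit \<Delta> as right and left multiplication of the copairing. Conversely, \<Delta> is then a
  bimodule map, which is both Frobenius relations on pure tensors, and \<open>coassoc\<close> and
  \<open>unitor_act\<close> give the coalgebra laws. Linearity of the unit map is assumed because
  the right-hand side sees this map only at 1.\<close>

lemma frobenius_algebra_iff:
  assumes "module K (space A)" "unit A \<in> linear_maps K (scalars K) (space A)"
  shows "frobenius_algebra K A \<longleftrightarrow>
    casimir_algebra K (space A) (nabla A) (unit A \<one>\<^bsub>K\<^esub>) (delta A) (counit A)"
proof
  assume F: "frobenius_algebra K A"
  note F' = F[unfolded frobenius_algebra_def Let_def]
  interpret unital_algebra K "space A" "nabla A" "unit A \<one>\<^bsub>K\<^esub>"
    using F' assoc_unital_algebra_iff[OF assms] by simp
  note C = F'[THEN conjunct2, THEN conjunct1, unfolded coassoc_counital_coalgebra_def]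
  note \<Delta> = C[THEN conjunct2, THEN conjunct1]
  have \<Delta>c: "delta A x \<in> carrier (tensor K (space A) (space A))" if "x \<in> carrier (space A)" for x
    by (rule linear_maps_closed[OF \<Delta> that])
  show "casimir_algebra K (space A) (nabla A) (unit A \<one>\<^bsub>K\<^esub>) (delta A) (counit A)"
  proof
    fix x assume x: "x \<in> carrier (space A)"
    have p: "pure_tensor K (space A) (space A) (unit A \<one>\<^bsub>K\<^esub>) x \<in> carrier (tensor K (space A) (space A))"
      "pure_tensor K (space A) (space A) x (unit A \<one>\<^bsub>K\<^esub>) \<in> carrier (tensor K (space A) (space A))"
      using x by simp_all
    show "delta A x = act_left x (delta A (unit A \<one>\<^bsub>K\<^esub>))"
      using F'[THEN conjunct2, THEN conjunct2, rule_format, OF p(2), THEN conjunct2] x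
      by (simp add: tensor_map_pure \<Delta> \<Delta>c mult_assoc_tensor)
    show "delta A x = act_right x (delta A (unit A \<one>\<^bsub>K\<^esub>))"
      using F'[THEN conjunct2, THEN conjunct2, rule_format, OF p(1), THEN conjunct1] x
      by (simp add: tensor_map_pure \<Delta> \<Delta>c mult_assoc_tensor)
  qed (use C in simp_all)
next
  assume "casimir_algebra K (space A) (nabla A) (unit A \<one>\<^bsub>K\<^esub>) (delta A) (counit A)"
  then interpret casimir_algebra K "space A" "nabla A" "unit A \<one>\<^bsub>K\<^esub>" "delta A" "counit A" .
  let ?V = "space A"
  note lin = linear_maps_tensor_intros linear_maps_compose[OF comult_linear] linear_maps_compose[OF mult_linear]
    comult_linear mult_linear module module_tensor
  show "frobenius_algebra K A"
    unfolding frobenius_algebra_def Let_def coassoc_counital_coalgebra_def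
  proof (intro conjI ballI)
    show "assoc_unital_algebra K ?V (nabla A) (unit A)"
      using assoc_unital_algebra_iff[OF assms] unital_algebra_axioms by simp
    fix x assume x: "x \<in> carrier (tensor K ?V ?V)"
    show "delta A (nabla A x) = tensor_map K ?V ?V id (nabla A)
        (tensor_assoc K ?V ?V ?V (tensor_map K (tensor K ?V ?V) ?V (delta A) id x))"
    proof (rule tensor_ext[OF _ _ _ x])
      show "(\<lambda>x. delta A (nabla A x)) \<in> linear_maps K (tensor K ?V ?V) (tensor K ?V ?V)"
        by (rule lin)+
      show "(\<lambda>x. tensor_map K ?V ?V id (nabla A)
        (tensor_assoc K ?V ?V ?V (tensor_map K (tensor K ?V ?V) ?V (delta A) id x)))
          \<in> linear_maps K (tensor K ?V ?V) (tensor K ?V ?V)"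
        by (rule lin)+
    qed (simp_all add: tensor_map_pure comult_linear mult_assoc_tensor[unfolded id_def] comult_mult(1) id_def)
    show "delta A (nabla A x) = tensor_map K ?V ?V (nabla A) id
        (tensor_assoc_inv K ?V ?V ?V (tensor_map K ?V (tensor K ?V ?V) id (delta A) x))"
    proof (rule tensor_ext[OF _ _ _ x])
      show "(\<lambda>x. delta A (nabla A x)) \<in> linear_maps K (tensor K ?V ?V) (tensor K ?V ?V)"
        by (rule lin)+
      show "(\<lambda>x. tensor_map K ?V ?V (nabla A) id
        (tensor_assoc_inv K ?V ?V ?V (tensor_map K ?V (tensor K ?V ?V) id (delta A) x)))
          \<in> linear_maps K (tensor K ?V ?V) (tensor K ?V ?V)"
        by (rule lin)+
    qed (simp_all add: tensor_map_pure comult_linear mult_assoc_tensor[unfolded id_def] comult_mult(2) id_def)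
  next
    fix v assume v: "v \<in> carrier ?V"
    show "left_unitor ?V (tensor_map K (scalars K) ?V (counit A) id (delta A v)) = v"
      using v comult_right[OF v] by (simp add: unitor_act counit_linear counit_left)
    show "right_unitor ?V (tensor_map K ?V (scalars K) id (counit A) (delta A v)) = v"
      using v comult_left[OF v] by (simp add: unitor_act counit_linear counit_right)
  qed (simp_all add: comult_linear counit_linear coassoc)
qed

section \<open>The algebra structure of a twisted tensor product\<close>

locale twisted_algebras =
  A: unital_algebra K V \<mu>A a1 + B: unital_algebra K W \<mu>B b1
  for K :: "('k, 'r) ring_scheme" and V :: "('k, 'a) module" and \<mu>A a1
    and W :: "('k, 'b) module" and \<mu>B b1 +
  fixes \<tau> :: "('b \<times> 'a \<Rightarrow>\<^sub>0 int) set \<Rightarrow> ('a \<times> 'b \<Rightarrow>\<^sub>0 int) set"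
  assumes twist_linear: "\<tau> \<in> linear_maps K (tensor K W V) (tensor K V W)"
    and twist_unit_right [simp]: "b \<in> carrier W \<Longrightarrow> \<tau> (pure_tensor K W V b a1) = pure_tensor K V W a1 b"
    and twist_unit_left [simp]: "a \<in> carrier V \<Longrightarrow> \<tau> (pure_tensor K W V b1 a) = pure_tensor K V W a b1"
    and twist_mult: "x \<in> carrier (tensor K (tensor K W W) (tensor K V V)) \<Longrightarrow>
      \<tau> (tensor_map K W V \<mu>B \<mu>A x) = tensor_map K V W \<mu>A \<mu>B (double_twist K V W \<tau> x)"
begin

definition twisted_mult where
  "twisted_mult = tensor_map K V W \<mu>A \<mu>B \<circ> middle_map K V W V W V W \<tau>"

abbreviation C where "C \<equiv> tensor K V W"
abbreviation pure where "pure \<equiv> pure_tensor K V W"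
abbreviation twist where "twist b a \<equiv> \<tau> (pure_tensor K W V b a)"
abbreviation star (infixl "\<star>" 70) where "c \<star> d \<equiv> twisted_mult (pure_tensor K C C c d)"
text \<open>The A-B-bimodule structure of A \<otimes> B, whose definition does not involve \<tau>.
  In the twisted algebra it becomes multiplication by \<open>a\<close> on the left and by
  \<open>b\<close> on the right, see \<open>star_embed_left\<close> and
  \<open>star_embed_right\<close>.\<close>

abbreviation lr where "lr a b \<equiv> tensor_map K V W (\<lambda>x. A.mult a x) (\<lambda>y. B.mult y b)"

lemmas linear_maps_twist [simp] = linear_maps_compose[OF twist_linear]
declare linear_maps_pure_tensor_left [simp] linear_maps_pure_tensor_right [simp]

lemma twist_closed [simp]: "\<lbrakk>a \<in> carrier V; b \<in> carrier W\<rbrakk> \<Longrightarrow> twist b a \<in> carrier C"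
  by (rule linear_maps_closed[OF twist_linear]) simp

lemma lr_linear [simp]: "\<lbrakk>a \<in> carrier V; b \<in> carrier W\<rbrakk> \<Longrightarrow> lr a b \<in> linear_maps K C C"
  by (rule tensor_map_linear) simp_all

lemmas linear_maps_lr [simp] = linear_maps_compose[OF lr_linear]

lemma lr_closed [simp]: "\<lbrakk>a \<in> carrier V; b \<in> carrier W; t \<in> carrier C\<rbrakk> \<Longrightarrow> lr a b t \<in> carrier C"
  by (rule linear_maps_closed[OF lr_linear])

lemma lr_pure [simp]:
  "\<lbrakk>a \<in> carrier V; b \<in> carrier W; x \<in> carrier V; y \<in> carrier W\<rbrakk> \<Longrightarrow>
    lr a b (pure x y) = pure (A.mult a x) (B.mult y b)"
  by (simp add: tensor_map_pure)

lemma lr_unit [simp]: "t \<in> carrier C \<Longrightarrow> lr a1 b1 t = t"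
  by (rule tensor_map_id) simp_all

lemma lr_lr [simp]:
  assumes "a \<in> carrier V" "a' \<in> carrier V" "b \<in> carrier W" "b' \<in> carrier W" "t \<in> carrier C"
  shows "lr a b (lr a' b' t) = lr (A.mult a a') (B.mult b' b) t"
  by (rule tensor_ext[OF _ _ _ assms(5), where P=C])
    (use assms in \<open>simp_all add: A.mult_assoc B.mult_assoc\<close>)

lemma twisted_mult_linear: "twisted_mult \<in> linear_maps K (tensor K C C) C"
  unfolding twisted_mult_def comp_def
  by (rule linear_maps_compose[OF tensor_map_linear middle_map_linear])
    (simp_all add: A.mult_linear B.mult_linear twist_linear)

lemmas linear_maps_twisted_mult = linear_maps_compose[OF twisted_mult_linear]

lemma star_linear [simp]:
  "\<lbrakk>f \<in> linear_maps K L C; d \<in> carrier C\<rbrakk> \<Longrightarrow> (\<lambda>x. f x \<star> d) \<in> linear_maps K L C"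
  "\<lbrakk>f \<in> linear_maps K L C; d \<in> carrier C\<rbrakk> \<Longrightarrow> (\<lambda>x. d \<star> f x) \<in> linear_maps K L C"
  by (rule linear_maps_twisted_mult; simp)+

lemma star_closed [simp]: "\<lbrakk>c \<in> carrier C; d \<in> carrier C\<rbrakk> \<Longrightarrow> c \<star> d \<in> carrier C"
  by (rule linear_maps_closed[OF twisted_mult_linear]) simp

text \<open>Only the inner legs \<open>b\<close> and \<open>a'\<close> meet \<tau>; the outer ones
  act on its value by the bimodule structure. Calculations can thus treat this value as an opaque
  element of \<open>C\<close>.\<close>

lemma star_pure:
  assumes "a \<in> carrier V" "b \<in> carrier W" "a' \<in> carrier V" "b' \<in> carrier W"
  shows "pure a b \<star> pure a' b' = lr a b' (twist b a')"
proof -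
  have "pure a b \<star> pure a' b' = tensor_map K V W \<mu>A \<mu>B
      (tensor_map K (tensor K V V) (tensor K W W) (pure_tensor K V V a) (\<lambda>q. pure_tensor K W W q b') (twist b a'))"
    using assms by (simp add: twisted_mult_def middle_map_pure twist_linear)
  also have "\<dots> = lr a b' (twist b a')"
    by (rule tensor_map_compose[where M=V and N=W]) (use assms in \<open>simp_all add: A.mult_linear B.mult_linear\<close>)
  finally show ?thesis .
qed

lemma star_ext:
  assumes "c \<in> carrier C" "f \<in> linear_maps K C C" "g \<in> linear_maps K C C"
    "\<And>x y. \<lbrakk>x \<in> carrier V; y \<in> carrier W\<rbrakk> \<Longrightarrow> f (pure x y) = g (pure x y)"
  shows "f c = g c"
  by (rule tensor_ext[OF A.module B.module _ assms(1-3)]) (simp_all add: assms(4))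

text \<open>The leftmost leg never meets \<tau>, so a factor from A can be pulled out on the left
  before associativity is known; \<open>star_lr\<close> is the mirror image.\<close>

lemma lr_star:
  assumes "a \<in> carrier V" "c \<in> carrier C" "d \<in> carrier C"
  shows "lr a b1 c \<star> d = lr a b1 (c \<star> d)"
proof (rule star_ext[OF assms(2)])
  fix x y assume xy: "x \<in> carrier V" "y \<in> carrier W"
  show "lr a b1 (pure x y) \<star> d = lr a b1 (pure x y \<star> d)"
    by (rule star_ext[OF assms(3)]) (use assms xy in \<open>simp_all add: star_pure\<close>)
qed (use assms in simp_all)

lemma star_lr:
  assumes "b \<in> carrier W" "c \<in> carrier C" "d \<in> carrier C"
  shows "c \<star> lr a1 b d = lr a1 b (c \<star> d)"
proof (rule star_ext[OF assms(2)])
  fix x y assume xy: "x \<in> carrier V" "y \<in> carrier W"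
  show "pure x y \<star> lr a1 b d = lr a1 b (pure x y \<star> d)"
    by (rule star_ext[OF assms(3)]) (use assms xy in \<open>simp_all add: star_pure\<close>)
qed (use assms in simp_all)

lemma star_embed_left:
  assumes "a \<in> carrier V" "c \<in> carrier C"
  shows "pure a b1 \<star> c = lr a b1 c"
  by (rule star_ext[OF assms(2)]) (use assms in \<open>simp_all add: star_pure\<close>)

lemma star_embed_right:
  assumes "b \<in> carrier W" "c \<in> carrier C"
  shows "c \<star> pure a1 b = lr a1 b c"
  by (rule star_ext[OF assms(2)]) (use assms in \<open>simp_all add: star_pure\<close>)

text \<open>Only the first crossing is evaluated. Its value \<open>twist b' a\<close> is not pure in
  general, so the second stage becomes a tensor map applied to it and the third is left
  symbolic.\<close>

lemma double_twist_pure: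
  assumes "a \<in> carrier V" "a' \<in> carrier V" "b \<in> carrier W" "b' \<in> carrier W"
  shows "double_twist K V W \<tau>
      (pure_tensor K (tensor K W W) (tensor K V V) (pure_tensor K W W b b') (pure_tensor K V V a a'))
    = middle_map K V W V W V W \<tau> (tensor_map K C C (\<lambda>x. twist b x) (\<lambda>y. twist y a') (twist b' a))"
proof -
  have "tensor_map K C C \<tau> \<tau> (tensor_map K (tensor K W V) (tensor K W V)
      (pure_tensor K W V b) (\<lambda>y. pure_tensor K W V y a') (twist b' a))
     = tensor_map K C C (\<lambda>x. twist b x) (\<lambda>y. twist y a') (twist b' a)"
    by (rule tensor_map_compose[where M=V and N=W]) (use assms in \<open>simp_all add: twist_linear\<close>)
  then show ?thesis
    using assms by (simp add: double_twist_def middle_map_pure twist_linear)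
qed

lemma twist_mult_mult:
  assumes "a \<in> carrier V" "a' \<in> carrier V" "b \<in> carrier W" "b' \<in> carrier W"
  shows "twist (B.mult b b') (A.mult a a') =
    twisted_mult (tensor_map K C C (\<lambda>x. twist b x) (\<lambda>y. twist y a') (twist b' a))"
  using assms twist_mult[of "pure_tensor K (tensor K W W) (tensor K V V) (pure_tensor K W W b b') (pure_tensor K V V a a')"]
  by (simp add: tensor_map_pure A.mult_linear B.mult_linear double_twist_pure twisted_mult_def)

lemma linear_maps_twisted_mult_tensor_map:
  assumes "f \<in> linear_maps K V C" "g \<in> linear_maps K W C"
  shows "(\<lambda>t. twisted_mult (tensor_map K C C f g t)) \<in> linear_maps K C C"
  by (rule linear_maps_twisted_mult tensor_map_linear)+ (use assms in simp_all)

text \<open>This is (b b') a = b (b' a) in \<open>C\<close>, the case \<open>a' = a1\<close> of the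
  law for both products: crossing with the unit is trivial, and what remains is left multiplication
  by \<open>b\<close>.\<close>

lemma twist_mult_left:
  assumes "a \<in> carrier V" "b \<in> carrier W" "b' \<in> carrier W"
  shows "twist (B.mult b b') a = pure a1 b \<star> twist b' a"
proof -
  have "twisted_mult (tensor_map K C C (\<lambda>x. twist b x) (\<lambda>y. twist y a1) t) = pure a1 b \<star> t" if t: "t \<in> carrier C" for t
    by (rule star_ext[OF t linear_maps_twisted_mult_tensor_map])
      (use assms in \<open>simp_all add: tensor_map_pure star_embed_right star_pure\<close>)
  then show ?thesis
    using twist_mult_mult[of a a1 b b'] assms by simp
qed

text \<open>Likewise b (a a') = (b a) a' comes from taking the first factor in W to be
  \<open>b1\<close>.\<close>

lemma twist_mult_right:
  assumes "a \<in> carrier V" "a' \<in> carrier V" "b \<in> carrier W"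
  shows "twist b (A.mult a a') = twist b a \<star> pure a' b1"
proof -
  have "twisted_mult (tensor_map K C C (\<lambda>x. twist b1 x) (\<lambda>y. twist y a') t) = t \<star> pure a' b1" if t: "t \<in> carrier C" for t
    by (rule star_ext[OF t linear_maps_twisted_mult_tensor_map])
      (use assms in \<open>simp_all add: tensor_map_pure star_embed_left star_pure\<close>)
  then show ?thesis
    using twist_mult_mult[of a a' b1 b] assms by simp
qed

text \<open>This is (t b) a = t (b a). Pulling the A leg of \<open>t\<close> out on the left leaves
  its B leg, for which it is \<open>twist_mult_left\<close>.\<close>

lemma lr_star_embed:
  assumes "a \<in> carrier V" "b \<in> carrier W" "t \<in> carrier C"
  shows "lr a1 b t \<star> pure a b1 = t \<star> twist b a"
proof (rule star_ext[OF assms(3)])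
  fix x y assume xy: "x \<in> carrier V" "y \<in> carrier W"
  have "pure x y \<star> twist b a = lr x b1 (pure a1 y) \<star> twist b a"
    using xy by simp
  also have "\<dots> = lr x b1 (twist (B.mult y b) a)"
    using assms xy by (subst lr_star) (simp_all add: twist_mult_left)
  finally show "lr a1 b (pure x y) \<star> pure a b1 = pure x y \<star> twist b a"
    using assms xy by (simp add: star_pure)
qed (use assms in simp_all)

text \<open>The mirror image, b (a t) = (b a) t: the B leg of \<open>t\<close> is pulled out on the
  right and \<open>twist_mult_right\<close> remains.\<close>

lemma embed_star_lr:
  assumes "a \<in> carrier V" "b \<in> carrier W" "t \<in> carrier C"
  shows "pure a1 b \<star> lr a b1 t = twist b a \<star> t"
proof (rule star_ext[OF assms(3)])
  fix x y assume xy: "x \<in> carrier V" "y \<in> carrier W"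
  have "twist b a \<star> pure x y = twist b a \<star> lr a1 y (pure x b1)"
    using xy by simp
  also have "\<dots> = lr a1 y (twist b (A.mult a x))"
    using assms xy by (subst star_lr) (simp_all add: twist_mult_right)
  finally show "pure a1 b \<star> lr a b1 (pure x y) = twist b a \<star> pure x y"
    using assms xy by (simp add: star_pure)
qed (use assms in simp_all)

text \<open>After \<open>a\<close> and \<open>b''\<close> are pulled out, both bracketings reduce to
  the product of the two crossings \<open>twist b a'\<close> and
  \<open>twist b' a''\<close>.\<close>

lemma star_assoc_pure:
  assumes "a \<in> carrier V" "b \<in> carrier W" "a' \<in> carrier V" "b' \<in> carrier W" "a'' \<in> carrier V" "b'' \<in> carrier W"
  shows "(pure a b \<star> pure a' b') \<star> pure a'' b'' = pure a b \<star> (pure a' b' \<star> pure a'' b'')"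
proof -
  have "(pure a b \<star> pure a' b') \<star> pure a'' b'' = lr a b1 (lr a1 b' (twist b a')) \<star> lr a1 b'' (pure a'' b1)"
    using assms by (simp add: star_pure)
  also have "\<dots> = lr a b'' (lr a1 b' (twist b a') \<star> pure a'' b1)"
    \<comment> \<open>Merging nested actions would undo the separation of inner and outer factors,
      so those rules are withheld until the outer factors are out.\<close>
    using assms by (simp add: lr_star star_lr del: lr_lr lr_pure) (simp add: assms)
  also have "\<dots> = lr a b'' (twist b a' \<star> twist b' a'')"
    using assms by (simp add: lr_star_embed)
  also have "\<dots> = lr a b'' (pure a1 b \<star> lr a' b1 (twist b' a''))"
    using assms by (simp add: embed_star_lr)
  also have "\<dots> = lr a b1 (pure a1 b) \<star> lr a1 b'' (lr a' b1 (twist b' a''))"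
    using assms by (simp add: lr_star star_lr del: lr_lr lr_pure) (simp add: assms)
  also have "\<dots> = pure a b \<star> (pure a' b' \<star> pure a'' b'')"
    using assms by (simp add: star_pure)
  finally show ?thesis .
qed

sublocale C: unital_algebra K C twisted_mult "pure a1 b1"
proof (rule unital_algebra.intro)
  fix c d e assume c: "c \<in> carrier C" and d: "d \<in> carrier C" and e: "e \<in> carrier C"
  show "c \<star> d \<star> e = c \<star> (d \<star> e)"
  proof (rule star_ext[OF c])
    fix a b assume ab: "a \<in> carrier V" "b \<in> carrier W"
    show "pure a b \<star> d \<star> e = pure a b \<star> (d \<star> e)"
    proof (rule star_ext[OF d])
      fix a' b' assume ab': "a' \<in> carrier V" "b' \<in> carrier W"
      show "pure a b \<star> pure a' b' \<star> e = pure a b \<star> (pure a' b' \<star> e)"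
        by (rule star_ext[OF e]) (use ab ab' in \<open>simp_all add: star_assoc_pure\<close>)
    qed (use ab e in simp_all)
  qed (use d e in simp_all)
qed (simp_all add: twisted_mult_linear star_embed_left star_embed_right)

end

section \<open>The Frobenius structure of a twisted tensor product\<close>

locale twisted_frobenius =
  A: casimir_algebra K V \<mu>A a1 \<Delta>A \<epsilon>A + B: casimir_algebra K W \<mu>B b1 \<Delta>B \<epsilon>B +
  twisted_algebras K V \<mu>A a1 W \<mu>B b1 \<tau>
  for K :: "('k, 'r) ring_scheme" and V :: "('k, 'a) module" and \<mu>A a1 \<Delta>A \<epsilon>A
    and W :: "('k, 'b) module" and \<mu>B b1 \<Delta>B \<epsilon>B and \<tau> +
  assumes twist_bij: "bij_betw \<tau> (carrier (tensor K W V)) (carrier (tensor K V W))"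
    and special_left: "a \<in> carrier V \<Longrightarrow> \<mu>A (\<Delta>A a) = a"
    and special_right: "b \<in> carrier W \<Longrightarrow> \<mu>B (\<Delta>B b) = b"
    and twist_comult: "x \<in> carrier (tensor K W V) \<Longrightarrow>
      tensor_map K (tensor K V V) (tensor K W W) \<Delta>A \<Delta>B (\<tau> x)
        = double_twist K V W \<tau> (tensor_map K (tensor K W W) (tensor K V V) \<Delta>B \<Delta>A x)"
begin

lemmas act_maps = A.act_linear A.act_closed B.act_linear B.act_closed C.act_linear C.act_closed
  linear_maps_compose[OF C.act_linear(1)] linear_maps_compose[OF C.act_linear(2)]

\<comment> \<open>Resolution eta-expands \<open>id\<close>, which the simplifier turns into the identity abstraction.\<close>
declare act_maps [simp] act_maps [unfolded id_def, simp]

definition untwist where "untwist = inv_into (carrier (tensor K W V)) \<tau>"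

definition twisted_comult where
  "twisted_comult = middle_map K V V W W W V untwist \<circ> tensor_map K (tensor K V V) (tensor K W W) \<Delta>A \<Delta>B"

definition twisted_counit where
  "twisted_counit = left_unitor (scalars K) \<circ> tensor_map K (scalars K) (scalars K) \<epsilon>A \<epsilon>B"

lemma untwist_linear: "untwist \<in> linear_maps K C (tensor K W V)"
  unfolding untwist_def by (rule linear_maps_inv_into[OF _ twist_linear twist_bij]) simp

lemma untwist_twist [simp]: "t \<in> carrier (tensor K W V) \<Longrightarrow> untwist (\<tau> t) = t"
  using twist_bij by (simp add: untwist_def bij_betw_def)

lemma twist_untwist [simp]: "t \<in> carrier C \<Longrightarrow> \<tau> (untwist t) = t"
  using twist_bij by (simp add: untwist_def bij_betw_def f_inv_into_f)

lemma untwist_closed [simp]: "t \<in> carrier C \<Longrightarrow> untwist t \<in> carrier (tensor K W V)"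
  by (rule linear_maps_closed[OF untwist_linear])

section \<open>Splitting and joining the middle legs\<close>

abbreviation VV where "VV \<equiv> tensor K V V"
abbreviation WW where "WW \<equiv> tensor K W W"
abbreviation pV where "pV \<equiv> pure_tensor K V V"
abbreviation pW where "pW \<equiv> pure_tensor K W W"
abbreviation pC where "pC \<equiv> pure_tensor K C C"
abbreviation join where "join \<equiv> middle_map K V W V W V W \<tau>"
abbreviation split where "split s t \<equiv> middle_map K V V W W W V untwist (pure_tensor K VV WW s t)"

lemma join_linear: "join \<in> linear_maps K (tensor K C C) (tensor K VV WW)"
  by (rule middle_map_linear) (simp_all add: twist_linear)

lemma untwist_middle_linear:
  "middle_map K V V W W W V untwist \<in> linear_maps K (tensor K VV WW) (tensor K C C)"
  by (rule middle_map_linear) (simp_all add: untwist_linear)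

lemma split_linear [simp]:
  "\<lbrakk>f \<in> linear_maps K L VV; t \<in> carrier WW\<rbrakk> \<Longrightarrow> (\<lambda>x. split (f x) t) \<in> linear_maps K L (tensor K C C)"
  "\<lbrakk>s \<in> carrier VV; g \<in> linear_maps K L' WW\<rbrakk> \<Longrightarrow> (\<lambda>x. split s (g x)) \<in> linear_maps K L' (tensor K C C)"
  by (rule linear_maps_compose[OF untwist_middle_linear]; simp)+

lemma split_closed [simp]: "\<lbrakk>s \<in> carrier VV; t \<in> carrier WW\<rbrakk> \<Longrightarrow> split s t \<in> carrier (tensor K C C)"
  by (rule linear_maps_closed[OF untwist_middle_linear]) simp

lemma split_pure:
  assumes "x \<in> carrier V" "y \<in> carrier V" "u \<in> carrier W" "v \<in> carrier W"
  shows "split (pV x y) (pW u v) = tensor_map K C C (pure x) (\<lambda>q. pure q v) (untwist (pure y u))"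
  by (rule middle_map_pure) (use assms in \<open>simp_all add: untwist_linear\<close>)

text \<open>An arbitrary \<open>t\<close> is required: \<open>split_pure\<close> puts a value of
  \<open>untwist\<close> in the middle, and here \<tau> reaches it so that the two cancel.\<close>

lemma join_insert:
  assumes "x \<in> carrier V" "v \<in> carrier W" "t \<in> carrier (tensor K W V)"
  shows "join (tensor_map K C C (pure x) (\<lambda>q. pure q v) t) = tensor_map K VV WW (pV x) (\<lambda>w. pW w v) (\<tau> t)"
proof (rule tensor_ext[OF _ _ _ assms(3)])
  show "(\<lambda>t. join (tensor_map K C C (pure x) (\<lambda>q. pure q v) t)) \<in> linear_maps K (tensor K W V) (tensor K VV WW)"
    by (rule linear_maps_compose[OF join_linear tensor_map_linear]) (use assms in simp_all)
  show "(\<lambda>t. tensor_map K VV WW (pV x) (\<lambda>w. pW w v) (\<tau> t)) \<in> linear_maps K (tensor K W V) (tensor K VV WW)"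
    by (rule linear_maps_compose[OF tensor_map_linear twist_linear]) (use assms in simp_all)
qed (use assms in \<open>simp_all add: tensor_map_pure middle_map_pure twist_linear\<close>)

lemma split_ext:
  assumes "module K P" "s \<in> carrier VV" "t \<in> carrier WW"
    "\<And>t. t \<in> carrier WW \<Longrightarrow> (\<lambda>s. f s t) \<in> linear_maps K VV P" "\<And>s. s \<in> carrier VV \<Longrightarrow> (\<lambda>t. f s t) \<in> linear_maps K WW P"
    "\<And>t. t \<in> carrier WW \<Longrightarrow> (\<lambda>s. g s t) \<in> linear_maps K VV P" "\<And>s. s \<in> carrier VV \<Longrightarrow> (\<lambda>t. g s t) \<in> linear_maps K WW P"
    "\<And>x y u v. \<lbrakk>x \<in> carrier V; y \<in> carrier V; u \<in> carrier W; v \<in> carrier W\<rbrakk> \<Longrightarrow>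
      f (pV x y) (pW u v) = g (pV x y) (pW u v)"
  shows "f s t = g s t"
proof (rule tensor_ext[OF _ _ assms(1,2)])
  fix x y assume xy: "x \<in> carrier V" "y \<in> carrier V"
  show "f (pV x y) t = g (pV x y) t"
    by (rule tensor_ext[OF _ _ assms(1,3)]) (use assms xy in simp_all)
qed (use assms in simp_all)

lemma join_split:
  assumes "s \<in> carrier VV" "t \<in> carrier WW"
  shows "join (split s t) = pure_tensor K VV WW s t"
  by (rule split_ext[where P="tensor K VV WW", OF _ assms])
    (simp_all add: linear_maps_compose[OF join_linear] split_pure join_insert tensor_map_pure)

text \<open>The leftmost leg is the first leg of \<open>s\<close>, out of reach of
  \<open>untwist\<close>. This is one of the two easy outer actions and holds for all
  \<open>s\<close> and \<open>t\<close>.\<close>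

lemma act_left_split:
  assumes "a \<in> carrier V" "s \<in> carrier VV" "t \<in> carrier WW"
  shows "C.act_left (pure a b1) (split s t) = split (A.act_left a s) t"
proof (rule split_ext[where P="tensor K C C", OF _ assms(2,3)])
  fix x y u v assume xy: "x \<in> carrier V" "y \<in> carrier V" "u \<in> carrier W" "v \<in> carrier W"
  have "C.act_left (pure a b1) (tensor_map K C C (pure x) (\<lambda>q. pure q v) r)
      = tensor_map K C C (pure (A.mult a x)) (\<lambda>q. pure q v) r" if r: "r \<in> carrier (tensor K W V)" for r
  proof -
    have "C.act_left (pure a b1) (tensor_map K C C (pure x) (\<lambda>q. pure q v) r)
      = tensor_map K C C (\<lambda>p. pure a b1 \<star> pure x p) (\<lambda>q. id (pure q v)) r"
      by (rule tensor_map_compose[where M=W and N=V]) (use assms xy r in simp_all)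
    also have "\<dots> = tensor_map K C C (pure (A.mult a x)) (\<lambda>q. pure q v) r"
      by (rule tensor_map_cong[OF r]) (use assms xy in \<open>simp_all add: star_embed_left\<close>)
    finally show ?thesis .
  qed
  then show "C.act_left (pure a b1) (split (pV x y) (pW u v)) = split (A.act_left a (pV x y)) (pW u v)"
    using assms xy by (simp add: split_pure tensor_map_pure)
qed (use assms in simp_all)

text \<open>The other easy action: B multiplies the last leg of \<open>t\<close>, which
  \<open>untwist\<close> does not touch either.\<close>

lemma act_right_split:
  assumes "b \<in> carrier W" "s \<in> carrier VV" "t \<in> carrier WW"
  shows "C.act_right (pure a1 b) (split s t) = split s (B.act_right b t)"
proof (rule split_ext[where P="tensor K C C", OF _ assms(2,3)])
  fix x y u v assume xy: "x \<in> carrier V" "y \<in> carrier V" "u \<in> carrier W" "v \<in> carrier W"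
  have "C.act_right (pure a1 b) (tensor_map K C C (pure x) (\<lambda>q. pure q v) r)
      = tensor_map K C C (pure x) (\<lambda>q. pure q (B.mult v b)) r" if r: "r \<in> carrier (tensor K W V)" for r
  proof -
    have "C.act_right (pure a1 b) (tensor_map K C C (pure x) (\<lambda>q. pure q v) r)
      = tensor_map K C C (\<lambda>p. id (pure x p)) (\<lambda>q. pure q v \<star> pure a1 b) r"
      by (rule tensor_map_compose[where M=W and N=V]) (use assms xy r in simp_all)
    also have "\<dots> = tensor_map K C C (pure x) (\<lambda>q. pure q (B.mult v b)) r"
      by (rule tensor_map_cong[OF r]) (use assms xy in \<open>simp_all add: star_embed_right\<close>)
    finally show ?thesis .
  qed
  then show "C.act_right (pure a1 b) (split (pV x y) (pW u v)) = split (pV x y) (B.act_right b (pW u v))"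
    using assms xy by (simp add: split_pure tensor_map_pure)
qed (use assms in simp_all)

section \<open>Moving a copairing across a strand\<close>

lemmas lin_rules =
  linear_maps_tensor_intros linear_maps_compose[OF join_linear] linear_maps_compose[OF twist_linear]
  linear_maps_compose[OF untwist_linear]
  linear_maps_compose[OF A.mult_linear] linear_maps_compose[OF B.mult_linear]
  A.comult_linear B.comult_linear A.counit_linear B.counit_linear
  A.module B.module module_tensor A.module_K join_linear twist_linear untwist_linear A.mult_linear B.mult_linear

text \<open>Multiplying the two V legs makes specialness of A applicable to
  \<open>\<Delta>A a\<close>; the rebracketing groups the product with the first W leg into an
  element of \<open>C\<close>.\<close>

abbreviation mergeV where
  "mergeV z \<equiv> tensor_assoc_inv K V W W (tensor_map K V WW \<mu>A id z)"

lemma mergeV_linear: "(\<lambda>z. mergeV z) \<in> linear_maps K (tensor K VV WW) (tensor K C W)"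
  by (rule lin_rules)+

lemmas linear_maps_mergeV = linear_maps_compose[OF mergeV_linear]

text \<open>Crossing the inner legs and then multiplying the V legs is the product in
  \<open>C\<close>, with the last W leg set aside.\<close>

lemma mergeV_join:
  assumes "a \<in> carrier V" "b \<in> carrier W" "c \<in> carrier C"
  shows "mergeV (join (pC c (pure a b))) = pure_tensor K C W (c \<star> pure a b1) b"
proof (rule tensor_ext[OF A.module B.module _ assms(3), where P="tensor K C W"])
  show "(\<lambda>c. mergeV (join (pC c (pure a b)))) \<in> linear_maps K C (tensor K C W)"
    by (rule linear_maps_mergeV linear_maps_compose[OF join_linear])+ (use assms in simp)
  fix p q assume pq: "p \<in> carrier V" "q \<in> carrier W"
  have "mergeV (tensor_map K VV WW (pV p) (\<lambda>w. pW w b) t) = pure_tensor K C W (lr p b1 t) b"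
    if t: "t \<in> carrier C" for t
  proof (rule tensor_ext[OF A.module B.module _ t, where P="tensor K C W"])
    show "(\<lambda>t. mergeV (tensor_map K VV WW (pV p) (\<lambda>w. pW w b) t)) \<in> linear_maps K C (tensor K C W)"
      by (rule linear_maps_mergeV tensor_map_linear)+ (use assms pq in simp_all)
  qed (use assms pq in \<open>simp_all add: tensor_map_pure tensor_assoc_inv_pure A.mult_linear\<close>)
  then show "mergeV (join (pC (pure p q) (pure a b))) = pure_tensor K C W (pure p q \<star> pure a b1) b"
    using assms pq by (simp add: middle_map_pure twist_linear star_pure)
qed (use assms in simp_all)

text \<open>\<open>u\<close> crosses first the V leg of \<open>t\<close> and then the one coming
  from \<open>y\<close>. By \<open>twist_mult_right\<close> this is a single crossing with their
  product, and forming that product beforehand gives \<open>t\<close> times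
  \<open>y\<close>.\<close>

lemma mergeV_double_twist_pure:
  assumes "u \<in> carrier W" "y \<in> carrier V" "t \<in> carrier C"
  shows "mergeV (join (tensor_map K C C (\<lambda>p. twist u p) (\<lambda>w. twist w y) t))
    = tensor_map K C W \<tau> id (tensor_assoc_inv K W V W (pure_tensor K W C u (t \<star> pure y b1)))"
proof (rule tensor_ext[OF A.module B.module _ assms(3), where P="tensor K C W"])
  show "(\<lambda>t. mergeV (join (tensor_map K C C (\<lambda>p. twist u p) (\<lambda>w. twist w y) t))) \<in> linear_maps K C (tensor K C W)"
    by (rule linear_maps_mergeV linear_maps_compose[OF join_linear] tensor_map_linear)+ (use assms in simp_all)
  show "(\<lambda>t. tensor_map K C W \<tau> id (tensor_assoc_inv K W V W (pure_tensor K W C u (t \<star> pure y b1))))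
      \<in> linear_maps K C (tensor K C W)"
    by (rule star_linear lin_rules assms pure_tensor_closed B.unit_closed)+
  fix p q assume pq: "p \<in> carrier V" "q \<in> carrier W"
  \<comment> \<open>The element \<open>w\<close> stands for \<open>twist q y\<close>, which is
    generalised to an arbitrary element of \<open>C\<close> so that it may be taken pure.\<close>
  have "mergeV (join (pC (twist u p) w))
      = tensor_map K C W \<tau> id (tensor_assoc_inv K W V W (pure_tensor K W C u (lr p b1 w)))"
    if w: "w \<in> carrier C" for w
  proof (rule tensor_ext[OF A.module B.module _ w, where P="tensor K C W"])
    show "(\<lambda>w. mergeV (join (pC (twist u p) w))) \<in> linear_maps K C (tensor K C W)"
      by (rule linear_maps_mergeV linear_maps_compose[OF join_linear])+ (use assms pq in simp)
    show "(\<lambda>w. tensor_map K C W \<tau> id (tensor_assoc_inv K W V W (pure_tensor K W C u (lr p b1 w))))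
        \<in> linear_maps K C (tensor K C W)"
      by (rule lr_linear lin_rules assms pq B.unit_closed)+
  qed (use assms pq in \<open>simp_all add: mergeV_join[unfolded id_def] id_def twist_mult_right tensor_map_pure tensor_assoc_inv_pure twist_linear\<close>)
  then show "mergeV (join (tensor_map K C C (\<lambda>p. twist u p) (\<lambda>w. twist w y) (pure p q)))
    = tensor_map K C W \<tau> id (tensor_assoc_inv K W V W (pure_tensor K W C u (pure p q \<star> pure y b1)))"
    using assms pq by (simp add: tensor_map_pure star_pure)
qed (use assms in simp_all)

lemma linear_maps_double_twist:
  "double_twist K V W \<tau> \<in> linear_maps K (tensor K WW VV) (tensor K VV WW)"
  unfolding double_twist_def comp_def
  by (rule linear_maps_compose[OF middle_map_linear] linear_maps_tensor_map middle_map_linear lin_rules)+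

text \<open>For each W strand, crossing two V strands and then multiplying them is one crossing with
  the product. The double twist therefore collapses to the second leg of \<open>t\<close> crossing
  \<open>\<mu>A s\<close>, followed by the first.\<close>

lemma mergeV_double_twist:
  assumes s: "s \<in> carrier VV" and t: "t \<in> carrier WW"
  shows "mergeV (double_twist K V W \<tau> (pure_tensor K WW VV t s))
    = tensor_map K C W \<tau> id (tensor_assoc_inv K W V W (tensor_map K W C id (\<lambda>v. twist v (\<mu>A s)) t))"
proof (rule split_ext[where P="tensor K C W", OF _ s t])
  have \<mu>: "\<mu>A s \<in> carrier V" if "s \<in> carrier VV" for s
    by (rule linear_maps_closed[OF A.mult_linear that])
  have assoc: "(\<lambda>x. tensor_map K C W \<tau> id (tensor_assoc_inv K W V W (h x))) \<in> linear_maps K X (tensor K C W)"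
    if "h \<in> linear_maps K X (tensor K W C)" for h X
    by (rule lin_rules that)+
  show "(\<lambda>s. mergeV (double_twist K V W \<tau> (pure_tensor K WW VV t s))) \<in> linear_maps K VV (tensor K C W)" if t: "t \<in> carrier WW" for t
    by (rule linear_maps_mergeV linear_maps_compose[OF linear_maps_double_twist])+ (use t in simp)
  show "(\<lambda>t. mergeV (double_twist K V W \<tau> (pure_tensor K WW VV t s))) \<in> linear_maps K WW (tensor K C W)" if s: "s \<in> carrier VV" for s
    by (rule linear_maps_mergeV linear_maps_compose[OF linear_maps_double_twist])+ (use s in simp)
  show "(\<lambda>s. tensor_map K C W \<tau> id (tensor_assoc_inv K W V W (tensor_map K W C id (\<lambda>v. twist v (\<mu>A s)) t)))
      \<in> linear_maps K VV (tensor K C W)" if t: "t \<in> carrier WW" for t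
    by (rule assoc, rule linear_maps_tensor_map_param_right[OF t]) (simp_all add: \<mu> A.mult_linear)
  show "(\<lambda>t. tensor_map K C W \<tau> id (tensor_assoc_inv K W V W (tensor_map K W C id (\<lambda>v. twist v (\<mu>A s)) t)))
      \<in> linear_maps K WW (tensor K C W)" if s: "s \<in> carrier VV" for s
    by (rule assoc tensor_map_linear)+ (use s in \<open>simp_all add: \<mu>\<close>)
next
  fix x y u v assume xy: "x \<in> carrier V" "y \<in> carrier V" "u \<in> carrier W" "v \<in> carrier W"
  then show "mergeV (double_twist K V W \<tau> (pure_tensor K WW VV (pW u v) (pV x y)))
    = tensor_map K C W \<tau> id (tensor_assoc_inv K W V W (tensor_map K W C id (\<lambda>v. twist v (\<mu>A (pV x y))) (pW u v)))"
    using mergeV_double_twist_pure[of u y "twist v x"]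
    by (simp add: double_twist_pure tensor_map_pure twist_mult_right)
qed simp_all

text \<open>The copairing \<open>\<Delta>B b1\<close> can be moved across a strand of \<open>V\<close>: this is the compatibility of \<open>\<tau>\<close>
  with the comultiplications at \<open>b1 \<otimes> a\<close>, merged by \<open>\<mu>A \<Delta>A = 1\<close>.\<close>
lemma twist_copairing_right:
  assumes a: "a \<in> carrier V"
  shows "tensor_map K C W \<tau> id (tensor_assoc_inv K W V W (tensor_map K W C id (\<lambda>v. twist v a) (\<Delta>B b1)))
    = tensor_map K C W (pure a) id (\<Delta>B b1)"
proof -
  have aux: "tensor_assoc_inv K V W W (pure_tensor K V WW a t) = tensor_map K C W (pure a) id t"
    if t: "t \<in> carrier WW" for t
  proof (rule tensor_ext[OF _ _ _ t])
    show "(\<lambda>t. tensor_assoc_inv K V W W (pure_tensor K V WW a t)) \<in> linear_maps K WW (tensor K C W)"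
      by (rule lin_rules a)+
  qed (use a in \<open>simp_all add: tensor_map_pure tensor_map_linear tensor_assoc_inv_pure\<close>)
  have "double_twist K V W \<tau> (pure_tensor K WW VV (\<Delta>B b1) (\<Delta>A a)) = pure_tensor K VV WW (\<Delta>A a) (\<Delta>B b1)"
    using a twist_comult[of "pure_tensor K W V b1 a"]
    by (simp add: tensor_map_pure A.comult_linear B.comult_linear)
  then show ?thesis
    using a mergeV_double_twist[of "\<Delta>A a" "\<Delta>B b1"]
    by (simp add: special_left tensor_map_pure A.mult_linear aux)
qed

text \<open>The mirror of \<open>mergeV\<close>: the W legs are multiplied, which will use
  specialness of B.\<close>

abbreviation mergeW where
  "mergeW z \<equiv> tensor_assoc K V V W (tensor_map K VV W id \<mu>B z)"

lemma mergeW_linear: "(\<lambda>z. mergeW z) \<in> linear_maps K (tensor K VV WW) (tensor K V C)"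
  by (rule lin_rules)+

lemmas linear_maps_mergeW = linear_maps_compose[OF mergeW_linear]

lemma mergeW_join:
  assumes "a \<in> carrier V" "b \<in> carrier W" "d \<in> carrier C"
  shows "mergeW (join (pC (pure a b) d)) = pure_tensor K V C a (pure a1 b \<star> d)"
proof (rule tensor_ext[OF A.module B.module _ assms(3), where P="tensor K V C"])
  show "(\<lambda>d. mergeW (join (pC (pure a b) d))) \<in> linear_maps K C (tensor K V C)"
    by (rule linear_maps_mergeW linear_maps_compose[OF join_linear])+ (use assms in simp)
  fix p q assume pq: "p \<in> carrier V" "q \<in> carrier W"
  have "mergeW (tensor_map K VV WW (pV a) (\<lambda>w. pW w q) t) = pure_tensor K V C a (lr a1 q t)"
    if t: "t \<in> carrier C" for t
  proof (rule tensor_ext[OF A.module B.module _ t, where P="tensor K V C"])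
    show "(\<lambda>t. mergeW (tensor_map K VV WW (pV a) (\<lambda>w. pW w q) t)) \<in> linear_maps K C (tensor K V C)"
      by (rule linear_maps_mergeW tensor_map_linear)+ (use assms pq in simp_all)
  qed (use assms pq in \<open>simp_all add: tensor_map_pure tensor_assoc_pure B.mult_linear\<close>)
  then show "mergeW (join (pC (pure a b) (pure p q))) = pure_tensor K V C a (pure a1 b \<star> pure p q)"
    using assms pq by (simp add: middle_map_pure twist_linear star_pure)
qed (use assms in simp_all)

text \<open>\<open>y\<close> is crossed first by the W leg of \<open>t\<close> and then by the one
  coming from \<open>u\<close>. By \<open>twist_mult_left\<close> this is a single crossing by their
  product, and forming that product beforehand gives \<open>u\<close> times
  \<open>t\<close>.\<close>

lemma mergeW_double_twist_pure:
  assumes "u \<in> carrier W" "y \<in> carrier V" "t \<in> carrier C"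
  shows "mergeW (join (tensor_map K C C (\<lambda>p. twist u p) (\<lambda>w. twist w y) t))
    = tensor_map K V C id \<tau> (tensor_assoc K V W V (pure_tensor K C V (pure a1 u \<star> t) y))"
proof (rule tensor_ext[OF A.module B.module _ assms(3), where P="tensor K V C"])
  show "(\<lambda>t. mergeW (join (tensor_map K C C (\<lambda>p. twist u p) (\<lambda>w. twist w y) t))) \<in> linear_maps K C (tensor K V C)"
    by (rule linear_maps_mergeW linear_maps_compose[OF join_linear] tensor_map_linear)+ (use assms in simp_all)
  show "(\<lambda>t. tensor_map K V C id \<tau> (tensor_assoc K V W V (pure_tensor K C V (pure a1 u \<star> t) y)))
      \<in> linear_maps K C (tensor K V C)"
    by (rule star_linear lin_rules assms pure_tensor_closed A.unit_closed)+
  fix p q assume pq: "p \<in> carrier V" "q \<in> carrier W"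
  have "mergeW (join (pC w (twist q y)))
      = tensor_map K V C id \<tau> (tensor_assoc K V W V (pure_tensor K C V (lr a1 q w) y))"
    if w: "w \<in> carrier C" for w
  proof (rule tensor_ext[OF A.module B.module _ w, where P="tensor K V C"])
    show "(\<lambda>w. mergeW (join (pC w (twist q y)))) \<in> linear_maps K C (tensor K V C)"
      by (rule linear_maps_mergeW linear_maps_compose[OF join_linear])+ (use assms pq in simp)
    show "(\<lambda>w. tensor_map K V C id \<tau> (tensor_assoc K V W V (pure_tensor K C V (lr a1 q w) y)))
        \<in> linear_maps K C (tensor K V C)"
      by (rule lr_linear lin_rules assms pq A.unit_closed)+
  qed (use assms pq in \<open>simp_all add: mergeW_join[unfolded id_def] id_def twist_mult_left tensor_map_pure tensor_assoc_pure twist_linear\<close>)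
  then show "mergeW (join (tensor_map K C C (\<lambda>p. twist u p) (\<lambda>w. twist w y) (pure p q)))
    = tensor_map K V C id \<tau> (tensor_assoc K V W V (pure_tensor K C V (pure a1 u \<star> pure p q) y))"
    using assms pq by (simp add: tensor_map_pure star_pure)
qed (use assms in simp_all)

lemma mergeW_double_twist:
  assumes s: "s \<in> carrier VV" and t: "t \<in> carrier WW"
  shows "mergeW (double_twist K V W \<tau> (pure_tensor K WW VV t s))
    = tensor_map K V C id \<tau> (tensor_assoc K V W V (tensor_map K C V (\<lambda>x. twist (\<mu>B t) x) id s))"
proof (rule split_ext[where P="tensor K V C", OF _ s t])
  have \<mu>: "\<mu>B t \<in> carrier W" if "t \<in> carrier WW" for t
    by (rule linear_maps_closed[OF B.mult_linear that])
  have assoc: "(\<lambda>x. tensor_map K V C id \<tau> (tensor_assoc K V W V (h x))) \<in> linear_maps K X (tensor K V C)"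
    if "h \<in> linear_maps K X (tensor K C V)" for h X
    by (rule lin_rules that)+
  show "(\<lambda>s. mergeW (double_twist K V W \<tau> (pure_tensor K WW VV t s))) \<in> linear_maps K VV (tensor K V C)" if t: "t \<in> carrier WW" for t
    by (rule linear_maps_mergeW linear_maps_compose[OF linear_maps_double_twist])+ (use t in simp)
  show "(\<lambda>t. mergeW (double_twist K V W \<tau> (pure_tensor K WW VV t s))) \<in> linear_maps K WW (tensor K V C)" if s: "s \<in> carrier VV" for s
    by (rule linear_maps_mergeW linear_maps_compose[OF linear_maps_double_twist])+ (use s in simp)
  show "(\<lambda>s. tensor_map K V C id \<tau> (tensor_assoc K V W V (tensor_map K C V (\<lambda>x. twist (\<mu>B t) x) id s)))
      \<in> linear_maps K VV (tensor K V C)" if t: "t \<in> carrier WW" for t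
    by (rule assoc tensor_map_linear)+ (use t in \<open>simp_all add: \<mu>\<close>)
  show "(\<lambda>t. tensor_map K V C id \<tau> (tensor_assoc K V W V (tensor_map K C V (\<lambda>x. twist (\<mu>B t) x) id s)))
      \<in> linear_maps K WW (tensor K V C)" if s: "s \<in> carrier VV" for s
    by (rule assoc, rule linear_maps_tensor_map_param_left[OF s]) (simp_all add: \<mu> B.mult_linear)
next
  fix x y u v assume xy: "x \<in> carrier V" "y \<in> carrier V" "u \<in> carrier W" "v \<in> carrier W"
  then show "mergeW (double_twist K V W \<tau> (pure_tensor K WW VV (pW u v) (pV x y)))
    = tensor_map K V C id \<tau> (tensor_assoc K V W V (tensor_map K C V (\<lambda>x. twist (\<mu>B (pW u v)) x) id (pV x y)))"
    using mergeW_double_twist_pure[of u y "twist v x"]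
    by (simp add: double_twist_pure tensor_map_pure twist_mult_left)
qed simp_all

text \<open>Compatibility of \<tau> with the comultiplications at \<open>b \<otimes> a1\<close>,
  where \<tau> is trivial; the W legs are merged and \<open>special_right\<close> turns
  \<open>\<Delta>B b\<close> back into \<open>b\<close>.\<close>

lemma twist_copairing_left:
  assumes b: "b \<in> carrier W"
  shows "tensor_map K V C id \<tau> (tensor_assoc K V W V (tensor_map K C V (\<lambda>x. twist b x) id (\<Delta>A a1)))
    = tensor_map K V C id (\<lambda>y. pure y b) (\<Delta>A a1)"
proof -
  have aux: "tensor_assoc K V V W (pure_tensor K VV W s b) = tensor_map K V C id (\<lambda>y. pure y b) s"
    if s: "s \<in> carrier VV" for s
  proof (rule tensor_ext[OF _ _ _ s])
    show "(\<lambda>s. tensor_assoc K V V W (pure_tensor K VV W s b)) \<in> linear_maps K VV (tensor K V C)"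
      by (rule lin_rules b)+
  qed (use b in \<open>simp_all add: tensor_map_pure tensor_map_linear tensor_assoc_pure\<close>)
  have "double_twist K V W \<tau> (pure_tensor K WW VV (\<Delta>B b) (\<Delta>A a1)) = pure_tensor K VV WW (\<Delta>A a1) (\<Delta>B b)"
    using b twist_comult[of "pure_tensor K W V b a1"]
    by (simp add: tensor_map_pure A.comult_linear B.comult_linear)
  then show ?thesis
    using b mergeW_double_twist[of "\<Delta>A a1" "\<Delta>B b"]
    by (simp add: special_right tensor_map_pure B.mult_linear aux)
qed

text \<open>Cancelling the outer \<tau> in \<open>twist_copairing_right\<close> shows that
  untwisting \<open>y\<close> against the first leg of the copairing is the same as crossing
  \<open>y\<close> with its second leg. So \<open>untwist\<close> disappears in favour of
  \<tau>.\<close>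

lemma split_copairing_right:
  assumes x: "x \<in> carrier V" and y: "y \<in> carrier V"
  shows "split (pV x y) (\<Delta>B b1) = tensor_map K C C (pure x) (\<lambda>v. twist v y) (\<Delta>B b1)"
proof -
  let ?U = "tensor K W V"
  \<comment> \<open>Attaches \<open>x\<close> on the left and rebrackets into C \<otimes> C. It lets
    \<open>expand\<close> expose \<open>untwist\<close> as the inverse of the \<tau> in
    \<open>twist_copairing_right\<close>.\<close>
  let ?\<Theta> = "\<lambda>r. tensor_map K C C (pure x) id (tensor_assoc K W V W r)"
  have \<Theta>: "(\<lambda>r. ?\<Theta> r) \<in> linear_maps K (tensor K ?U W) (tensor K C C)"
    by (rule linear_maps_tensor_map[where M=W and N=C] linear_maps_pure_tensor lin_rules x)+
  have insert: "?\<Theta> (pure_tensor K ?U W w v) = tensor_map K C C (pure x) (\<lambda>q. pure q v) w"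
    if w: "w \<in> carrier ?U" and v: "v \<in> carrier W" for w v
  proof (rule tensor_ext[OF _ _ _ w])
    show "(\<lambda>w. ?\<Theta> (pure_tensor K ?U W w v)) \<in> linear_maps K ?U (tensor K C C)"
      by (rule linear_maps_compose[OF \<Theta>]) (use v in simp)
  qed (use x v in \<open>simp_all add: tensor_map_linear tensor_map_pure tensor_assoc_pure\<close>)
  have expand: "split (pV x y) t = ?\<Theta> (tensor_map K ?U W untwist id (tensor_map K C W (pure y) id t))"
    if t: "t \<in> carrier WW" for t
  proof (rule tensor_ext[OF _ _ _ t])
    show "(\<lambda>t. ?\<Theta> (tensor_map K ?U W untwist id (tensor_map K C W (pure y) id t))) \<in> linear_maps K WW (tensor K C C)"
      by (rule linear_maps_compose[OF \<Theta>] linear_maps_tensor_map[where M=C and N=W] tensor_map_linear untwist_linear)+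
        (use y in \<open>simp_all add: untwist_linear\<close>)
  qed (use x y in \<open>simp_all add: insert[unfolded id_def] id_def split_pure tensor_map_pure untwist_linear\<close>)
  have cancel: "tensor_map K ?U W untwist id (tensor_map K C W \<tau> id r) = r" if r: "r \<in> carrier (tensor K ?U W)" for r
  proof -
    have "tensor_map K ?U W untwist id (tensor_map K C W \<tau> id r) = tensor_map K ?U W (\<lambda>x. untwist (\<tau> x)) (\<lambda>x. id (id x)) r"
      by (rule tensor_map_compose[OF r]) (simp_all add: untwist_linear twist_linear)
    also have "\<dots> = r"
      by (rule tensor_map_id[OF r]) simp_all
    finally show ?thesis .
  qed
  let ?X = "tensor_map K W C id (\<lambda>v. twist v y) (\<Delta>B b1)"
  have X: "?X \<in> carrier (tensor K W C)"
    by (rule tensor_map_closed[where M=W and N=W]) (use y in simp_all)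
  have X': "tensor_assoc_inv K W V W ?X \<in> carrier (tensor K ?U W)"
    by (rule linear_maps_closed[OF tensor_assoc_inv_linear X]) simp_all
  have "split (pV x y) (\<Delta>B b1) = ?\<Theta> (tensor_map K ?U W untwist id (tensor_map K C W \<tau> id (tensor_assoc_inv K W V W ?X)))"
    using y by (simp add: expand twist_copairing_right)
  also have "\<dots> = tensor_map K C C (pure x) id ?X"
    by (simp add: cancel[OF X'] tensor_assoc_tensor_assoc_inv X)
  also have "\<dots> = tensor_map K C C (\<lambda>u. pure x (id u)) (\<lambda>v. id (twist v y)) (\<Delta>B b1)"
    by (rule tensor_map_compose[where M=W and N=W]) (use x y in simp_all)
  finally show ?thesis by simp
qed

text \<open>The same cancellation in \<open>twist_copairing_left\<close>: untwisting the second leg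
  of the copairing of A against \<open>u\<close> is crossing its first leg with
  \<open>u\<close>.\<close>

lemma split_copairing_left:
  assumes u: "u \<in> carrier W" and v: "v \<in> carrier W"
  shows "split (\<Delta>A a1) (pW u v) = tensor_map K C C (\<lambda>x. twist u x) (\<lambda>y. pure y v) (\<Delta>A a1)"
proof -
  let ?U = "tensor K W V"
  let ?\<Theta> = "\<lambda>r. tensor_map K C C id (\<lambda>y. pure y v) (tensor_assoc_inv K V W V r)"
  have \<Theta>: "(\<lambda>r. ?\<Theta> r) \<in> linear_maps K (tensor K V ?U) (tensor K C C)"
    by (rule linear_maps_tensor_map[where M=C and N=V] linear_maps_pure_tensor lin_rules v)+
  have insert: "?\<Theta> (pure_tensor K V ?U x w) = tensor_map K C C (pure x) (\<lambda>q. pure q v) w"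
    if w: "w \<in> carrier ?U" and x: "x \<in> carrier V" for w x
  proof (rule tensor_ext[OF _ _ _ w])
    show "(\<lambda>w. ?\<Theta> (pure_tensor K V ?U x w)) \<in> linear_maps K ?U (tensor K C C)"
      by (rule linear_maps_compose[OF \<Theta>]) (use x in simp)
  qed (use x v in \<open>simp_all add: tensor_map_linear tensor_map_pure tensor_assoc_inv_pure\<close>)
  have expand: "split s (pW u v) = ?\<Theta> (tensor_map K V ?U id untwist (tensor_map K V C id (\<lambda>y. pure y u) s))"
    if s: "s \<in> carrier VV" for s
  proof (rule tensor_ext[OF _ _ _ s])
    show "(\<lambda>s. ?\<Theta> (tensor_map K V ?U id untwist (tensor_map K V C id (\<lambda>y. pure y u) s))) \<in> linear_maps K VV (tensor K C C)"
      by (rule linear_maps_compose[OF \<Theta>] linear_maps_tensor_map[where M=V and N=C] tensor_map_linear untwist_linear)+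
        (use u in \<open>simp_all add: untwist_linear\<close>)
  qed (use u v in \<open>simp_all add: insert[unfolded id_def] id_def split_pure tensor_map_pure untwist_linear\<close>)
  have cancel: "tensor_map K V ?U id untwist (tensor_map K V C id \<tau> r) = r" if r: "r \<in> carrier (tensor K V ?U)" for r
  proof -
    have "tensor_map K V ?U id untwist (tensor_map K V C id \<tau> r) = tensor_map K V ?U (\<lambda>x. id (id x)) (\<lambda>x. untwist (\<tau> x)) r"
      by (rule tensor_map_compose[OF r]) (simp_all add: untwist_linear twist_linear)
    also have "\<dots> = r"
      by (rule tensor_map_id[OF r]) simp_all
    finally show ?thesis .
  qed
  let ?X = "tensor_map K C V (\<lambda>x. twist u x) id (\<Delta>A a1)"
  have X: "?X \<in> carrier (tensor K C V)"
    by (rule tensor_map_closed[where M=V and N=V]) (use u in simp_all)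
  have X': "tensor_assoc K V W V ?X \<in> carrier (tensor K V ?U)"
    by (rule linear_maps_closed[OF tensor_assoc_linear X]) simp_all
  have "split (\<Delta>A a1) (pW u v) = ?\<Theta> (tensor_map K V ?U id untwist (tensor_map K V C id \<tau> (tensor_assoc K V W V ?X)))"
    using u by (simp add: expand twist_copairing_left)
  also have "\<dots> = tensor_map K C C id (\<lambda>y. pure y v) ?X"
    by (simp add: cancel[OF X'] tensor_assoc_inv_tensor_assoc X)
  also have "\<dots> = tensor_map K C C (\<lambda>x. id (twist u x)) (\<lambda>y. pure (id y) v) (\<Delta>A a1)"
    by (rule tensor_map_compose[where M=V and N=V]) (use u v in simp_all)
  finally show ?thesis by simp
qed

text \<open>A hard action, made accessible by the copairing of B: by
  \<open>split_copairing_right\<close> the second factor of C \<otimes> C is the product v y, and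
  \<open>a\<close> is absorbed into \<open>y\<close> by \<open>twist_mult_right\<close>.\<close>

lemma act_right_split_copairing:
  assumes a: "a \<in> carrier V" and s: "s \<in> carrier VV"
  shows "C.act_right (pure a b1) (split s (\<Delta>B b1)) = split (A.act_right a s) (\<Delta>B b1)"
proof (rule tensor_ext[OF _ _ _ s, where P="tensor K C C"])
  fix x y assume xy: "x \<in> carrier V" "y \<in> carrier V"
  have "C.act_right (pure a b1) (tensor_map K C C (pure x) (\<lambda>v. twist v y) (\<Delta>B b1))
      = tensor_map K C C (\<lambda>u. id (pure x u)) (\<lambda>v. twist v y \<star> pure a b1) (\<Delta>B b1)"
    by (rule tensor_map_compose[where M=W and N=W]) (use a xy in simp_all)
  also have "\<dots> = tensor_map K C C (pure x) (\<lambda>v. twist v (A.mult y a)) (\<Delta>B b1)"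
    by (rule tensor_map_cong[where M=W and N=W]) (use a xy in \<open>simp_all add: twist_mult_right\<close>)
  finally show "C.act_right (pure a b1) (split (pV x y) (\<Delta>B b1)) = split (A.act_right a (pV x y)) (\<Delta>B b1)"
    using a xy by (simp add: split_copairing_right tensor_map_pure)
qed (use a in simp_all)

text \<open>The other hard action: with the copairing of A in place the first factor is the product
  u x, and \<open>twist_mult_left\<close> absorbs \<open>b\<close> into \<open>u\<close>.\<close>

lemma act_left_split_copairing:
  assumes b: "b \<in> carrier W" and t: "t \<in> carrier WW"
  shows "C.act_left (pure a1 b) (split (\<Delta>A a1) t) = split (\<Delta>A a1) (B.act_left b t)"
proof (rule tensor_ext[OF _ _ _ t, where P="tensor K C C"])
  fix u v assume uv: "u \<in> carrier W" "v \<in> carrier W"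
  have "C.act_left (pure a1 b) (tensor_map K C C (\<lambda>x. twist u x) (\<lambda>y. pure y v) (\<Delta>A a1))
      = tensor_map K C C (\<lambda>x. pure a1 b \<star> twist u x) (\<lambda>y. id (pure y v)) (\<Delta>A a1)"
    by (rule tensor_map_compose[where M=V and N=V]) (use b uv in simp_all)
  also have "\<dots> = tensor_map K C C (\<lambda>x. twist (B.mult b u) x) (\<lambda>y. pure y v) (\<Delta>A a1)"
    by (rule tensor_map_cong[where M=V and N=V]) (use b uv in \<open>simp_all add: twist_mult_left\<close>)
  finally show "C.act_left (pure a1 b) (split (\<Delta>A a1) (pW u v)) = split (\<Delta>A a1) (B.act_left b (pW u v))"
    using b uv by (simp add: split_copairing_left tensor_map_pure)
qed (use b in simp_all)

section \<open>Comultiplication and counit of the twisted tensor product\<close>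

lemma twisted_comult_pure:
  "\<lbrakk>a \<in> carrier V; b \<in> carrier W\<rbrakk> \<Longrightarrow> twisted_comult (pure a b) = split (\<Delta>A a) (\<Delta>B b)"
  by (simp add: twisted_comult_def tensor_map_pure A.comult_linear B.comult_linear)

lemma twisted_comult_linear: "twisted_comult \<in> linear_maps K C (tensor K C C)"
  unfolding twisted_comult_def comp_def
  by (rule linear_maps_compose[OF untwist_middle_linear] tensor_map_linear)+
    (simp_all add: A.comult_linear B.comult_linear)

lemma twisted_comult_closed [simp]: "c \<in> carrier C \<Longrightarrow> twisted_comult c \<in> carrier (tensor K C C)"
  by (rule linear_maps_closed[OF twisted_comult_linear])

lemma pure_eq_star: "\<lbrakk>a \<in> carrier V; b \<in> carrier W\<rbrakk> \<Longrightarrow> pure a b = pure a b1 \<star> pure a1 b"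
  by (simp add: star_embed_left)

text \<open>\<open>a \<otimes> b\<close> is the product of its two embedded factors, so on the left
  \<open>b\<close> acts before \<open>a\<close>, and on the right \<open>a\<close> acts before
  \<open>b\<close>. In both cases the hard action comes first, while the copairing that it depends
  on is still intact, and the easy action holds for any tensors.\<close>

lemma twisted_comult_act:
  assumes c: "c \<in> carrier C"
  shows "twisted_comult c = C.act_left c (twisted_comult (pure a1 b1))"
    and "twisted_comult c = C.act_right c (twisted_comult (pure a1 b1))"
proof -
  show "twisted_comult c = C.act_left c (twisted_comult (pure a1 b1))"
  proof (rule tensor_ext[OF A.module B.module _ c twisted_comult_linear C.act_param_linear(1)])
    fix a b assume ab: "a \<in> carrier V" "b \<in> carrier W"
    have "twisted_comult (pure a b) = split (A.act_left a (\<Delta>A a1)) (B.act_left b (\<Delta>B b1))"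
      using ab A.comult_left[of a] B.comult_left[of b] by (simp add: twisted_comult_pure)
    also have "\<dots> = C.act_left (pure a b1) (C.act_left (pure a1 b) (split (\<Delta>A a1) (\<Delta>B b1)))"
      using ab by (simp add: act_left_split act_left_split_copairing)
    also have "\<dots> = C.act_left (pure a b) (split (\<Delta>A a1) (\<Delta>B b1))"
      using ab by (subst C.act_mult(1)) (simp_all add: pure_eq_star[symmetric])
    finally show "twisted_comult (pure a b) = C.act_left (pure a b) (twisted_comult (pure a1 b1))"
      by (simp add: twisted_comult_pure)
  qed simp_all
  show "twisted_comult c = C.act_right c (twisted_comult (pure a1 b1))"
  proof (rule tensor_ext[OF A.module B.module _ c twisted_comult_linear C.act_param_linear(2)])
    fix a b assume ab: "a \<in> carrier V" "b \<in> carrier W"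
    have "twisted_comult (pure a b) = split (A.act_right a (\<Delta>A a1)) (B.act_right b (\<Delta>B b1))"
      using ab A.comult_right[of a] B.comult_right[of b] by (simp add: twisted_comult_pure)
    also have "\<dots> = C.act_right (pure a1 b) (C.act_right (pure a b1) (split (\<Delta>A a1) (\<Delta>B b1)))"
      using ab by (simp add: act_right_split act_right_split_copairing)
    also have "\<dots> = C.act_right (pure a b) (split (\<Delta>A a1) (\<Delta>B b1))"
      using ab by (subst C.act_mult(2)) (simp_all add: pure_eq_star[symmetric])
    finally show "twisted_comult (pure a b) = C.act_right (pure a b) (twisted_comult (pure a1 b1))"
      by (simp add: twisted_comult_pure)
  qed simp_all
qed

lemma twisted_counit_linear: "twisted_counit \<in> linear_maps K C (scalars K)"
  unfolding twisted_counit_def comp_def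
  by (rule linear_maps_compose[OF left_unitor_linear] tensor_map_linear)+
    (simp_all add: tensor_map_linear A.counit_linear B.counit_linear)

lemmas linear_maps_twisted_counit [simp] = linear_maps_compose[OF twisted_counit_linear]

lemma counit_closed [simp]:
  "a \<in> carrier V \<Longrightarrow> \<epsilon>A a \<in> carrier K" "b \<in> carrier W \<Longrightarrow> \<epsilon>B b \<in> carrier K"
  using linear_maps_closed[OF A.counit_linear] linear_maps_closed[OF B.counit_linear] by simp_all

lemma counit_mult_closed [simp]:
  "\<lbrakk>a \<in> carrier V; b \<in> carrier W\<rbrakk> \<Longrightarrow> \<epsilon>A a \<otimes>\<^bsub>K\<^esub> \<epsilon>B b \<in> carrier K"
  using A.cring by (simp add: cring_def ring.ring_simprules(5))

lemma twisted_counit_pure: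
  "\<lbrakk>a \<in> carrier V; b \<in> carrier W\<rbrakk> \<Longrightarrow> twisted_counit (pure a b) = \<epsilon>A a \<otimes>\<^bsub>K\<^esub> \<epsilon>B b"
  by (simp add: twisted_counit_def tensor_map_pure A.counit_linear B.counit_linear left_unitor_pure)

lemma twist_smult:
  assumes "a \<in> carrier V" "b \<in> carrier W" "r \<in> carrier K"
  shows "twist (r \<odot>\<^bsub>W\<^esub> b) a = r \<odot>\<^bsub>C\<^esub> twist b a" "twist b (r \<odot>\<^bsub>V\<^esub> a) = r \<odot>\<^bsub>C\<^esub> twist b a"
  using assms by (simp_all add: pure_tensor_smult_left pure_tensor_smult_right linear_maps_smult[OF twist_linear])

lemma C_smult_assoc:
  "\<lbrakk>r \<in> carrier K; s \<in> carrier K; c \<in> carrier C\<rbrakk> \<Longrightarrow> (r \<otimes>\<^bsub>K\<^esub> s) \<odot>\<^bsub>C\<^esub> c = r \<odot>\<^bsub>C\<^esub> (s \<odot>\<^bsub>C\<^esub> c)"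
  by (rule module.smult_assoc1) simp_all

lemma linear_maps_smult_const:
  "\<lbrakk>f \<in> linear_maps K L C; r \<in> carrier K\<rbrakk> \<Longrightarrow> (\<lambda>x. r \<odot>\<^bsub>C\<^esub> f x) \<in> linear_maps K L C"
  using scalars_smult_bilinear(1)[of K C]
  by - (rule linear_maps_compose[of "smult C r"], simp_all add: bilinear_maps_def)

text \<open>In the form with legs x u and v y, the counit of B contracts u and turns v into
  \<open>b1\<close>. The crossing of \<open>b1\<close> with y is then trivial, and the counit of A
  acting on \<open>s\<close> is all that is left.\<close>

lemma twisted_counit_left:
  assumes s: "s \<in> carrier VV"
  shows "left_unitor C (tensor_map K (scalars K) C twisted_counit id (split s (\<Delta>B b1)))
    = pure (left_unitor V (tensor_map K (scalars K) V \<epsilon>A id s)) b1"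
proof (rule tensor_ext[OF _ _ _ s])
  show "(\<lambda>s. left_unitor C (tensor_map K (scalars K) C twisted_counit id (split s (\<Delta>B b1)))) \<in> linear_maps K VV C"
    by (rule linear_maps_left_unitor linear_maps_tensor_map[where M=C and N=C] split_linear twisted_counit_linear)+ simp_all
  show "(\<lambda>s. pure (left_unitor V (tensor_map K (scalars K) V \<epsilon>A id s)) b1) \<in> linear_maps K VV C"
    by (rule lin_rules B.unit_closed)+
  fix x y assume xy: "x \<in> carrier V" "y \<in> carrier V"
  \<comment> \<open>Stated for an arbitrary \<open>t\<close> so that pure tensors suffice; the
    copairing of B is substituted afterwards.\<close>
  have "left_unitor C (tensor_map K (scalars K) C (\<lambda>u. twisted_counit (pure x u)) (\<lambda>v. twist v y) t)
      = \<epsilon>A x \<odot>\<^bsub>C\<^esub> twist (left_unitor W (tensor_map K (scalars K) W \<epsilon>B id t)) y"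
    if t: "t \<in> carrier WW" for t
  proof (rule tensor_ext[OF _ _ _ t])
    show "(\<lambda>t. left_unitor C (tensor_map K (scalars K) C (\<lambda>u. twisted_counit (pure x u)) (\<lambda>v. twist v y) t)) \<in> linear_maps K WW C"
      by (rule linear_maps_left_unitor tensor_map_linear)+ (use xy in simp_all)
    show "(\<lambda>t. \<epsilon>A x \<odot>\<^bsub>C\<^esub> twist (left_unitor W (tensor_map K (scalars K) W \<epsilon>B id t)) y) \<in> linear_maps K WW C"
      by (rule linear_maps_smult_const lin_rules counit_closed xy)+
  qed (use xy in \<open>simp_all add: tensor_map_pure left_unitor_pure twisted_counit_pure B.counit_linear twist_smult C_smult_assoc\<close>)
  note counit = this[OF B.comult_closed[OF B.unit_closed]]
  have "tensor_map K (scalars K) C twisted_counit id (tensor_map K C C (pure x) (\<lambda>v. twist v y) (\<Delta>B b1))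
      = tensor_map K (scalars K) C (\<lambda>u. twisted_counit (pure x u)) (\<lambda>v. id (twist v y)) (\<Delta>B b1)"
    by (rule tensor_map_compose[where M=W and N=W]) (use xy in \<open>simp_all add: twisted_counit_linear\<close>)
  then show "left_unitor C (tensor_map K (scalars K) C twisted_counit id (split (pV x y) (\<Delta>B b1)))
    = pure (left_unitor V (tensor_map K (scalars K) V \<epsilon>A id (pV x y))) b1"
    using xy by (simp add: split_copairing_right counit B.counit_left tensor_map_pure A.counit_linear
        left_unitor_pure pure_tensor_smult_left)
qed simp_all

text \<open>Uses the other form, with legs u x and y v: the counit of A contracts y and turns x into
  \<open>a1\<close>, and \<open>u\<close> crosses \<open>a1\<close> trivially.\<close>

lemma twisted_counit_right:
  assumes t: "t \<in> carrier WW"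
  shows "right_unitor C (tensor_map K C (scalars K) id twisted_counit (split (\<Delta>A a1) t))
    = pure a1 (right_unitor W (tensor_map K W (scalars K) id \<epsilon>B t))"
proof (rule tensor_ext[OF _ _ _ t])
  show "(\<lambda>t. right_unitor C (tensor_map K C (scalars K) id twisted_counit (split (\<Delta>A a1) t))) \<in> linear_maps K WW C"
    by (rule linear_maps_right_unitor linear_maps_tensor_map[where M=C and N=C] split_linear twisted_counit_linear)+ simp_all
  show "(\<lambda>t. pure a1 (right_unitor W (tensor_map K W (scalars K) id \<epsilon>B t))) \<in> linear_maps K WW C"
    by (rule lin_rules A.unit_closed)+
  fix u v assume uv: "u \<in> carrier W" "v \<in> carrier W"
  have "right_unitor C (tensor_map K C (scalars K) (\<lambda>x. twist u x) (\<lambda>y. twisted_counit (pure y v)) s)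
      = \<epsilon>B v \<odot>\<^bsub>C\<^esub> twist u (right_unitor V (tensor_map K V (scalars K) id \<epsilon>A s))"
    if s: "s \<in> carrier VV" for s
  proof (rule tensor_ext[OF _ _ _ s])
    show "(\<lambda>s. right_unitor C (tensor_map K C (scalars K) (\<lambda>x. twist u x) (\<lambda>y. twisted_counit (pure y v)) s)) \<in> linear_maps K VV C"
      by (rule linear_maps_right_unitor tensor_map_linear)+ (use uv in simp_all)
    show "(\<lambda>s. \<epsilon>B v \<odot>\<^bsub>C\<^esub> twist u (right_unitor V (tensor_map K V (scalars K) id \<epsilon>A s))) \<in> linear_maps K VV C"
      by (rule linear_maps_smult_const lin_rules counit_closed uv)+
  \<comment> \<open>Commutativity of \<open>K\<close> is applied here: the counit of
    \<open>C\<close> yields the A scalar before the B scalar, and the other side has them in the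
    opposite order.\<close>
  qed (use uv in \<open>simp_all add: tensor_map_pure right_unitor_pure twisted_counit_pure A.counit_linear twist_smult
        C_smult_assoc[symmetric] cring.cring_simprules(14)[OF A.cring]\<close>)
  note counit = this[OF A.comult_closed[OF A.unit_closed]]
  have "tensor_map K C (scalars K) id twisted_counit (tensor_map K C C (\<lambda>x. twist u x) (\<lambda>y. pure y v) (\<Delta>A a1))
      = tensor_map K C (scalars K) (\<lambda>x. id (twist u x)) (\<lambda>y. twisted_counit (pure y v)) (\<Delta>A a1)"
    by (rule tensor_map_compose[where M=V and N=V]) (use uv in \<open>simp_all add: twisted_counit_linear\<close>)
  then show "right_unitor C (tensor_map K C (scalars K) id twisted_counit (split (\<Delta>A a1) (pW u v)))
    = pure a1 (right_unitor W (tensor_map K W (scalars K) id \<epsilon>B (pW u v)))"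
    using uv by (simp add: split_copairing_left counit A.counit_right tensor_map_pure B.counit_linear
        right_unitor_pure pure_tensor_smult_right)
qed simp_all

lemma casimir_twisted: "casimir_algebra K C twisted_mult (pure a1 b1) twisted_comult twisted_counit"
proof (intro casimir_algebra.intro casimir_algebra_axioms.intro)
  show "left_unitor C (tensor_map K (scalars K) C twisted_counit id (twisted_comult (pure a1 b1))) = pure a1 b1"
    by (simp add: twisted_comult_pure twisted_counit_left A.counit_left)
  show "right_unitor C (tensor_map K C (scalars K) id twisted_counit (twisted_comult (pure a1 b1))) = pure a1 b1"
    by (simp add: twisted_comult_pure twisted_counit_right B.counit_right)
qed (fact C.unital_algebra_axioms twisted_comult_linear twisted_counit_linear twisted_comult_act)+

lemma twisted_special:
  assumes "c \<in> carrier C"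
  shows "twisted_mult (twisted_comult c) = c"
proof (rule star_ext[OF assms])
  show "(\<lambda>c. twisted_mult (twisted_comult c)) \<in> linear_maps K C C"
    by (rule linear_maps_compose[OF twisted_mult_linear twisted_comult_linear])
  fix a b assume "a \<in> carrier V" "b \<in> carrier W"
  then show "twisted_mult (twisted_comult (pure a b)) = pure a b"
    by (simp add: twisted_comult_pure twisted_mult_def join_split tensor_map_pure A.mult_linear B.mult_linear
        special_left special_right)
qed simp

end

lemma special_frobenius_algebra_iff:
  assumes "module K (space A)" "unit A \<in> linear_maps K (scalars K) (space A)"
  shows "special_frobenius_algebra K A \<longleftrightarrow>
    casimir_algebra K (space A) (nabla A) (unit A \<one>\<^bsub>K\<^esub>) (delta A) (counit A) \<and>
    (\<forall>a \<in> carrier (space A). nabla A (delta A a) = a)"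
  by (simp add: special_frobenius_algebra_def frobenius_algebra_iff[OF assms])

lemma special_frobenius_algebra_module_unit:
  assumes "special_frobenius_algebra K A"
  shows "module K (space A)" "unit A \<in> linear_maps K (scalars K) (space A)"
  using assms
  by (auto simp: special_frobenius_algebra_def frobenius_algebra_def Let_def assoc_unital_algebra_def)

theorem corollary5p5:
  fixes K :: "('k, 'r) ring_scheme"
    and A :: "('k, 'a) frobenius"
    and B :: "('k, 'b) frobenius"
    and \<tau> :: "('b \<times> 'a \<Rightarrow>\<^sub>0 int) set \<Rightarrow> ('a \<times> 'b \<Rightarrow>\<^sub>0 int) set"
  assumes "field K"
    and "special_frobenius_algebra K A"
    and "special_frobenius_algebra K B"
    and "twisting_map K A B \<tau>"
    and "\<forall>x \<in> carrier (tensor K (space B) (space A)).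
           tensor_map K (tensor K (space A) (space A)) (tensor K (space B) (space B))
               (delta A) (delta B) (\<tau> x)
             = double_twist K (space A) (space B) \<tau>
                 (tensor_map K (tensor K (space B) (space B)) (tensor K (space A) (space A))
                    (delta B) (delta A) x)"
  shows "special_frobenius_algebra K (twisted_tensor_product K A B \<tau>)"
proof -
  note A = special_frobenius_algebra_module_unit[OF assms(2)]
  note B = special_frobenius_algebra_module_unit[OF assms(3)]
  interpret A: casimir_algebra K "space A" "nabla A" "unit A \<one>\<^bsub>K\<^esub>" "delta A" "counit A"
    using special_frobenius_algebra_iff[OF A] assms(2) by simp
  interpret B: casimir_algebra K "space B" "nabla B" "unit B \<one>\<^bsub>K\<^esub>" "delta B" "counit B"
    using special_frobenius_algebra_iff[OF B] assms(3) by simp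
  have special: "a \<in> carrier (space A) \<Longrightarrow> nabla A (delta A a) = a"
    "b \<in> carrier (space B) \<Longrightarrow> nabla B (delta B b) = b" for a b
    using assms(2,3) by (simp_all add: special_frobenius_algebra_def)
  interpret twisted_frobenius K "space A" "nabla A" "unit A \<one>\<^bsub>K\<^esub>" "delta A" "counit A"
    "space B" "nabla B" "unit B \<one>\<^bsub>K\<^esub>" "delta B" "counit B" \<tau>
    by (intro twisted_frobenius.intro twisted_algebras.intro twisted_algebras_axioms.intro
        twisted_frobenius_axioms.intro A.casimir_algebra_axioms B.casimir_algebra_axioms
        A.unital_algebra_axioms B.unital_algebra_axioms special)
      (use assms(4,5) in \<open>simp_all add: twisting_map_def Let_def\<close>)
  let ?T = "twisted_tensor_product K A B \<tau>"
  have T: "space ?T = tensor K (space A) (space B)" "nabla ?T = twisted_mult" "delta ?T = twisted_comult"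
    "counit ?T = twisted_counit"
    "unit ?T = (\<lambda>r. tensor_map K (space A) (space B) (unit A) (unit B)
        (pure_tensor K (scalars K) (scalars K) r \<one>\<^bsub>K\<^esub>))"
    by (simp_all add: twisted_tensor_product_def Let_def twisted_mult_def twisted_comult_def
        twisted_counit_def untwist_def)
  interpret cring K by (rule A.cring)
  have unit: "unit ?T \<in> linear_maps K (scalars K) (space ?T)"
    unfolding T
    by (rule linear_maps_compose[OF tensor_map_linear linear_maps_pure_tensor(1)]) (simp_all add: A B)
  have unit1: "unit ?T \<one>\<^bsub>K\<^esub> = pure_tensor K (space A) (space B) (unit A \<one>\<^bsub>K\<^esub>) (unit B \<one>\<^bsub>K\<^esub>)"
    unfolding T by (simp add: tensor_map_pure A B)
  have "module K (space ?T)"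
    by (simp add: T)
  then show ?thesis
    using special_frobenius_algebra_iff[OF _ unit] casimir_twisted twisted_special
    unfolding unit1 by (simp add: T(1-4))
qed

end
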